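(* With $c_0=\frac{8}{15\pi^2}$, there is a finite constant $C_0$ such that \[ M_a=\#\{n:\lambda_n(\ell)\in(\tfrac14,\tfrac34)\}\ \ge\ c_0\ln\ell-C_0\qquad\text{for every }\ell>0 . \]
   Context: Let $Q$ be the orthogonal projection of $L^2(\mathbb{R})$ onto functions with Fourier support in $(-\frac12,\frac12)$ (Fourier transform $\int f(x)e^{-2\pi i x\xi}dx$), i.e. the integral operator with kernel $\operatorname{sinc}(x-y)$, $\operatorname{sinc}(t)=\sin(\pi t)/(\pi t)$, $\operatorname{sinc}(0)=1$. For $\ell>0$ let $P$ be multiplication by the indicator of $(0,\ell)$ and $S_\ell=PQP$ on $L^2(0,\ell)$, with eigenvalues $1>\lambda_0(\ell)\ge\lambda_1(\ell)\ge\cdots>0$ (with multiplicity). *)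

theory Defs
  imports "HOL-Analysis.Analysis"
begin

definition nsinc :: "real \<Rightarrow> real" where
  "nsinc t = (if t = 0 then 1 else sin (pi * t) / (pi * t))"

text \<open>
  Elements of \<open>L\<^sup>2\<close> are represented by measurable functions; equality in \<open>L\<^sup>2\<close> is
  equality almost everywhere.
\<close>

definition L2 :: "'a measure \<Rightarrow> ('a \<Rightarrow> complex) set" where
  "L2 M = {f \<in> borel_measurable M. integrable M (\<lambda>x. (norm (f x))\<^sup>2)}"

text \<open>
  The projection of \<open>L\<^sup>2(\<real>)\<close> onto the functions with Fourier support in
  \<open>(-1/2, 1/2)\<close>, as an integral operator. For \<open>f\<close> in \<open>L\<^sup>2(\<real>)\<close> the integral converges
  absolutely for every \<open>x\<close>, since \<open>nsinc\<close> is square integrable.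
\<close>

definition Q_op :: "(real \<Rightarrow> complex) \<Rightarrow> real \<Rightarrow> complex" where
  "Q_op f x = (LINT y|lborel. of_real (nsinc (x - y)) * f y)"

definition P_op :: "real \<Rightarrow> (real \<Rightarrow> complex) \<Rightarrow> real \<Rightarrow> complex" where
  "P_op l f x = indicator {0<..<l} x * f x"

definition S_op :: "real \<Rightarrow> (real \<Rightarrow> complex) \<Rightarrow> real \<Rightarrow> complex" where
  "S_op l f = P_op l (Q_op (P_op l f))"

abbreviation interval_measure_on :: "real \<Rightarrow> real measure" where
  "interval_measure_on l \<equiv> restrict_space lborel {0<..<l}"

definition S_eigenspace :: "real \<Rightarrow> complex \<Rightarrow> (real \<Rightarrow> complex) set" where
  "S_eigenspace l \<mu> =
     {f \<in> L2 (interval_measure_on l). AE x in interval_measure_on l. S_op l f x = \<mu> * f x}"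

text \<open>
  The complex dimension of a space \<open>V\<close> of functions is \<open>d\<close>, after functions that agree almost
  everywhere have been identified: \<open>b 0, \<dots>, b (d - 1)\<close> is a basis.
\<close>

definition has_dim_AE :: "'a measure \<Rightarrow> ('a \<Rightarrow> complex) set \<Rightarrow> nat \<Rightarrow> bool" where
  "has_dim_AE M V d \<longleftrightarrow> (\<exists>b :: nat \<Rightarrow> 'a \<Rightarrow> complex.
     (\<forall>i<d. b i \<in> V) \<and>
     (\<forall>c :: nat \<Rightarrow> complex. (AE x in M. (\<Sum>i<d. c i * b i x) = 0) \<longrightarrow> (\<forall>i<d. c i = 0)) \<and>
     (\<forall>f\<in>V. \<exists>c :: nat \<Rightarrow> complex. AE x in M. f x = (\<Sum>i<d. c i * b i x)))"

text \<open>
  \<open>lam\<close> lists the eigenvalues of \<open>S_op l\<close> on \<open>L\<^sup>2(0, l)\<close> in nonincreasing order, each value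
  repeated according to the dimension of its eigenspace. Values \<open>\<mu>\<close> that are not eigenvalues
  have a zero-dimensional eigenspace and so do not occur.
\<close>

definition lists_eigenvalues :: "real \<Rightarrow> (nat \<Rightarrow> real) \<Rightarrow> bool" where
  "lists_eigenvalues l lam \<longleftrightarrow> decseq lam \<and>
     (\<forall>\<mu> :: complex. finite {n. of_real (lam n) = \<mu>} \<and>
        has_dim_AE (interval_measure_on l) (S_eigenspace l \<mu>) (card {n. of_real (lam n) = \<mu>}))"

text \<open>
  The listing exists for \<open>l > 0\<close> because \<open>S_op l\<close> is compact, self-adjoint, positive and
  injective on \<open>L\<^sup>2(0, l)\<close>; it is unique because a nonincreasing sequence is determined by how
  often it takes each value, when this is finite.
\<close>

definition eigenvalue :: "real \<Rightarrow> nat \<Rightarrow> real" where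
  "eigenvalue l = (THE lam. lists_eigenvalues l lam)"

end

theory Submission
  imports Defs "HOL-Complex_Analysis.Great_Picard"
begin

text \<open>
  Write \<open>S = PQP\<close>. Since \<open>Q\<close> is a projection, \<open>S - S\<^sup>2 = PQ(1 - P)QP\<close>, so that
  \<open>\<langle>(S - S\<^sup>2)f, f\<rangle> = \<parallel>(1 - P)Qf\<parallel>\<^sup>2\<close> for \<open>f\<close> supported in \<open>(0, l)\<close>: this is the energy which
  band-limiting moves out of the interval. An eigenvalue \<open>\<lambda>\<close> lies in \<open>(1/4, 3/4)\<close> exactly
  when \<open>\<lambda> - \<lambda>\<^sup>2 > 3/16\<close>. By the variational principle it is therefore enough to find a space of
  test functions of dimension \<open>(8 / (15 \<pi>\<^sup>2)) ln l - O(1)\<close>, each of which loses more than \<open>3/16\<close>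
  of its energy.

  Only the energy on \<open>(-l, 0)\<close>, beyond the left endpoint, is used. For \<open>x, y > 0\<close> the kernel
  between \<open>-x\<close> and \<open>y\<close> is \<open>sin (\<pi>(x + y)) / (\<pi>(x + y))\<close>. Applied to a wave of frequency
  \<open>\<plusminus>1/2\<close> with a slowly varying amplitude, and paired with the reflection of such a wave, it acts on
  the amplitudes as \<open>1 / (4\<pi>)\<close> times Carleman's kernel \<open>1 / (x + y)\<close>, up to oscillating terms.
  Carleman's kernel has norm \<open>\<pi>\<close> and commutes with dilations; its approximate eigenfunctions for
  the value \<open>\<pi>\<close> are \<open>1 / \<surd>x\<close> on long logarithmic scales. So the interval is cut into the blocks
  \<open>(exp (kT), exp ((k + 1)T))\<close>, and each block carries the two test functions
  \<open>cos (\<pi>y) / \<surd>y\<close> and \<open>sin (\<pi>y) / \<surd>y\<close>. With \<open>T = 15 \<pi>\<^sup>2 / 4\<close> these are \<open>2 / T = 8 / (15 \<pi>\<^sup>2)\<close>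
  functions per unit of \<open>ln l\<close>. This \<open>T\<close> is just long enough: up to small errors, the pairing is
  at least \<open>T/4 - 836 / (225 \<pi>)\<close> per unit of coefficient energy, the squared norm is \<open>T/2\<close>, and
  their ratio exceeds \<open>\<surd>3 / 4\<close>, which is what an energy loss of \<open>3/16\<close> requires
  (\<open>test_space_defect\<close>).

  The variational principle needs the eigenvalues. A compact positive contraction on a
  semi-inner product space has a sequence of eigenvectors obtained by successively maximising
  the Rayleigh quotient (\<open>eigensystem_exists\<close>).
  For the operator at hand, compactness is the Arzela-Ascoli theorem, and \<open>0 \<le> S \<le> 1\<close> and
  injectivity follow from the fact that \<open>\<langle>Sf, f\<rangle>\<close> is the integral of
  the squared modulus of the Fourier transform of \<open>f\<close> over \<open>[-1/2, 1/2]\<close>. Real functions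
  suffice, as the kernel is real; complex eigenfunctions are split into real and imaginary parts
  to see that the sequence so obtained is the list of eigenvalues (\<open>eigenvalue_eq\<close>).
\<close>

section \<open>Homogeneous linear systems and quadratics\<close>

text \<open>
  Gaussian elimination on one equation at a time. It serves three purposes below: dimensions are
  well defined, \<open>L\<^sup>2\<close> is infinite-dimensional, and a large space of test functions contains one that is
  orthogonal to few eigenvectors.
\<close>

lemma homogeneous_system_nontrivial:
  fixes A :: "'i \<Rightarrow> 'j \<Rightarrow> 'a::field"
  assumes "finite J" "finite I" "card J < card I"
  shows "\<exists>c. (\<exists>i\<in>I. c i \<noteq> 0) \<and> (\<forall>j\<in>J. (\<Sum>i\<in>I. c i * A i j) = 0)"
  using assms
proof (induction J arbitrary: I A rule: finite_induct)
  case empty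
  then obtain i where "i \<in> I" by fastforce
  then show ?case by (intro exI[of _ "\<lambda>_. 1"]) auto
next
  case (insert j J)
  show ?case
  proof (cases "\<forall>i\<in>I. A i j = 0")
    case True
    have "card J < card I" using insert by simp
    then obtain c where "\<exists>i\<in>I. c i \<noteq> 0" "\<forall>j\<in>J. (\<Sum>i\<in>I. c i * A i j) = 0"
      using insert.IH[of I A] insert.prems by blast
    with True show ?thesis by (intro exI[of _ c]) auto
  next
    case False
    then obtain p where p: "p \<in> I" "A p j \<noteq> 0" by blast
    define A' where "A' i k = A i k - A i j / A p j * A p k" for i k
    have "card J < card (I - {p})" using insert p by simp
    then obtain c where c: "\<exists>i\<in>I-{p}. c i \<noteq> 0" "\<forall>k\<in>J. (\<Sum>i\<in>I-{p}. c i * A' i k) = 0"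
      using insert.IH[of "I-{p}" A'] insert.prems by blast
    define c' where "c' = c(p := - (\<Sum>i\<in>I-{p}. c i * A i j) / A p j)"
    have split: "(\<Sum>i\<in>I. c' i * A i k) = c' p * A p k + (\<Sum>i\<in>I-{p}. c i * A i k)" for k
    proof -
      have "(\<Sum>i\<in>I-{p}. c' i * A i k) = (\<Sum>i\<in>I-{p}. c i * A i k)"
        by (rule sum.cong) (auto simp: c'_def)
      then show ?thesis using p insert.prems by (simp add: sum.remove)
    qed
    have c'p: "c' p = - (\<Sum>i\<in>I-{p}. c i * A i j) / A p j" by (simp add: c'_def)
    have "(\<Sum>i\<in>I. c' i * A i j) = 0"
      unfolding split c'p using p by simp
    moreover have "(\<Sum>i\<in>I. c' i * A i k) = 0" if "k \<in> J" for k
    proof -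
      have "0 = (\<Sum>i\<in>I-{p}. c i * A i k - c i * A i j * (A p k / A p j))"
        using c(2) that by (simp add: A'_def algebra_simps)
      also have "\<dots> = (\<Sum>i\<in>I-{p}. c i * A i k) - (\<Sum>i\<in>I-{p}. c i * A i j) * (A p k / A p j)"
        by (simp only: sum_subtractf sum_distrib_right)
      finally show ?thesis unfolding split c'p by simp
    qed
    moreover have "\<exists>i\<in>I. c' i \<noteq> 0" using c(1) by (auto simp: c'_def)
    ultimately show ?thesis by blast
  qed
qed

lemma nonneg_quadratic_discriminant:
  fixes a b c :: real
  assumes nonneg: "\<And>t. 0 \<le> a + 2 * t * b + t\<^sup>2 * c" and "0 \<le> c"
  shows "b\<^sup>2 \<le> a * c"
proof (cases "c = 0")
  case True
  have "b = 0"
  proof (rule ccontr)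
    assume "b \<noteq> 0"
    then show False using nonneg[of "-(a + 1) / (2 * b)"] True by (simp add: field_simps)
  qed
  with True show ?thesis by simp
next
  case False
  with \<open>0 \<le> c\<close> have "0 < c" by simp
  have "0 \<le> c * (a + 2 * (-b/c) * b + (-b/c)\<^sup>2 * c)"
    using nonneg[of "-b/c"] \<open>0 < c\<close> by (intro mult_nonneg_nonneg) auto
  also have "\<dots> = a * c - b\<^sup>2"
    using \<open>0 < c\<close> by (simp add: field_simps power2_eq_square)
  finally show ?thesis by simp
qed

section \<open>Spectra of compact positive contractions\<close>

text \<open>
  The inner product is only semi-definite, because functions that agree almost everywhere are not
  identified. Linear structure is pointwise, and a single rule for \<open>f + c g\<close> provides
  both additivity and homogeneity.
\<close>

locale semi_inner_product =
  fixes V :: "('a \<Rightarrow> real) set" and ip :: "('a \<Rightarrow> real) \<Rightarrow> ('a \<Rightarrow> real) \<Rightarrow> real"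
  assumes lincomb_closed: "f \<in> V \<Longrightarrow> g \<in> V \<Longrightarrow> (\<lambda>x. f x + c * g x) \<in> V"
    and ip_commute: "f \<in> V \<Longrightarrow> g \<in> V \<Longrightarrow> ip f g = ip g f"
    and ip_lincomb_left:
      "f \<in> V \<Longrightarrow> g \<in> V \<Longrightarrow> h \<in> V \<Longrightarrow> ip (\<lambda>x. f x + c * g x) h = ip f h + c * ip g h"
    and ip_nonneg: "f \<in> V \<Longrightarrow> 0 \<le> ip f f"
begin

lemma ip_lincomb_right:
  "f \<in> V \<Longrightarrow> g \<in> V \<Longrightarrow> h \<in> V \<Longrightarrow> ip h (\<lambda>x. f x + c * g x) = ip h f + c * ip h g"
  using ip_lincomb_left[of f g h c] ip_commute[of h "\<lambda>x. f x + c * g x"]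
    ip_commute[of f h] ip_commute[of g h] lincomb_closed[of f g c] by metis

lemma ip_lincomb_self:
  assumes "f \<in> V" "g \<in> V"
  shows "ip (\<lambda>x. f x + c * g x) (\<lambda>x. f x + c * g x) = ip f f + 2 * c * ip f g + c\<^sup>2 * ip g g"
proof -
  have "ip g f = ip f g" by (rule ip_commute[OF assms(2,1)])
  then show ?thesis using assms
    by (simp add: ip_lincomb_left ip_lincomb_right lincomb_closed power2_eq_square algebra_simps)
qed

lemma scale_closed:
  assumes "f \<in> V" shows "(\<lambda>x. c * f x) \<in> V"
proof -
  have "(\<lambda>x. c * f x) = (\<lambda>x. f x + (c - 1) * f x)" by (simp add: algebra_simps)
  then show ?thesis using lincomb_closed[OF assms assms, of "c - 1"] by simp
qed

lemma ip_scale_left: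
  assumes "f \<in> V" "h \<in> V" shows "ip (\<lambda>x. c * f x) h = c * ip f h"
proof -
  have "(\<lambda>x. c * f x) = (\<lambda>x. f x + (c - 1) * f x)" by (simp add: algebra_simps)
  then show ?thesis using ip_lincomb_left[OF assms(1) assms, of "c - 1"]
    by (simp add: algebra_simps)
qed

lemma ip_scale_right:
  assumes "f \<in> V" "h \<in> V" shows "ip h (\<lambda>x. c * f x) = c * ip h f"
  using ip_scale_left[OF assms, of c] ip_commute[OF assms] ip_commute[OF assms(2) scale_closed[OF assms(1), of c]]
  by simp

lemma diff_closed: "f \<in> V \<Longrightarrow> g \<in> V \<Longrightarrow> (\<lambda>x. f x - g x) \<in> V"
  using lincomb_closed[of f g "-1"] by simp

lemma ip_diff_left:
  "f \<in> V \<Longrightarrow> g \<in> V \<Longrightarrow> h \<in> V \<Longrightarrow> ip (\<lambda>x. f x - g x) h = ip f h - ip g h"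
  using ip_lincomb_left[of f g h "-1"] by simp

lemma sum_closed:
  assumes "finite I" "V \<noteq> {}" "\<And>i. i \<in> I \<Longrightarrow> g i \<in> V"
  shows "(\<lambda>x. \<Sum>i\<in>I. c i * g i x) \<in> V"
  using assms(1,3)
proof (induction I rule: finite_induct)
  case empty
  obtain f where "f \<in> V" using \<open>V \<noteq> {}\<close> by blast
  then show ?case using scale_closed[of f 0] by simp
next
  case (insert i I)
  then show ?case
    using lincomb_closed[of "\<lambda>x. \<Sum>i\<in>I. c i * g i x" "g i" "c i"] by (simp add: add.commute)
qed

lemma ip_sum_left:
  assumes "finite I" "\<And>i. i \<in> I \<Longrightarrow> g i \<in> V" "h \<in> V"
  shows "ip (\<lambda>x. \<Sum>i\<in>I. c i * g i x) h = (\<Sum>i\<in>I. c i * ip (g i) h)"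
  using assms(1,2)
proof (induction I rule: finite_induct)
  case empty
  show ?case using ip_scale_left[OF \<open>h \<in> V\<close> \<open>h \<in> V\<close>, of 0] by simp
next
  case (insert i I)
  have "V \<noteq> {}" using \<open>h \<in> V\<close> by blast
  then have "(\<lambda>x. \<Sum>i\<in>I. c i * g i x) \<in> V" using insert by (intro sum_closed) auto
  then show ?case
    using ip_lincomb_left[of "\<lambda>x. \<Sum>i\<in>I. c i * g i x" "g i" h "c i"] insert \<open>h \<in> V\<close>
    by (simp add: add.commute)
qed

lemma ip_sum_right:
  assumes "finite I" "\<And>i. i \<in> I \<Longrightarrow> g i \<in> V" "h \<in> V"
  shows "ip h (\<lambda>x. \<Sum>i\<in>I. c i * g i x) = (\<Sum>i\<in>I. c i * ip h (g i))"
proof -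
  have "ip h (\<lambda>x. \<Sum>i\<in>I. c i * g i x) = ip (\<lambda>x. \<Sum>i\<in>I. c i * g i x) h"
    using assms by (intro ip_commute sum_closed) auto
  also have "\<dots> = (\<Sum>i\<in>I. c i * ip (g i) h)" by (rule ip_sum_left[OF assms])
  also have "\<dots> = (\<Sum>i\<in>I. c i * ip h (g i))" using assms by (intro sum.cong) (auto simp: ip_commute)
  finally show ?thesis .
qed

lemma Cauchy_Schwarz:
  assumes "f \<in> V" "g \<in> V"
  shows "(ip f g)\<^sup>2 \<le> ip f f * ip g g"
proof (rule nonneg_quadratic_discriminant)
  fix t
  show "0 \<le> ip f f + 2 * t * ip f g + t\<^sup>2 * ip g g"
    using ip_nonneg[OF lincomb_closed[OF assms, of t]] by (simp add: ip_lincomb_self assms)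
qed (rule ip_nonneg[OF assms(2)])

lemma Cauchy_Schwarz_abs:
  assumes "f \<in> V" "g \<in> V"
  shows "\<bar>ip f g\<bar> \<le> sqrt (ip f f) * sqrt (ip g g)"
  using real_sqrt_le_mono[OF Cauchy_Schwarz[OF assms]] by (simp add: real_sqrt_mult)

text \<open>
  Convergence in norm makes inner products converge, even against a test vector that varies with
  the index but stays bounded. The varying test vector is needed where a sequence is paired with
  itself.
\<close>

lemma ip_tendsto:
  assumes lim: "(\<lambda>n. ip (\<lambda>x. F n x - g x) (\<lambda>x. F n x - g x)) \<longlonglongrightarrow> 0"
    and F: "\<And>n. F n \<in> V" and g: "g \<in> V"
    and w: "\<And>n. w n \<in> V" "\<And>n. ip (w n) (w n) \<le> B"
  shows "(\<lambda>n. ip (F n) (w n) - ip g (w n)) \<longlonglongrightarrow> 0"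
proof (rule tendsto_rabs_zero_cancel, rule tendsto_sandwich[OF _ _ tendsto_const])
  have "(\<lambda>n. sqrt (ip (\<lambda>x. F n x - g x) (\<lambda>x. F n x - g x)) * sqrt B) \<longlonglongrightarrow> sqrt 0 * sqrt B"
    by (intro tendsto_intros lim)
  then show "(\<lambda>n. sqrt (ip (\<lambda>x. F n x - g x) (\<lambda>x. F n x - g x)) * sqrt B) \<longlonglongrightarrow> 0" by simp
  show "\<forall>\<^sub>F n in sequentially. \<bar>ip (F n) (w n) - ip g (w n)\<bar>
      \<le> sqrt (ip (\<lambda>x. F n x - g x) (\<lambda>x. F n x - g x)) * sqrt B"
  proof (intro always_eventually allI)
    fix n
    have "\<bar>ip (F n) (w n) - ip g (w n)\<bar> = \<bar>ip (\<lambda>x. F n x - g x) (w n)\<bar>"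
      by (simp add: ip_diff_left F g w)
    also have "\<dots> \<le> sqrt (ip (\<lambda>x. F n x - g x) (\<lambda>x. F n x - g x)) * sqrt (ip (w n) (w n))"
      by (rule Cauchy_Schwarz_abs[OF diff_closed[OF F g] w(1)])
    also have "\<dots> \<le> sqrt (ip (\<lambda>x. F n x - g x) (\<lambda>x. F n x - g x)) * sqrt B"
      using w(2) ip_nonneg[OF diff_closed[OF F g]] by (intro mult_left_mono) auto
    finally show "\<bar>ip (F n) (w n) - ip g (w n)\<bar>
      \<le> sqrt (ip (\<lambda>x. F n x - g x) (\<lambda>x. F n x - g x)) * sqrt B" .
  qed
qed auto

end

locale positive_contraction = semi_inner_product +
  fixes T
  assumes T_closed: "f \<in> V \<Longrightarrow> T f \<in> V"
    and T_lincomb: "f \<in> V \<Longrightarrow> g \<in> V \<Longrightarrow> T (\<lambda>x. f x + c * g x) = (\<lambda>x. T f x + c * T g x)"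
    and T_sym: "f \<in> V \<Longrightarrow> g \<in> V \<Longrightarrow> ip (T f) g = ip f (T g)"
    and T_nonneg: "f \<in> V \<Longrightarrow> 0 \<le> ip (T f) f"
    and T_le: "f \<in> V \<Longrightarrow> ip (T f) f \<le> ip f f"
begin

sublocale form: semi_inner_product V "\<lambda>f g. ip (T f) g"
proof
  fix f g h :: "'a \<Rightarrow> real" and c :: real
  show "f \<in> V \<Longrightarrow> g \<in> V \<Longrightarrow> (\<lambda>x. f x + c * g x) \<in> V" by (rule lincomb_closed)
  show "f \<in> V \<Longrightarrow> g \<in> V \<Longrightarrow> ip (T f) g = ip (T g) f" by (metis T_sym T_closed ip_commute)
  show "f \<in> V \<Longrightarrow> g \<in> V \<Longrightarrow> h \<in> V \<Longrightarrow>
      ip (T (\<lambda>x. f x + c * g x)) h = ip (T f) h + c * ip (T g) h"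
    by (simp add: T_lincomb ip_lincomb_left T_closed)
  show "f \<in> V \<Longrightarrow> 0 \<le> ip (T f) f" by (rule T_nonneg)
qed

text \<open>
  This is Cauchy--Schwarz for the form \<open>\<langle>T f, g\<rangle>\<close>, applied to \<open>f\<close> and \<open>T f\<close>. Only the single vector
  \<open>T f\<close> has to satisfy the bound by \<open>M\<close>, so that the lemma also serves on an invariant subspace.
\<close>

lemma norm_image_le:
  assumes "f \<in> V" and bound: "ip (T (T f)) (T f) \<le> M * ip (T f) (T f)"
  shows "ip (T f) (T f) \<le> M * ip (T f) f"
proof -
  have "(ip (T f) (T f))\<^sup>2 \<le> ip (T f) f * ip (T (T f)) (T f)"
    using form.Cauchy_Schwarz[of f "T f"] assms T_closed by simp
  also have "\<dots> \<le> ip (T f) f * (M * ip (T f) (T f))"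
    using bound T_nonneg assms by (intro mult_left_mono) auto
  finally have *: "(ip (T f) (T f))\<^sup>2 \<le> (M * ip (T f) f) * ip (T f) (T f)" by (simp add: mult_ac)
  show ?thesis
  proof (cases "ip (T f) (T f) = 0")
    case True
    have "ip (T f) f = 0"
      using Cauchy_Schwarz[of "T f" f] assms T_closed True by simp
    with True show ?thesis by simp
  next
    case False
    then have "0 < ip (T f) (T f)" using ip_nonneg[OF T_closed[OF assms(1)]] by simp
    then show ?thesis using * by (simp add: power2_eq_square)
  qed
qed

text \<open>
  In operator terms \<open>T\<^sup>2 \<le> T\<close>; this replaces the idempotence of a projection.
\<close>

lemma norm_image_le_form: "f \<in> V \<Longrightarrow> ip (T f) (T f) \<le> ip (T f) f"
  using norm_image_le[of f 1] T_le[of "T f"] T_closed by simp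

end

locale compact_positive_contraction = positive_contraction +
  assumes T_definite: "f \<in> V \<Longrightarrow> ip (T f) f = 0 \<Longrightarrow> ip f f = 0"
    and T_compact: "(\<And>n. s n \<in> V) \<Longrightarrow> (\<And>n. ip (s n) (s n) \<le> 1) \<Longrightarrow>
      \<exists>(r :: nat \<Rightarrow> nat) g. strict_mono r \<and> g \<in> V \<and>
        (\<lambda>n. ip (\<lambda>x. T (s (r n)) x - g x) (\<lambda>x. T (s (r n)) x - g x)) \<longlonglongrightarrow> 0"
    and infinite_dim: "(\<And>i. i < n \<Longrightarrow> e i \<in> V) \<Longrightarrow>
      \<exists>f\<in>V. (\<forall>i<(n::nat). ip (e i) f = 0) \<and> 0 < ip f f"
begin

text \<open>
  Eigenvectors are meant weakly: \<open>T v = \<lambda> v\<close> is tested against all \<open>w\<close>, as vectors of norm zero need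
  not vanish. The eigenvalue is the Rayleigh quotient \<open>\<langle>T v, v\<rangle>\<close>, which \<open>v\<close> maximises among the vectors
  orthogonal to \<open>e 0, \<dots>, e (n - 1)\<close>.
\<close>

definition rayleigh_eigenvector :: "(nat \<Rightarrow> 'a \<Rightarrow> real) \<Rightarrow> nat \<Rightarrow> ('a \<Rightarrow> real) \<Rightarrow> bool" where
  "rayleigh_eigenvector e n v \<longleftrightarrow> v \<in> V \<and> ip v v = 1 \<and> (\<forall>i<n. ip (e i) v = 0) \<and>
     (\<forall>w\<in>V. ip (T v) w = ip (T v) v * ip v w) \<and>
     (\<forall>f\<in>V. (\<forall>i<n. ip (e i) f = 0) \<longrightarrow> ip (T f) f \<le> ip (T v) v * ip f f)"

lemma rayleigh_eigenvectorD:
  assumes "rayleigh_eigenvector e n v"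
  shows "v \<in> V" "ip v v = 1" "\<And>i. i < n \<Longrightarrow> ip (e i) v = 0"
    "\<And>w. w \<in> V \<Longrightarrow> ip (T v) w = ip (T v) v * ip v w"
    "\<And>f. f \<in> V \<Longrightarrow> \<forall>i<n. ip (e i) f = 0 \<Longrightarrow> ip (T f) f \<le> ip (T v) v * ip f f"
  using assms unfolding rayleigh_eigenvector_def by blast+

text \<open>
  Let \<open>M\<close> be the supremum of the Rayleigh quotient on the orthogonal complement \<open>U\<close>, and \<open>t\<^sub>k\<close> a
  maximising sequence. Since \<open>\<parallel>T t\<^sub>k\<parallel>\<^sup>2 \<le> M \<langle>T t\<^sub>k, t\<^sub>k\<rangle>\<close>, the difference \<open>T t\<^sub>k - M t\<^sub>k\<close> tends to zero. By
  compactness \<open>T t\<^sub>k\<close> has a limit \<open>g\<close>, hence so has \<open>M t\<^sub>k\<close>, and \<open>g\<close> is the eigenvector.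
\<close>

lemma next_eigenvector:
  assumes e: "\<And>i. i < n \<Longrightarrow> e i \<in> V"
    and eig: "\<And>i w. i < n \<Longrightarrow> w \<in> V \<Longrightarrow> ip (T (e i)) w = ip (T (e i)) (e i) * ip (e i) w"
  shows "\<exists>v. rayleigh_eigenvector e n v"
proof -
  define U where "U = {f \<in> V. \<forall>i<n. ip (e i) f = 0}"
  have U_V: "f \<in> V" if "f \<in> U" for f using that by (simp add: U_def)
  have T_U: "T f \<in> U" if "f \<in> U" for f
  proof -
    have "ip (e i) (T f) = 0" if "i < n" for i
      using T_sym[OF e[OF that] U_V[OF \<open>f \<in> U\<close>]] eig[OF that U_V[OF \<open>f \<in> U\<close>]] \<open>f \<in> U\<close> that
      by (simp add: U_def)
    then show ?thesis using T_closed[OF U_V[OF that]] by (simp add: U_def)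
  qed
  have scale_U: "(\<lambda>x. c * f x) \<in> U" if "f \<in> U" for c f
    using that e by (auto simp: U_def scale_closed ip_scale_right)
  define A where "A = {ip (T f) f | f. f \<in> U \<and> ip f f = 1}"
  define M where "M = Sup A"
  have normed: "\<exists>f\<in>U. ip f f = 1 \<and> ip (T f) f = ip (T h) h / ip h h" if hU: "h \<in> U" and h_pos: "0 < ip h h" for h
  proof -
    obtain c where cc: "c * c = 1 / ip h h"
      using h_pos by (metis abs_of_pos divide_pos_pos real_sqrt_mult_self zero_less_one)
    have hV: "h \<in> V" using hU U_V by simp
    have "T (\<lambda>x. c * h x) = (\<lambda>x. c * T h x)"
    proof -
      have "(\<lambda>x. c * h x) = (\<lambda>x. h x + (c - 1) * h x)" by (simp add: algebra_simps)
      then show ?thesis using T_lincomb[OF hV hV, of "c - 1"] by (simp add: algebra_simps)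
    qed
    then have "ip (T (\<lambda>x. c * h x)) (\<lambda>x. c * h x) = ip (T h) h / ip h h"
      using cc by (simp add: ip_scale_left ip_scale_right hV T_closed scale_closed flip: mult.assoc)
    moreover have "ip (\<lambda>x. c * h x) (\<lambda>x. c * h x) = 1"
      using cc h_pos by (simp add: ip_scale_left ip_scale_right hV scale_closed flip: mult.assoc)
    ultimately show ?thesis using scale_U[OF hU] by blast
  qed
  obtain f where "f \<in> V" "\<forall>i<n. ip (e i) f = 0" "0 < ip f f"
    using infinite_dim[of n e, OF e] by blast
  then have "f \<in> U" "0 < ip f f" by (simp_all add: U_def)
  from normed[OF this] obtain f0 where f0: "f0 \<in> U" "ip f0 f0 = 1" by blast
  have ne: "A \<noteq> {}" using f0 by (auto simp: A_def)
  have bdd: "bdd_above A"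
  proof (rule bdd_aboveI[of _ 1])
    fix a assume "a \<in> A"
    then obtain f where "f \<in> U" "ip f f = 1" "a = ip (T f) f" by (auto simp: A_def)
    then show "a \<le> 1" using T_le[OF U_V, of f] by simp
  qed
  have "0 < ip (T f0) f0"
    using T_nonneg[OF U_V[OF f0(1)]] T_definite[OF U_V[OF f0(1)]] f0(2) by linarith
  also have "\<dots> \<le> M" unfolding M_def using f0 by (intro cSup_upper bdd) (auto simp: A_def)
  finally have M_pos: "0 < M" .
  have M_bound: "ip (T f) f \<le> M * ip f f" if fU: "f \<in> U" for f
  proof (cases "ip f f = 0")
    case True
    then have "ip (T f) f = 0"
      using Cauchy_Schwarz[OF T_closed[OF U_V[OF fU]] U_V[OF fU]] by simp
    with True show ?thesis by simp
  next
    case False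
    then have pos: "0 < ip f f" using ip_nonneg[OF U_V[OF fU]] by linarith
    then obtain h where "h \<in> U" "ip h h = 1" "ip (T h) h = ip (T f) f / ip f f"
      using normed[OF fU pos] by blast
    then have "ip (T f) f / ip f f \<in> A"
      unfolding A_def by (intro CollectI exI[of _ h]) simp
    then have "ip (T f) f / ip f f \<le> M" unfolding M_def by (intro cSup_upper bdd)
    then show ?thesis using pos by (simp add: field_simps)
  qed
  have "\<exists>f. f \<in> U \<and> ip f f = 1 \<and> M - 1 / real (Suc k) < ip (T f) f" for k
    using less_cSupD[OF ne, of "M - 1 / real (Suc k)"] by (auto simp: A_def M_def)
  then obtain s where s: "\<And>k. s k \<in> U" "\<And>k. ip (s k) (s k) = 1"
      "\<And>k. M - 1 / real (Suc k) < ip (T (s k)) (s k)"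
    by metis
  obtain r g where r: "strict_mono (r :: nat \<Rightarrow> nat)" and gV: "g \<in> V" and
      lim: "(\<lambda>k. ip (\<lambda>x. T (s (r k)) x - g x) (\<lambda>x. T (s (r k)) x - g x)) \<longlonglongrightarrow> 0"
    using T_compact[of s, OF U_V[OF s(1)] eq_refl[OF s(2)]] by blast
  define t where "t k = s (r k)" for k
  have tU: "t k \<in> U" and tV: "t k \<in> V" and t1: "ip (t k) (t k) = 1" for k
    using s U_V by (auto simp: t_def)
  have Tt: "T (t k) \<in> V" for k using tV T_closed by simp
  have limt: "(\<lambda>k. ip (\<lambda>x. T (t k) x - g x) (\<lambda>x. T (t k) x - g x)) \<longlonglongrightarrow> 0"
    using lim by (simp add: t_def)
  have ray: "(\<lambda>k. ip (T (t k)) (t k)) \<longlonglongrightarrow> M"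
  proof (rule tendsto_sandwich)
    have "(\<lambda>k. M - 1 / real (Suc k)) \<longlonglongrightarrow> M - 0"
      by (intro tendsto_intros LIMSEQ_inverse_real_of_nat[unfolded inverse_eq_divide])
    then show "(\<lambda>k. M - 1 / real (Suc (r k))) \<longlonglongrightarrow> M"
      using LIMSEQ_subseq_LIMSEQ[OF _ r, of "\<lambda>k. M - 1 / real (Suc k)"] by (simp add: o_def)
    show "\<forall>\<^sub>F k in sequentially. M - 1 / real (Suc (r k)) \<le> ip (T (t k)) (t k)"
      using s(3) by (auto simp: t_def less_imp_le)
    show "\<forall>\<^sub>F k in sequentially. ip (T (t k)) (t k) \<le> M"
      using M_bound[OF tU] t1 by simp
  qed auto
  have lim_w: "(\<lambda>k. ip (T (t k)) w) \<longlonglongrightarrow> ip g w" if "w \<in> V" for w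
    using ip_tendsto[OF limt Tt gV, of "\<lambda>_. w" "ip w w"] that LIM_zero_cancel by auto
  \<comment> \<open>Expanding the square gives at most \<open>M\<^sup>2 - M \<langle>T t\<^sub>k, t\<^sub>k\<rangle>\<close>.\<close>
  have lim_Mt: "(\<lambda>k. ip (\<lambda>x. T (t k) x - M * t k x) (\<lambda>x. T (t k) x - M * t k x)) \<longlonglongrightarrow> 0"
  proof (rule tendsto_sandwich[OF _ _ tendsto_const])
    have "(\<lambda>k. M\<^sup>2 - M * ip (T (t k)) (t k)) \<longlonglongrightarrow> M\<^sup>2 - M * M" by (intro tendsto_intros ray)
    then show "(\<lambda>k. M\<^sup>2 - M * ip (T (t k)) (t k)) \<longlonglongrightarrow> 0" by (simp add: power2_eq_square)
    show "\<forall>\<^sub>F k in sequentially. 0 \<le> ip (\<lambda>x. T (t k) x - M * t k x) (\<lambda>x. T (t k) x - M * t k x)"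
      by (intro always_eventually allI ip_nonneg diff_closed Tt scale_closed tV)
    have "ip (\<lambda>x. T (t k) x - M * t k x) (\<lambda>x. T (t k) x - M * t k x)
        \<le> M\<^sup>2 - M * ip (T (t k)) (t k)" for k
    proof -
      have "ip (T (t k)) (T (t k)) \<le> M * ip (T (t k)) (t k)"
        by (rule norm_image_le[OF tV M_bound[OF T_U[OF tU]]])
      then show ?thesis using ip_lincomb_self[OF Tt tV, of k "-M" k] t1 by simp
    qed
    then show "\<forall>\<^sub>F k in sequentially. ip (\<lambda>x. T (t k) x - M * t k x) (\<lambda>x. T (t k) x - M * t k x)
        \<le> M\<^sup>2 - M * ip (T (t k)) (t k)" by simp
  qed
  have lim_M: "(\<lambda>k. M * ip (t k) w) \<longlonglongrightarrow> ip g w" if "w \<in> V" for w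
  proof -
    have "(\<lambda>k. ip (\<lambda>x. T (t k) x - M * t k x) w) \<longlonglongrightarrow> 0"
    proof (rule tendsto_rabs_zero_cancel, rule tendsto_sandwich[OF _ _ tendsto_const])
      have "(\<lambda>k. sqrt (ip (\<lambda>x. T (t k) x - M * t k x) (\<lambda>x. T (t k) x - M * t k x)) * sqrt (ip w w))
          \<longlonglongrightarrow> sqrt 0 * sqrt (ip w w)"
        by (intro tendsto_intros lim_Mt)
      then show "(\<lambda>k. sqrt (ip (\<lambda>x. T (t k) x - M * t k x) (\<lambda>x. T (t k) x - M * t k x))
          * sqrt (ip w w)) \<longlonglongrightarrow> 0" by simp
    qed (use that in \<open>auto intro!: always_eventually Cauchy_Schwarz_abs diff_closed Tt scale_closed tV\<close>)
    then have "(\<lambda>k. ip (T (t k)) w - M * ip (t k) w) \<longlonglongrightarrow> 0"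
      using that by (simp add: ip_diff_left ip_scale_left Tt tV scale_closed)
    from tendsto_diff[OF lim_w[OF that] this] show ?thesis by simp
  qed
  have gU: "g \<in> U" unfolding U_def
  proof (intro CollectI conjI allI impI gV)
    fix i assume "i < n"
    have "ip (T (t k)) (e i) = 0" for k
      using T_U[OF tU[of k]] \<open>i < n\<close> e ip_commute[OF Tt, of "e i" k] by (auto simp: U_def)
    then have "ip g (e i) = 0" using LIMSEQ_unique[OF lim_w[OF e[OF \<open>i < n\<close>]], of 0] by simp
    then show "ip (e i) g = 0" using ip_commute[OF gV e[OF \<open>i < n\<close>]] by simp
  qed
  have eig_g: "ip (T g) w = M * ip g w" if "w \<in> V" for w
  proof -
    have "(\<lambda>k. M * ip (t k) (T w)) \<longlonglongrightarrow> ip g (T w)" by (rule lim_M[OF T_closed[OF that]])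
    moreover have "(\<lambda>k. M * ip (T (t k)) w) \<longlonglongrightarrow> M * ip g w"
      by (intro tendsto_intros lim_w that)
    ultimately have "ip g (T w) = M * ip g w"
      using T_sym[OF tV that] by (intro LIMSEQ_unique) simp_all
    then show ?thesis using T_sym[OF gV that] by simp
  qed
  have "(\<lambda>k. ip (T (t k)) (t k) - ip g (t k)) \<longlonglongrightarrow> 0"
    by (rule ip_tendsto[OF limt Tt gV tV, where B = 1]) (simp add: t1)
  from tendsto_diff[OF ray this] have "(\<lambda>k. ip (t k) g) \<longlonglongrightarrow> M"
    using ip_commute[OF gV tV] by simp
  then have "(\<lambda>k. M * ip (t k) g) \<longlonglongrightarrow> M * M" by (intro tendsto_intros)
  then have g_norm: "ip g g = M * M" using LIMSEQ_unique[OF lim_M[OF gV]] by blast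
  define v where "v = (\<lambda>x. (1 / M) * g x)"
  have vU: "v \<in> U" unfolding v_def by (rule scale_U[OF gU])
  have vV: "v \<in> V" using vU U_V by simp
  have v1: "ip v v = 1"
    using M_pos unfolding v_def
    by (simp only: ip_scale_left ip_scale_right gV scale_closed g_norm) simp
  have "ip (T v) w = M * ip v w" if "w \<in> V" for w
  proof -
    have "ip (T v) w = ip v (T w)" by (rule T_sym[OF vV that])
    also have "\<dots> = (1 / M) * ip (T g) w"
      unfolding v_def ip_scale_left[OF gV T_closed[OF that]] T_sym[OF gV that] ..
    also have "\<dots> = M * ip v w"
      unfolding v_def ip_scale_left[OF gV that] eig_g[OF that] by simp
    finally show ?thesis .
  qed
  moreover from this have "ip (T v) v = M" using v1 vV by simp
  moreover have "ip (T f) f \<le> M * ip f f" if "f \<in> V" "\<forall>i<n. ip (e i) f = 0" for f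
    using M_bound[of f] that by (simp add: U_def)
  ultimately have "rayleigh_eigenvector e n v"
    unfolding rayleigh_eigenvector_def using vV v1 vU unfolding U_def by simp
  then show ?thesis by (rule exI[where P = "rayleigh_eigenvector e n"])
qed

lemma rayleigh_eigenvector_cong:
  assumes "\<And>i. i < n \<Longrightarrow> e i = e' i"
  shows "rayleigh_eigenvector e n v = rayleigh_eigenvector e' n v"
proof -
  have "(\<forall>i<n. ip (e i) f = 0) = (\<forall>i<n. ip (e' i) f = 0)" for f using assms by simp
  then show ?thesis unfolding rayleigh_eigenvector_def by simp
qed

text \<open>
  The last clause bounds \<open>T\<close> on the remainder after \<open>n\<close> eigenvectors have been split off.
\<close>

definition eigensystem :: "(nat \<Rightarrow> 'a \<Rightarrow> real) \<Rightarrow> (nat \<Rightarrow> real) \<Rightarrow> bool" where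
  "eigensystem e lam \<longleftrightarrow>
     (\<forall>n. e n \<in> V) \<and> (\<forall>i j. ip (e i) (e j) = (if i = j then 1 else 0)) \<and>
     (\<forall>n. \<forall>w\<in>V. ip (T (e n)) w = lam n * ip (e n) w) \<and>
     (\<forall>n. 0 < lam n) \<and> decseq lam \<and> lam \<longlonglongrightarrow> 0 \<and>
     (\<forall>n. \<forall>f\<in>V. (\<forall>i<n. ip (e i) f = 0) \<longrightarrow> ip (T f) f \<le> lam n * ip f f)"

text \<open>
  Dependent choice along \<open>next_eigenvector\<close>. The eigenvalues tend to zero: if \<open>lam n \<ge> L > 0\<close>, a limit
  of a subsequence of the vectors \<open>T e\<^sub>n = lam n e\<^sub>n\<close> would be orthogonal to every \<open>e\<^sub>m\<close>, which forces
  \<open>lam\<close> to zero along the subsequence.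
\<close>

theorem eigensystem_exists: "\<exists>e lam. eigensystem e lam"
proof -
  have "\<exists>e. \<forall>n. rayleigh_eigenvector e n (e n)"
  proof (rule dependent_wellorder_choice)
    show "rayleigh_eigenvector f x r = rayleigh_eigenvector g x r" if "\<And>z. z < x \<Longrightarrow> f z = g z" for r f g x
      using that by (rule rayleigh_eigenvector_cong)
    show "\<exists>r. rayleigh_eigenvector f x r" if "\<And>y. y < x \<Longrightarrow> rayleigh_eigenvector f y (f y)" for x f
      using rayleigh_eigenvectorD[OF that] by (intro next_eigenvector) blast+
  qed
  then obtain e where "\<forall>n. rayleigh_eigenvector e n (e n)" ..
  then have ext: "rayleigh_eigenvector e n (e n)" for n by simp
  define lam where "lam n = ip (T (e n)) (e n)" for n
  have eV: "e n \<in> V" and e1: "ip (e n) (e n) = 1" for n using rayleigh_eigenvectorD[OF ext] by blast+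
  have orth_less: "ip (e i) (e j) = 0" if "i < j" for i j using rayleigh_eigenvectorD(3)[OF ext that] .
  have orth: "ip (e i) (e j) = (if i = j then 1 else 0)" for i j
    using orth_less[of i j] orth_less[of j i] e1 ip_commute[OF eV eV, of i j]
    by (cases i j rule: linorder_cases) simp_all
  have eig: "ip (T (e n)) w = lam n * ip (e n) w" if "w \<in> V" for n w
    using rayleigh_eigenvectorD(4)[OF ext that] by (simp only: lam_def)
  have max: "ip (T f) f \<le> lam n * ip f f" if "f \<in> V" "\<forall>i<n. ip (e i) f = 0" for f n
    using rayleigh_eigenvectorD(5)[OF ext that] by (simp only: lam_def)
  have pos: "0 < lam n" for n
    using T_nonneg[OF eV, of n] T_definite[OF eV, of n] e1[of n] unfolding lam_def by linarith
  have dec: "decseq lam"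
  proof (rule decseq_SucI)
    fix n
    show "lam (Suc n) \<le> lam n"
      using max[of "e (Suc n)" n] eV orth unfolding lam_def[of "Suc n"] by auto
  qed
  obtain L where L: "lam \<longlonglongrightarrow> L" "\<And>n. L \<le> lam n"
    using decseq_convergent[OF dec, of 0] pos by (metis less_imp_le)
  have "L = 0"
  proof (rule ccontr)
    assume "L \<noteq> 0"
    obtain r g where r: "strict_mono (r :: nat \<Rightarrow> nat)" and gV: "g \<in> V" and
        lim: "(\<lambda>k. ip (\<lambda>x. T (e (r k)) x - g x) (\<lambda>x. T (e (r k)) x - g x)) \<longlonglongrightarrow> 0"
      using T_compact[of e, OF eV eq_refl[OF e1]] by blast
    have "ip g (e m) = 0" for m
    proof -
      have "(\<lambda>k. ip (T (e (r k))) (e m) - ip g (e m)) \<longlonglongrightarrow> 0"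
        by (rule ip_tendsto[OF lim T_closed[OF eV] gV]) (auto simp: eV e1)
      then have "(\<lambda>k. ip (T (e (r k))) (e m)) \<longlonglongrightarrow> ip g (e m)" by (rule LIM_zero_cancel)
      moreover have "(\<lambda>k. ip (T (e (r k))) (e m)) \<longlonglongrightarrow> 0"
      proof (rule tendsto_eventually)
        show "\<forall>\<^sub>F k in sequentially. ip (T (e (r k))) (e m) = 0"
          using eventually_gt_at_top[of m]
        proof eventually_elim
          case (elim k)
          then have "r k \<noteq> m" using seq_suble[OF r, of k] by linarith
          then show ?case by (simp add: eig eV orth)
        qed
      qed
      ultimately show ?thesis using LIMSEQ_unique by blast
    qed
    moreover have "(\<lambda>k. ip (T (e (r k))) (e (r k)) - ip g (e (r k))) \<longlonglongrightarrow> 0"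
      by (rule ip_tendsto[OF lim T_closed[OF eV] gV]) (auto simp: eV e1)
    ultimately have "(\<lambda>k. lam (r k)) \<longlonglongrightarrow> 0" by (simp add: lam_def)
    moreover have "(\<lambda>k. lam (r k)) \<longlonglongrightarrow> L" using LIMSEQ_subseq_LIMSEQ[OF L(1) r] by (simp add: o_def)
    ultimately show False using \<open>L \<noteq> 0\<close> LIMSEQ_unique by blast
  qed
  then have "lam \<longlonglongrightarrow> 0" using L by simp
  then have "eigensystem e lam" unfolding eigensystem_def using eV orth eig pos dec max by blast
  then show ?thesis by blast
qed

lemma eigensystemD:
  assumes "eigensystem e lam"
  shows "e n \<in> V" "ip (e i) (e j) = (if i = j then 1 else 0)"
    "w \<in> V \<Longrightarrow> ip (T (e n)) w = lam n * ip (e n) w"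
    "0 < lam n" "decseq lam" "lam \<longlonglongrightarrow> 0"
    "f \<in> V \<Longrightarrow> (\<And>i. i < n \<Longrightarrow> ip (e i) f = 0) \<Longrightarrow> ip (T f) f \<le> lam n * ip f f"
  using assms unfolding eigensystem_def by blast+

lemma eigensystem_complete:
  assumes sys: "eigensystem e lam" and f: "f \<in> V" and orth: "\<And>i. ip (e i) f = 0"
  shows "ip f f = 0"
proof -
  have "(\<lambda>n. lam n * ip f f) \<longlonglongrightarrow> 0 * ip f f"
    by (intro tendsto_intros eigensystemD(6)[OF sys])
  then have "ip (T f) f \<le> 0"
    using eigensystemD(7)[OF sys f orth] by (intro LIMSEQ_le_const) auto
  then show ?thesis using T_nonneg[OF f] T_definite[OF f] by simp
qed

text \<open>
  The quadratic form of \<open>T - T\<^sup>2\<close> is diagonal in the eigenvectors; peeling them off one by one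
  avoids infinite expansions.
\<close>

lemma split_off_eigenvectors:
  assumes sys: "eigensystem e lam" and f: "f \<in> V"
  shows "\<exists>r\<in>V. (\<forall>i<n. ip (e i) r = 0) \<and> (\<forall>i\<ge>n. ip (e i) r = ip (e i) f) \<and>
    ip f f = ip r r + (\<Sum>i<n. (ip (e i) f)\<^sup>2) \<and>
    ip (T f) f - ip (T f) (T f) =
      ip (T r) r - ip (T r) (T r) + (\<Sum>i<n. (lam i - (lam i)\<^sup>2) * (ip (e i) f)\<^sup>2)"
proof (induction n)
  case 0
  show ?case using f by (intro bexI[of _ f]) auto
next
  case (Suc n)
  then obtain r where r: "r \<in> V" "\<And>i. i < n \<Longrightarrow> ip (e i) r = 0"
      "\<And>i. n \<le> i \<Longrightarrow> ip (e i) r = ip (e i) f"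
      "ip f f = ip r r + (\<Sum>i<n. (ip (e i) f)\<^sup>2)"
      "ip (T f) f - ip (T f) (T f) =
        ip (T r) r - ip (T r) (T r) + (\<Sum>i<n. (lam i - (lam i)\<^sup>2) * (ip (e i) f)\<^sup>2)"
    by blast
  define a where "a = ip (e n) f"
  define r' where "r' = (\<lambda>x. r x + (- a) * e n x)"
  have eV: "e n \<in> V" and TeV: "T (e n) \<in> V" and TrV: "T r \<in> V"
    using eigensystemD(1)[OF sys] T_closed r by auto
  have ra: "ip (e n) r = a" and ra': "ip r (e n) = a"
    using r(3)[of n] ip_commute[OF r(1) eV] by (auto simp: a_def)
  have r'V: "r' \<in> V" unfolding r'_def by (rule lincomb_closed[OF r(1) eV])
  have ip_r': "ip (e i) r' = ip (e i) r - a * ip (e i) (e n)" for i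
    unfolding r'_def using ip_lincomb_right[OF r(1) eV eigensystemD(1)[OF sys, of i], of "- a"] by simp
  have nrm: "ip r r = ip r' r' + a\<^sup>2"
    unfolding r'_def using ip_lincomb_self[OF r(1) eV, of "- a"] ra' eigensystemD(2)[OF sys, of n n]
    by (simp add: power2_eq_square)
  have cross: "ip (T r) (e n) = lam n * a"
    using form.ip_commute[OF r(1) eV] eigensystemD(3)[OF sys r(1), of n] ra by simp
  have self: "ip (T (e n)) (e n) = lam n"
    using eigensystemD(3)[OF sys eV, of n] eigensystemD(2)[OF sys, of n n] by simp
  have form_r': "ip (T r) r = ip (T r') r' + lam n * a\<^sup>2"
    unfolding r'_def using form.ip_lincomb_self[OF r(1) eV, of "- a"] cross self
    by (simp add: power2_eq_square)
  have "ip (e n) (T r) = lam n * a" using cross ip_commute[OF TrV eV] by simp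
  then have cross2: "ip (T r) (T (e n)) = (lam n)\<^sup>2 * a"
    using ip_commute[OF TrV TeV] eigensystemD(3)[OF sys TrV, of n] by (simp add: power2_eq_square)
  have "ip (e n) (T (e n)) = lam n" using self ip_commute[OF TeV eV] by simp
  then have self2: "ip (T (e n)) (T (e n)) = (lam n)\<^sup>2"
    using eigensystemD(3)[OF sys TeV, of n] by (simp add: power2_eq_square)
  have image_r': "ip (T r) (T r) = ip (T r') (T r') + (lam n)\<^sup>2 * a\<^sup>2"
    unfolding r'_def T_lincomb[OF r(1) eV]
    using ip_lincomb_self[OF TrV TeV, of "- a"] cross2 self2
    by (simp add: power2_eq_square)
  show ?case
  proof (intro bexI[of _ r'] conjI allI impI r'V)
    show "ip (e i) r' = 0" if "i < Suc n" for i
      using that r(2)[of i] ip_r'[of i] eigensystemD(2)[OF sys, of i n] ra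
      by (cases "i = n") auto
    show "ip (e i) r' = ip (e i) f" if "Suc n \<le> i" for i
      using that r(3)[of i] ip_r'[of i] eigensystemD(2)[OF sys, of i n] by auto
    show "ip f f = ip r' r' + (\<Sum>i<Suc n. (ip (e i) f)\<^sup>2)"
      using r(4) nrm by (simp add: a_def)
    show "ip (T f) f - ip (T f) (T f) =
        ip (T r') r' - ip (T r') (T r') + (\<Sum>i<Suc n. (lam i - (lam i)\<^sup>2) * (ip (e i) f)\<^sup>2)"
      using r(5) form_r' image_r' by (simp add: a_def algebra_simps)
  qed
qed

text \<open>
  On the first \<open>n\<close> eigenvectors the form of \<open>T - T\<^sup>2\<close> is at most \<open>\<kappa>\<close> by the orthogonality assumption. On
  the remainder already \<open>T \<le> lam n < \<kappa>\<close> for large \<open>n\<close>.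
\<close>

lemma defect_le:
  assumes sys: "eigensystem e lam" and f: "f \<in> V" and "0 < \<kappa>"
    and orth: "\<And>i. \<kappa> < lam i - (lam i)\<^sup>2 \<Longrightarrow> ip (e i) f = 0"
  shows "ip (T f) f - ip (T f) (T f) \<le> \<kappa> * ip f f"
proof -
  obtain n where n: "lam n < \<kappa>"
    using eigensystemD(6)[OF sys] \<open>0 < \<kappa>\<close>
    by (metis (mono_tags) eventually_sequentially order_refl order_tendstoD(2))
  obtain r where r: "r \<in> V" "\<And>i. i < n \<Longrightarrow> ip (e i) r = 0"
      "ip f f = ip r r + (\<Sum>i<n. (ip (e i) f)\<^sup>2)"
      "ip (T f) f - ip (T f) (T f) =
        ip (T r) r - ip (T r) (T r) + (\<Sum>i<n. (lam i - (lam i)\<^sup>2) * (ip (e i) f)\<^sup>2)"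
    using split_off_eigenvectors[OF sys f, of n] by blast
  have "ip (T r) r - ip (T r) (T r) \<le> lam n * ip r r"
    using eigensystemD(7)[OF sys r(1,2)] ip_nonneg[OF T_closed[OF r(1)]] by fastforce
  also have "\<dots> \<le> \<kappa> * ip r r" using n ip_nonneg[OF r(1)] by (intro mult_right_mono) auto
  finally have rest: "ip (T r) r - ip (T r) (T r) \<le> \<kappa> * ip r r" .
  have "(lam i - (lam i)\<^sup>2) * (ip (e i) f)\<^sup>2 \<le> \<kappa> * (ip (e i) f)\<^sup>2" for i
    using orth[of i] by (cases "\<kappa> < lam i - (lam i)\<^sup>2") (auto intro: mult_right_mono)
  then have "(\<Sum>i<n. (lam i - (lam i)\<^sup>2) * (ip (e i) f)\<^sup>2) \<le> \<kappa> * (\<Sum>i<n. (ip (e i) f)\<^sup>2)"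
    unfolding sum_distrib_left by (intro sum_mono)
  with rest r(3,4) show ?thesis by (simp add: distrib_left)
qed

lemma finite_large_eigenvalues:
  assumes sys: "eigensystem e lam" and "0 < \<kappa>"
  shows "finite {n. \<kappa> \<le> lam n}"
proof -
  obtain N where N: "\<And>n. N \<le> n \<Longrightarrow> lam n < \<kappa>"
    using order_tendstoD(2)[OF eigensystemD(6)[OF sys] \<open>0 < \<kappa>\<close>] by (auto simp: eventually_sequentially)
  have "{n. \<kappa> \<le> lam n} \<subseteq> {..<N}" using N by (auto simp flip: not_less)
  then show ?thesis by (rule finite_subset) simp
qed

text \<open>
  The variational principle: if there were fewer eigenvalues with \<open>lam - lam\<^sup>2 > \<kappa>\<close> than test functions,
  some nontrivial combination would be orthogonal to all of the corresponding eigenvectors,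
  against \<open>defect_le\<close>. Linear independence of the test functions is implied by the strict
  inequality, which fails for \<open>f = 0\<close>.
\<close>

theorem card_test_functions_le:
  assumes sys: "eigensystem e lam" and "0 < \<kappa>" and "finite W"
    and g: "\<And>m. m \<in> W \<Longrightarrow> g m \<in> V"
    and defect: "\<And>c f. \<exists>m\<in>W. c m \<noteq> 0 \<Longrightarrow> f = (\<lambda>x. \<Sum>m\<in>W. c m * g m x) \<Longrightarrow>
      \<kappa> * ip f f < ip (T f) f - ip (T f) (T f)"
  shows "card W \<le> card {n. \<kappa> < lam n - (lam n)\<^sup>2}"
proof (rule ccontr)
  let ?N = "{n. \<kappa> < lam n - (lam n)\<^sup>2}"
  assume "\<not> card W \<le> card ?N"
  then have less: "card ?N < card W" by simp
  have "lam n - (lam n)\<^sup>2 \<le> lam n" for n by simp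
  then have "?N \<subseteq> {n. \<kappa> \<le> lam n}" by (force intro: less_imp_le less_le_trans)
  then have fin: "finite ?N" using finite_large_eigenvalues[OF sys \<open>0 < \<kappa>\<close>] by (rule finite_subset)
  obtain c where c: "\<exists>m\<in>W. c m \<noteq> 0" "\<And>n. n \<in> ?N \<Longrightarrow> (\<Sum>m\<in>W. c m * ip (e n) (g m)) = 0"
    using homogeneous_system_nontrivial[OF fin \<open>finite W\<close> less, of "\<lambda>m n. ip (e n) (g m)"] by blast
  define f where "f = (\<lambda>x. \<Sum>m\<in>W. c m * g m x)"
  have "f \<in> V" unfolding f_def
    using eigensystemD(1)[OF sys] by (intro sum_closed \<open>finite W\<close> g) auto
  have "ip (e n) f = 0" if "\<kappa> < lam n - (lam n)\<^sup>2" for n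
    unfolding f_def using c(2)[of n] that
    by (subst ip_sum_right[OF \<open>finite W\<close> g eigensystemD(1)[OF sys]]) auto
  from defect_le[OF sys \<open>f \<in> V\<close> \<open>0 < \<kappa>\<close> this] defect[OF c(1) f_def] show False by simp
qed

end

section \<open>Square-integrable functions and the sinc kernel\<close>

text \<open>
  The real square-integrable functions supported in \<open>(a, b)\<close>, as functions on the whole line. Keeping
  the line as the common domain lets functions on different intervals be compared and convolved.
\<close>

definition sqint :: "real \<Rightarrow> real \<Rightarrow> (real \<Rightarrow> real) set" where
  "sqint a b = {f \<in> borel_measurable borel. integrable lborel (\<lambda>x. (f x)\<^sup>2) \<and> (\<forall>x. x \<notin> {a<..<b} \<longrightarrow> f x = 0)}"

definition l2_inner :: "(real \<Rightarrow> real) \<Rightarrow> (real \<Rightarrow> real) \<Rightarrow> real" where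
  "l2_inner f g = (LINT x|lborel. f x * g x)"

definition sinc_conv :: "(real \<Rightarrow> real) \<Rightarrow> real \<Rightarrow> real" where
  "sinc_conv f x = (LINT y|lborel. nsinc (x - y) * f y)"

definition sinc_op :: "real \<Rightarrow> real \<Rightarrow> (real \<Rightarrow> real) \<Rightarrow> real \<Rightarrow> real" where
  "sinc_op a b f x = indicator {a<..<b} x * sinc_conv f x"

lemma sqintD:
  assumes "f \<in> sqint a b"
  shows "f \<in> borel_measurable borel" "integrable lborel (\<lambda>x. (f x)\<^sup>2)" "x \<notin> {a<..<b} \<Longrightarrow> f x = 0"
  using assms by (auto simp: sqint_def)

lemma sqintI:
  assumes "f \<in> borel_measurable borel" "integrable lborel (\<lambda>x. (f x)\<^sup>2)" "\<And>x. x \<notin> {a<..<b} \<Longrightarrow> f x = 0"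
  shows "f \<in> sqint a b"
  using assms by (auto simp: sqint_def)

lemma sqint_mono:
  assumes "f \<in> sqint a b" "a' \<le> a" "b \<le> b'" shows "f \<in> sqint a' b'"
  using assms by (auto simp: sqint_def)

lemma integrable_mult_sqint:
  assumes f: "f \<in> sqint a b" and g: "g \<in> sqint a' b'"
  shows "integrable lborel (\<lambda>x. f x * g x)"
proof (rule Bochner_Integration.integrable_bound)
  show "integrable lborel (\<lambda>x. (f x)\<^sup>2 + (g x)\<^sup>2)" using sqintD(2)[OF f] sqintD(2)[OF g] by simp
  show "(\<lambda>x. f x * g x) \<in> borel_measurable lborel"
    using sqintD(1)[OF f] sqintD(1)[OF g] by simp
  have "\<bar>u * v\<bar> \<le> u\<^sup>2 + v\<^sup>2" for u v :: real
  proof -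
    have "2 * (\<bar>u\<bar> * \<bar>v\<bar>) \<le> u\<^sup>2 + v\<^sup>2"
      using sum_squares_bound[of "\<bar>u\<bar>" "\<bar>v\<bar>"] by simp
    moreover have "0 \<le> \<bar>u\<bar> * \<bar>v\<bar>" by simp
    ultimately show ?thesis unfolding abs_mult by linarith
  qed
  then show "AE x in lborel. norm (f x * g x) \<le> norm ((f x)\<^sup>2 + (g x)\<^sup>2)"
    by (intro AE_I2) (simp add: abs_of_nonneg del: abs_mult)
qed

lemma sqint_bounded:
  assumes "f \<in> borel_measurable borel" "\<And>x. \<bar>f x\<bar> \<le> B" "\<And>x. x \<notin> {a<..<b} \<Longrightarrow> f x = 0"
  shows "f \<in> sqint a b"
proof (rule sqintI[OF assms(1) _ assms(3)])
  show "integrable lborel (\<lambda>x. (f x)\<^sup>2)"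
  proof (rule Bochner_Integration.integrable_bound)
    show "integrable lborel (\<lambda>x. B\<^sup>2 * indicator {a..b} x :: real)"
      by (intro integrable_mult_right integrable_real_indicator) (auto simp: emeasure_lborel_Icc_eq)
    show "(\<lambda>x. (f x)\<^sup>2) \<in> borel_measurable lborel" using assms(1) by simp
    show "AE x in lborel. norm ((f x)\<^sup>2) \<le> norm (B\<^sup>2 * indicator {a..b} x :: real)"
    proof (rule AE_I2)
      fix x
      have "(f x)\<^sup>2 \<le> B\<^sup>2" using power_mono[OF assms(2)[of x], of 2] by simp
      then show "norm ((f x)\<^sup>2) \<le> norm (B\<^sup>2 * indicator {a..b} x :: real)"
        using assms(3)[of x] by (auto simp: indicator_def)
    qed
  qed
qed

lemma indicator_sqint: "indicator {a<..<b} \<in> sqint a b"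
  by (rule sqint_bounded[of _ 1]) (auto simp: indicator_def)

lemma integrable_sqint:
  assumes f: "f \<in> sqint a b" shows "integrable lborel f"
proof -
  have "f = (\<lambda>x. f x * indicator {a<..<b} x)"
  proof
    show "f x = f x * indicator {a<..<b} x" for x
      using sqintD(3)[OF f, of x] by (cases "x \<in> {a<..<b}") simp_all
  qed
  then show ?thesis using integrable_mult_sqint[OF f indicator_sqint, of a b] by simp
qed

lemma integrable_bounded_mult:
  fixes f h :: "real \<Rightarrow> real"
  assumes f: "integrable lborel f" and h: "h \<in> borel_measurable borel" "\<And>x. \<bar>h x\<bar> \<le> B"
  shows "integrable lborel (\<lambda>x. h x * f x)"
proof (rule Bochner_Integration.integrable_bound)
  show "integrable lborel (\<lambda>x. B * f x)" using f by simp
  show "(\<lambda>x. h x * f x) \<in> borel_measurable lborel" using f h by (simp add: borel_measurable_integrable)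
  show "AE x in lborel. norm (h x * f x) \<le> norm (B * f x)"
    using h(2) by (intro AE_I2) (auto simp: abs_mult intro!: mult_right_mono order_trans[OF h(2)])
qed

lemma mult_bounded_sqint:
  assumes f: "f \<in> sqint a b" and h: "h \<in> borel_measurable borel" "\<And>x. \<bar>h x\<bar> \<le> B"
  shows "(\<lambda>x. h x * f x) \<in> sqint a b"
proof (rule sqintI)
  show "(\<lambda>x. h x * f x) \<in> borel_measurable borel" using sqintD(1)[OF f] h(1) by simp
  have "\<bar>(h x)\<^sup>2\<bar> \<le> B\<^sup>2" for x using power_mono[OF h(2)[of x], of 2] by simp
  then show "integrable lborel (\<lambda>x. (h x * f x)\<^sup>2)"
    unfolding power_mult_distrib using h(1)
    by (intro integrable_bounded_mult[OF sqintD(2)[OF f]]) auto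
  show "h x * f x = 0" if "x \<notin> {a<..<b}" for x using sqintD(3)[OF f that] by simp
qed

lemma lincomb_sqint:
  assumes f: "f \<in> sqint a b" and g: "g \<in> sqint a b"
  shows "(\<lambda>x. f x + c * g x) \<in> sqint a b"
proof (rule sqintI)
  show "(\<lambda>x. f x + c * g x) \<in> borel_measurable borel" using sqintD(1)[OF f] sqintD(1)[OF g] by simp
  have "(\<lambda>x. (f x + c * g x)\<^sup>2) = (\<lambda>x. (f x)\<^sup>2 + (2 * c) * (f x * g x) + c\<^sup>2 * (g x)\<^sup>2)"
    by (auto simp: power2_eq_square algebra_simps)
  then show "integrable lborel (\<lambda>x. (f x + c * g x)\<^sup>2)"
    using sqintD(2)[OF f] sqintD(2)[OF g] integrable_mult_sqint[OF f g] by simp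
  show "f x + c * g x = 0" if "x \<notin> {a<..<b}" for x using sqintD(3)[OF f that] sqintD(3)[OF g that] by simp
qed

interpretation sqint: semi_inner_product "sqint a b" l2_inner for a b
proof
  fix f g h :: "real \<Rightarrow> real" and c :: real
  show "f \<in> sqint a b \<Longrightarrow> g \<in> sqint a b \<Longrightarrow> (\<lambda>x. f x + c * g x) \<in> sqint a b" by (rule lincomb_sqint)
  show "f \<in> sqint a b \<Longrightarrow> g \<in> sqint a b \<Longrightarrow> l2_inner f g = l2_inner g f" by (simp add: l2_inner_def mult.commute)
  show "l2_inner (\<lambda>x. f x + c * g x) h = l2_inner f h + c * l2_inner g h"
    if "f \<in> sqint a b" "g \<in> sqint a b" "h \<in> sqint a b"
    using that integrable_mult_sqint[OF that(1,3)] integrable_mult_sqint[OF that(2,3)]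
    by (simp add: l2_inner_def distrib_right mult.assoc)
  show "f \<in> sqint a b \<Longrightarrow> 0 \<le> l2_inner f f" by (simp add: l2_inner_def)
qed

lemma L1_le_L2:
  assumes f: "f \<in> sqint a b" and "a \<le> b"
  shows "(LINT x|lborel. \<bar>f x\<bar>) \<le> sqrt (b - a) * sqrt (l2_inner f f)"
proof -
  have absf: "(\<lambda>x. \<bar>f x\<bar>) \<in> sqint a b"
    using f by (auto simp: sqint_def)
  have "(LINT x|lborel. \<bar>f x\<bar>) = l2_inner (indicator {a<..<b}) (\<lambda>x. \<bar>f x\<bar>)"
    unfolding l2_inner_def using sqintD(3)[OF f] by (intro Bochner_Integration.integral_cong) (auto simp: indicator_def)
  also have "\<dots> \<le> sqrt (l2_inner (indicator {a<..<b}) (indicator {a<..<b})) * sqrt (l2_inner (\<lambda>x. \<bar>f x\<bar>) (\<lambda>x. \<bar>f x\<bar>))"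
    using sqint.Cauchy_Schwarz_abs[OF indicator_sqint absf] by simp
  also have "l2_inner (indicator {a<..<b}) (indicator {a<..<b}) = b - a"
    using \<open>a \<le> b\<close> by (simp add: l2_inner_def flip: indicator_inter_arith)
  also have "l2_inner (\<lambda>x. \<bar>f x\<bar>) (\<lambda>x. \<bar>f x\<bar>) = l2_inner f f" by (simp add: l2_inner_def)
  finally show ?thesis .
qed

text \<open>
  The normalised sinc function is the Fourier transform of the indicator of \<open>[-1/2, 1/2]\<close>. Bounds and
  Lipschitz continuity are read off from that integral.
\<close>

definition window :: "real \<Rightarrow> real" where "window = indicator {-1/2..1/2}"

lemma window_integrable: "integrable lborel window"
  unfolding window_def by (intro integrable_real_indicator) (auto simp: emeasure_lborel_Icc_eq)

lemma window_measurable [measurable]: "window \<in> borel_measurable borel"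
  by (simp add: window_def)

lemma window_bounds: "0 \<le> window x" "window x \<le> 1"
  by (auto simp: window_def indicator_def)

lemma integral_window: "(LINT \<xi>|lborel. window \<xi>) = 1"
  by (simp add: window_def)

lemma nsinc_eq_integral: "nsinc t = (LINT \<xi>|lborel. window \<xi> * cos (2 * pi * \<xi> * t))"
proof (cases "t = 0")
  case True
  then show ?thesis by (simp add: nsinc_def integral_window)
next
  case False
  have "(LINT \<xi>|lborel. cos (2 * pi * \<xi> * t) * indicator {-1/2..1/2} \<xi>)
      = sin (2 * pi * (1/2) * t) / (2 * pi * t) - sin (2 * pi * (-1/2) * t) / (2 * pi * t)"
    using False
    by (intro integral_FTC_Icc_real) (auto intro!: derivative_eq_intros continuous_intros simp: field_simps)
  also have "\<dots> = nsinc t" using False by (simp add: nsinc_def field_simps)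
  finally show ?thesis by (simp add: window_def mult.commute)
qed

lemma nsinc_measurable [measurable]: "nsinc \<in> borel_measurable borel"
  unfolding nsinc_def by measurable

lemma cos_window_integrable:
  "k \<in> borel_measurable borel \<Longrightarrow> (\<And>x. \<bar>k x\<bar> \<le> 1) \<Longrightarrow> integrable lborel (\<lambda>\<xi>. window \<xi> * k \<xi>)"
  using integrable_bounded_mult[OF window_integrable, of k 1] by (simp add: mult.commute)

lemma abs_nsinc_le: "\<bar>nsinc t\<bar> \<le> 1"
proof -
  have "\<bar>nsinc t\<bar> \<le> (LINT \<xi>|lborel. \<bar>window \<xi> * cos (2 * pi * \<xi> * t)\<bar>)"
    unfolding nsinc_eq_integral by (rule integral_abs_bound)
  also have "\<dots> \<le> (LINT \<xi>|lborel. window \<xi>)"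
    using window_bounds
    by (intro integral_mono window_integrable integrable_abs cos_window_integrable)
       (auto simp: abs_mult mult_left_le)
  finally show ?thesis by (simp add: integral_window)
qed

lemma abs_cos_diff_le: "\<bar>cos x - cos y\<bar> \<le> \<bar>x - y\<bar>" for x y :: real
proof -
  have "cos x - cos y = 2 * sin ((x + y) / 2) * sin ((y - x) / 2)" by (rule cos_diff_cos)
  then have "\<bar>cos x - cos y\<bar> = 2 * \<bar>sin ((x + y) / 2)\<bar> * \<bar>sin ((y - x) / 2)\<bar>" by (simp add: abs_mult)
  also have "\<dots> \<le> 2 * 1 * \<bar>(y - x) / 2\<bar>"
    using abs_sin_x_le_abs_x[of "(y - x) / 2"] by (intro mult_mono) auto
  finally show ?thesis by simp
qed

lemma nsinc_lipschitz: "\<bar>nsinc s - nsinc t\<bar> \<le> pi * \<bar>s - t\<bar>"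
proof -
  have int: "integrable lborel (\<lambda>\<xi>. window \<xi> * cos (2 * pi * \<xi> * u))" for u
    by (rule cos_window_integrable) auto
  have "\<bar>nsinc s - nsinc t\<bar> = \<bar>LINT \<xi>|lborel. window \<xi> * cos (2 * pi * \<xi> * s) - window \<xi> * cos (2 * pi * \<xi> * t)\<bar>"
    unfolding nsinc_eq_integral by (simp add: int)
  also have "\<dots> \<le> (LINT \<xi>|lborel. \<bar>window \<xi> * cos (2 * pi * \<xi> * s) - window \<xi> * cos (2 * pi * \<xi> * t)\<bar>)"
    by (rule integral_abs_bound)
  also have "\<dots> \<le> (LINT \<xi>|lborel. (pi * \<bar>s - t\<bar>) * window \<xi>)"
  proof (intro integral_mono integrable_abs integrable_mult_right window_integrable)
    show "integrable lborel (\<lambda>\<xi>. window \<xi> * cos (2 * pi * \<xi> * s) - window \<xi> * cos (2 * pi * \<xi> * t))"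
      by (intro Bochner_Integration.integrable_diff int)
    fix \<xi> :: real
    show "\<bar>window \<xi> * cos (2 * pi * \<xi> * s) - window \<xi> * cos (2 * pi * \<xi> * t)\<bar> \<le> (pi * \<bar>s - t\<bar>) * window \<xi>"
    proof (cases "\<xi> \<in> {-1/2..1/2}")
      case True
      have "\<bar>cos (2 * pi * \<xi> * s) - cos (2 * pi * \<xi> * t)\<bar> \<le> \<bar>2 * pi * \<xi> * s - 2 * pi * \<xi> * t\<bar>"
        by (rule abs_cos_diff_le)
      also have "\<dots> = (2 * \<bar>\<xi>\<bar>) * (pi * \<bar>s - t\<bar>)"
        by (simp add: abs_mult flip: right_diff_distrib)
      also have "\<dots> \<le> 1 * (pi * \<bar>s - t\<bar>)" using True by (intro mult_right_mono) auto
      finally show ?thesis using True by (simp add: window_def)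
    qed (auto simp: window_def)
  qed
  finally show ?thesis by (simp add: integral_window)
qed

lemma sinc_integrable:
  "integrable lborel f \<Longrightarrow> integrable lborel (\<lambda>y. nsinc (x - y) * f y)"
  by (rule integrable_bounded_mult[where B = 1]) (auto simp: abs_nsinc_le)

lemma abs_sinc_conv_le:
  assumes "integrable lborel f"
  shows "\<bar>sinc_conv f x\<bar> \<le> (LINT y|lborel. \<bar>f y\<bar>)"
proof -
  have "\<bar>sinc_conv f x\<bar> \<le> (LINT y|lborel. \<bar>nsinc (x - y) * f y\<bar>)"
    unfolding sinc_conv_def by (rule integral_abs_bound)
  also have "\<dots> \<le> (LINT y|lborel. \<bar>f y\<bar>)"
    using assms abs_nsinc_le by (intro integral_mono integrable_abs sinc_integrable) (auto simp: abs_mult mult_left_le_one_le)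
  finally show ?thesis .
qed

text \<open>
  Equicontinuity on bounded sets of \<open>L\<^sup>1\<close>; this is where compactness comes from.
\<close>

lemma sinc_conv_lipschitz:
  assumes "integrable lborel f"
  shows "\<bar>sinc_conv f x - sinc_conv f y\<bar> \<le> pi * \<bar>x - y\<bar> * (LINT y|lborel. \<bar>f y\<bar>)"
proof -
  have "\<bar>sinc_conv f x - sinc_conv f y\<bar> = \<bar>LINT z|lborel. (nsinc (x - z) - nsinc (y - z)) * f z\<bar>"
    unfolding sinc_conv_def by (simp add: left_diff_distrib sinc_integrable assms)
  also have "\<dots> \<le> (LINT z|lborel. \<bar>(nsinc (x - z) - nsinc (y - z)) * f z\<bar>)"
    by (rule integral_abs_bound)
  also have "\<dots> \<le> (LINT z|lborel. (pi * \<bar>x - y\<bar>) * \<bar>f z\<bar>)"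
  proof (intro integral_mono integrable_abs integrable_mult_right assms)
    show "integrable lborel (\<lambda>z. (nsinc (x - z) - nsinc (y - z)) * f z)"
      by (simp add: left_diff_distrib sinc_integrable assms)
    show "\<bar>(nsinc (x - z) - nsinc (y - z)) * f z\<bar> \<le> (pi * \<bar>x - y\<bar>) * \<bar>f z\<bar>" for z
      using nsinc_lipschitz[of "x - z" "y - z"] by (simp add: abs_mult mult_right_mono)
  qed
  finally show ?thesis by simp
qed

lemma sinc_conv_measurable:
  assumes "integrable lborel f" shows "sinc_conv f \<in> borel_measurable borel"
proof (rule borel_measurable_continuous_onI)
  let ?L = "pi * (LINT y|lborel. \<bar>f y\<bar>)"
  have "?L-lipschitz_on UNIV (sinc_conv f)"
    using sinc_conv_lipschitz[OF assms] by (intro lipschitz_onI) (auto simp: dist_real_def mult_ac)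
  then show "continuous_on UNIV (sinc_conv f)" by (rule lipschitz_on_continuous_on)
qed

lemma sinc_op_sqint:
  assumes "integrable lborel f" shows "sinc_op a b f \<in> sqint a b"
proof (rule sqint_bounded)
  show "sinc_op a b f \<in> borel_measurable borel"
    unfolding sinc_op_def using sinc_conv_measurable[OF assms] by measurable
  show "\<bar>sinc_op a b f x\<bar> \<le> (LINT y|lborel. \<bar>f y\<bar>)" for x
    using abs_sinc_conv_le[OF assms, of x] by (auto simp: sinc_op_def indicator_def)
qed (auto simp: sinc_op_def)

lemma l2_inner_sinc_op:
  assumes "g \<in> sqint a b"
  shows "l2_inner (sinc_op a b f) g = (LINT x|lborel. sinc_conv f x * g x)"
  unfolding l2_inner_def sinc_op_def using sqintD(3)[OF assms]
  by (intro Bochner_Integration.integral_cong) (auto simp: indicator_def)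

section \<open>The quadratic form in the frequency domain\<close>

lemma integrable_tensor:
  fixes u w :: "real \<Rightarrow> real" and k :: "real \<times> real \<Rightarrow> real"
  assumes u: "integrable lborel u" and w: "integrable lborel w"
    and k: "k \<in> borel_measurable borel" "\<And>p. \<bar>k p\<bar> \<le> 1"
  shows "integrable (lborel \<Otimes>\<^sub>M lborel) (\<lambda>(x, y). u x * w y * k (x, y))"
proof (rule Bochner_Integration.integrable_bound)
  have [measurable]: "u \<in> borel_measurable borel" "w \<in> borel_measurable borel"
    using u w borel_measurable_integrable by auto
  have [measurable]: "k \<in> borel_measurable (borel \<Otimes>\<^sub>M borel)" using k(1) by (simp add: borel_prod)
  show "integrable (lborel \<Otimes>\<^sub>M lborel) (\<lambda>(x, y). u x * w y)"
  proof (rule lborel_pair.Fubini_integrable)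
    show "integrable lborel (\<lambda>x. LBINT y. norm (case (x, y) of (x, y) \<Rightarrow> u x * w y))"
      using u by (simp add: abs_mult)
    show "AE x in lborel. integrable lborel (\<lambda>y. case (x, y) of (x, y) \<Rightarrow> u x * w y)"
      using w by simp
  qed simp
  show "(\<lambda>(x, y). u x * w y * k (x, y)) \<in> borel_measurable (lborel \<Otimes>\<^sub>M lborel)" by simp
  show "AE p in lborel \<Otimes>\<^sub>M lborel. norm (case p of (x, y) \<Rightarrow> u x * w y * k (x, y))
      \<le> norm (case p of (x, y) \<Rightarrow> u x * w y)"
    using k(2) by (intro AE_I2) (auto simp: abs_mult mult_left_le)
qed

lemma Fubini_tensor:
  fixes u w :: "real \<Rightarrow> real" and k :: "real \<times> real \<Rightarrow> real"
  assumes u: "integrable lborel u" and w: "integrable lborel w"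
    and k: "k \<in> borel_measurable borel" "\<And>p. \<bar>k p\<bar> \<le> 1"
  shows "(LINT x|lborel. u x * (LINT y|lborel. w y * k (x, y))) =
    (LINT y|lborel. w y * (LINT x|lborel. u x * k (x, y)))"
  using lborel_pair.Fubini_integral[OF integrable_tensor[OF assms]]
  by (simp add: mult.assoc mult.left_commute[of "u _" "w _"] flip: integral_mult_right_zero)

lemma trig_kernel_measurable:
  "(\<lambda>(x, \<xi>). cos (2 * pi * \<xi> * x)) \<in> borel_measurable (borel :: (real \<times> real) measure)"
  "(\<lambda>(x, \<xi>). sin (2 * pi * \<xi> * x)) \<in> borel_measurable (borel :: (real \<times> real) measure)"
  "(\<lambda>(y, \<xi>). cos (2 * pi * \<xi> * (x - y))) \<in> borel_measurable (borel :: (real \<times> real) measure)"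
  by (intro borel_measurable_continuous_onI; auto intro!: continuous_intros simp: split_beta')+

text \<open>
  The real and imaginary parts of the Fourier transform, up to sign.
\<close>

definition cos_tr :: "(real \<Rightarrow> real) \<Rightarrow> real \<Rightarrow> real" where
  "cos_tr f \<xi> = (LINT y|lborel. cos (2 * pi * \<xi> * y) * f y)"

definition sin_tr :: "(real \<Rightarrow> real) \<Rightarrow> real \<Rightarrow> real" where
  "sin_tr f \<xi> = (LINT y|lborel. sin (2 * pi * \<xi> * y) * f y)"

lemma cos_sin_integrable:
  fixes f :: "real \<Rightarrow> real"
  assumes "integrable lborel f"
  shows "integrable lborel (\<lambda>y. cos (t * y) * f y)" "integrable lborel (\<lambda>y. sin (t * y) * f y)"
    "integrable lborel (\<lambda>y. cos (t * y + s) * f y)"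
  by (rule integrable_bounded_mult[OF assms, of _ 1]; simp)+

lemma abs_tr_diff_le:
  fixes k :: "real \<Rightarrow> real"
  assumes f: "f \<in> sqint a b" and k: "k \<in> borel_measurable borel" "\<And>x. \<bar>k x\<bar> \<le> 1"
    "\<And>x y. \<bar>k x - k y\<bar> \<le> \<bar>x - y\<bar>"
  shows "\<bar>(LINT y|lborel. k (2 * pi * \<xi> * y) * f y) - (LINT y|lborel. k (2 * pi * \<eta> * y) * f y)\<bar>
    \<le> 2 * pi * max \<bar>a\<bar> \<bar>b\<bar> * (LINT y|lborel. \<bar>f y\<bar>) * \<bar>\<xi> - \<eta>\<bar>"
proof -
  have int: "integrable lborel (\<lambda>y. k (2 * pi * \<xi> * y) * f y)" for \<xi>
    using k(1,2) by (intro integrable_bounded_mult[OF integrable_sqint[OF f], of _ 1]) auto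
  have "\<bar>(LINT y|lborel. k (2 * pi * \<xi> * y) * f y) - (LINT y|lborel. k (2 * pi * \<eta> * y) * f y)\<bar>
      = \<bar>LINT y|lborel. k (2 * pi * \<xi> * y) * f y - k (2 * pi * \<eta> * y) * f y\<bar>"
    by (simp add: int)
  also have "\<dots> \<le> (LINT y|lborel. \<bar>k (2 * pi * \<xi> * y) * f y - k (2 * pi * \<eta> * y) * f y\<bar>)"
    by (rule integral_abs_bound)
  also have "\<dots> \<le> (LINT y|lborel. (2 * pi * max \<bar>a\<bar> \<bar>b\<bar> * \<bar>\<xi> - \<eta>\<bar>) * \<bar>f y\<bar>)"
  proof (intro integral_mono integrable_abs integrable_mult_right integrable_sqint[OF f])
    show "integrable lborel (\<lambda>y. k (2 * pi * \<xi> * y) * f y - k (2 * pi * \<eta> * y) * f y)"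
      by (intro Bochner_Integration.integrable_diff int)
    fix y
    show "\<bar>k (2 * pi * \<xi> * y) * f y - k (2 * pi * \<eta> * y) * f y\<bar>
        \<le> (2 * pi * max \<bar>a\<bar> \<bar>b\<bar> * \<bar>\<xi> - \<eta>\<bar>) * \<bar>f y\<bar>"
    proof (cases "y \<in> {a<..<b}")
      case True
      have "\<bar>k (2 * pi * \<xi> * y) - k (2 * pi * \<eta> * y)\<bar> \<le> \<bar>2 * pi * \<xi> * y - 2 * pi * \<eta> * y\<bar>" by (rule k(3))
      also have "\<dots> = 2 * pi * \<bar>y\<bar> * \<bar>\<xi> - \<eta>\<bar>"
        by (simp add: abs_mult flip: left_diff_distrib right_diff_distrib)
      also have "\<dots> \<le> 2 * pi * max \<bar>a\<bar> \<bar>b\<bar> * \<bar>\<xi> - \<eta>\<bar>"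
        using True by (intro mult_right_mono mult_left_mono) auto
      finally show ?thesis by (simp add: abs_mult mult_right_mono flip: left_diff_distrib)
    qed (use sqintD(3)[OF f] in simp)
  qed
  finally show ?thesis by (simp add: mult_ac)
qed

lemma abs_sin_diff_le: "\<bar>sin x - sin y\<bar> \<le> \<bar>x - y\<bar>" for x y :: real
  using abs_cos_diff_le[of "pi/2 - x" "pi/2 - y"] by (simp add: cos_diff sin_diff)

lemma continuous_tr:
  assumes f: "f \<in> sqint a b"
  shows "continuous_on UNIV (cos_tr f)" "continuous_on UNIV (sin_tr f)"
proof -
  let ?L = "2 * pi * max \<bar>a\<bar> \<bar>b\<bar> * (LINT y|lborel. \<bar>f y\<bar>)"
  have L: "0 \<le> ?L" by (intro mult_nonneg_nonneg) auto
  have "?L-lipschitz_on UNIV (cos_tr f)"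
    unfolding cos_tr_def using abs_tr_diff_le[OF f, of cos] abs_cos_diff_le L
    by (intro lipschitz_onI) (auto simp: dist_real_def)
  then show "continuous_on UNIV (cos_tr f)" by (rule lipschitz_on_continuous_on)
  have "?L-lipschitz_on UNIV (sin_tr f)"
    unfolding sin_tr_def using abs_tr_diff_le[OF f, of sin] abs_sin_diff_le L
    by (intro lipschitz_onI) (auto simp: dist_real_def)
  then show "continuous_on UNIV (sin_tr f)" by (rule lipschitz_on_continuous_on)
qed

lemma abs_tr_le:
  assumes "integrable lborel f"
  shows "\<bar>cos_tr f \<xi>\<bar> \<le> (LINT y|lborel. \<bar>f y\<bar>)" "\<bar>sin_tr f \<xi>\<bar> \<le> (LINT y|lborel. \<bar>f y\<bar>)"
proof -
  have "\<bar>LINT y|lborel. k y * f y\<bar> \<le> (LINT y|lborel. \<bar>f y\<bar>)"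
    if "k \<in> borel_measurable borel" "\<And>x. \<bar>k x\<bar> \<le> 1" for k
  proof -
    have "\<bar>LINT y|lborel. k y * f y\<bar> \<le> (LINT y|lborel. \<bar>k y * f y\<bar>)" by (rule integral_abs_bound)
    also have "\<dots> \<le> (LINT y|lborel. \<bar>f y\<bar>)"
      using that integrable_bounded_mult[OF assms that]
      by (intro integral_mono integrable_abs assms) (auto simp: abs_mult mult_left_le_one_le)
    finally show ?thesis .
  qed
  then show "\<bar>cos_tr f \<xi>\<bar> \<le> (LINT y|lborel. \<bar>f y\<bar>)" "\<bar>sin_tr f \<xi>\<bar> \<le> (LINT y|lborel. \<bar>f y\<bar>)"
    unfolding cos_tr_def sin_tr_def by auto
qed

lemma sinc_conv_eq_tr:
  assumes f: "integrable lborel f"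
  shows "sinc_conv f x = (LINT \<xi>|lborel. window \<xi> * (cos (2 * pi * \<xi> * x) * cos_tr f \<xi> + sin (2 * pi * \<xi> * x) * sin_tr f \<xi>))"
proof -
  have "sinc_conv f x = (LINT y|lborel. f y * (LINT \<xi>|lborel. window \<xi> * cos (2 * pi * \<xi> * (x - y))))"
    unfolding sinc_conv_def nsinc_eq_integral by (simp add: mult.commute)
  also have "\<dots> = (LINT \<xi>|lborel. window \<xi> * (LINT y|lborel. f y * cos (2 * pi * \<xi> * (x - y))))"
    using Fubini_tensor[OF f window_integrable trig_kernel_measurable(3)[of x]]
    by (simp add: split_beta')
  also have "(\<lambda>\<xi>. LINT y|lborel. f y * cos (2 * pi * \<xi> * (x - y))) =
      (\<lambda>\<xi>. cos (2 * pi * \<xi> * x) * cos_tr f \<xi> + sin (2 * pi * \<xi> * x) * sin_tr f \<xi>)"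
  proof
    fix \<xi>
    have "(\<lambda>y. f y * cos (2 * pi * \<xi> * (x - y))) =
        (\<lambda>y. cos (2 * pi * \<xi> * x) * (cos (2 * pi * \<xi> * y) * f y) + sin (2 * pi * \<xi> * x) * (sin (2 * pi * \<xi> * y) * f y))"
      by (auto simp: right_diff_distrib cos_diff algebra_simps)
    then show "(LINT y|lborel. f y * cos (2 * pi * \<xi> * (x - y))) =
        cos (2 * pi * \<xi> * x) * cos_tr f \<xi> + sin (2 * pi * \<xi> * x) * sin_tr f \<xi>"
      by (simp add: cos_tr_def sin_tr_def cos_sin_integrable f)
  qed
  finally show ?thesis .
qed

lemma window_tr_integrable:
  assumes f: "f \<in> sqint a b"
  shows "integrable lborel (\<lambda>\<xi>. window \<xi> * cos_tr f \<xi>)" "integrable lborel (\<lambda>\<xi>. window \<xi> * sin_tr f \<xi>)"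
proof -
  have [measurable]: "cos_tr f \<in> borel_measurable borel" "sin_tr f \<in> borel_measurable borel"
    using continuous_tr[OF f] by (auto intro: borel_measurable_continuous_onI)
  show "integrable lborel (\<lambda>\<xi>. window \<xi> * cos_tr f \<xi>)" "integrable lborel (\<lambda>\<xi>. window \<xi> * sin_tr f \<xi>)"
    using integrable_bounded_mult[OF window_integrable _ abs_tr_le(1)[OF integrable_sqint[OF f]]]
      integrable_bounded_mult[OF window_integrable _ abs_tr_le(2)[OF integrable_sqint[OF f]]]
    by (simp_all add: mult.commute)
qed

lemma window_tr_mult_integrable:
  assumes f: "f \<in> sqint a b" and g: "g \<in> sqint a' b'"
  shows "integrable lborel (\<lambda>\<xi>. window \<xi> * (cos_tr f \<xi> * cos_tr g \<xi>))"
    "integrable lborel (\<lambda>\<xi>. window \<xi> * (sin_tr f \<xi> * sin_tr g \<xi>))"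
proof -
  have [measurable]: "cos_tr g \<in> borel_measurable borel" "sin_tr g \<in> borel_measurable borel"
    using continuous_tr[OF g] by (auto intro: borel_measurable_continuous_onI)
  show "integrable lborel (\<lambda>\<xi>. window \<xi> * (cos_tr f \<xi> * cos_tr g \<xi>))"
    "integrable lborel (\<lambda>\<xi>. window \<xi> * (sin_tr f \<xi> * sin_tr g \<xi>))"
    using integrable_bounded_mult[OF window_tr_integrable(1)[OF f] _ abs_tr_le(1)[OF integrable_sqint[OF g]]]
      integrable_bounded_mult[OF window_tr_integrable(2)[OF f] _ abs_tr_le(2)[OF integrable_sqint[OF g]]]
    by (simp_all add: mult_ac)
qed

text \<open>
  Fubini, with the sinc function written as an integral over the window and
  \<open>cos (2\<pi>\<xi>(x - y))\<close> expanded by the addition theorem. Symmetry and positivity of the form are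
  visible on the right-hand side.
\<close>

proposition sinc_form_eq_tr:
  assumes f: "f \<in> sqint a b" and g: "g \<in> sqint a' b'"
  shows "(LINT x|lborel. sinc_conv f x * g x) =
    (LINT \<xi>|lborel. window \<xi> * (cos_tr f \<xi> * cos_tr g \<xi> + sin_tr f \<xi> * sin_tr g \<xi>))"
proof -
  note fi = integrable_sqint[OF f] and gi = integrable_sqint[OF g]
  note wc = window_tr_integrable(1)[OF f] and ws = window_tr_integrable(2)[OF f]
  have kc: "integrable lborel (\<lambda>\<xi>. window \<xi> * cos_tr f \<xi> * cos (2 * pi * \<xi> * x))"
    and ks: "integrable lborel (\<lambda>\<xi>. window \<xi> * sin_tr f \<xi> * sin (2 * pi * \<xi> * x))" for x
    using integrable_bounded_mult[OF wc, of "\<lambda>\<xi>. cos (2 * pi * \<xi> * x)" 1]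
      integrable_bounded_mult[OF ws, of "\<lambda>\<xi>. sin (2 * pi * \<xi> * x)" 1] by (simp_all add: mult_ac)
  have ic: "integrable lborel (\<lambda>x. g x * (LINT \<xi>|lborel. window \<xi> * cos_tr f \<xi> * cos (2 * pi * \<xi> * x)))"
    using lborel_pair.integrable_fst'[OF integrable_tensor[OF gi wc trig_kernel_measurable(1)]]
    by (simp add: split_beta' mult.assoc)
  have isn: "integrable lborel (\<lambda>x. g x * (LINT \<xi>|lborel. window \<xi> * sin_tr f \<xi> * sin (2 * pi * \<xi> * x)))"
    using lborel_pair.integrable_fst'[OF integrable_tensor[OF gi ws trig_kernel_measurable(2)]]
    by (simp add: split_beta' mult.assoc)
  have "(LINT x|lborel. sinc_conv f x * g x) =
      (LINT x|lborel. g x * (LINT \<xi>|lborel. window \<xi> * cos_tr f \<xi> * cos (2 * pi * \<xi> * x)) +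
        g x * (LINT \<xi>|lborel. window \<xi> * sin_tr f \<xi> * sin (2 * pi * \<xi> * x)))"
  proof (intro Bochner_Integration.integral_cong refl)
    fix x
    have "sinc_conv f x = (LINT \<xi>|lborel. window \<xi> * cos_tr f \<xi> * cos (2 * pi * \<xi> * x) + window \<xi> * sin_tr f \<xi> * sin (2 * pi * \<xi> * x))"
      unfolding sinc_conv_eq_tr[OF fi]
      by (intro Bochner_Integration.integral_cong refl) (simp add: algebra_simps)
    then have eq: "sinc_conv f x = (LINT \<xi>|lborel. window \<xi> * cos_tr f \<xi> * cos (2 * pi * \<xi> * x)) +
        (LINT \<xi>|lborel. window \<xi> * sin_tr f \<xi> * sin (2 * pi * \<xi> * x))"
      by (simp only: Bochner_Integration.integral_add[OF kc ks])
    show "sinc_conv f x * g x = g x * (LINT \<xi>|lborel. window \<xi> * cos_tr f \<xi> * cos (2 * pi * \<xi> * x)) +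
        g x * (LINT \<xi>|lborel. window \<xi> * sin_tr f \<xi> * sin (2 * pi * \<xi> * x))"
      by (simp only: eq distrib_right mult.commute[of "g x"])
  qed
  also have "\<dots> = (LINT x|lborel. g x * (LINT \<xi>|lborel. window \<xi> * cos_tr f \<xi> * cos (2 * pi * \<xi> * x))) +
      (LINT x|lborel. g x * (LINT \<xi>|lborel. window \<xi> * sin_tr f \<xi> * sin (2 * pi * \<xi> * x)))"
    by (rule Bochner_Integration.integral_add[OF ic isn])
  also have "\<dots> = (LINT \<xi>|lborel. (window \<xi> * cos_tr f \<xi>) * (LINT x|lborel. g x * cos (2 * pi * \<xi> * x))) +
      (LINT \<xi>|lborel. (window \<xi> * sin_tr f \<xi>) * (LINT x|lborel. g x * sin (2 * pi * \<xi> * x)))"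
    using Fubini_tensor[OF gi wc trig_kernel_measurable(1)]
      Fubini_tensor[OF gi ws trig_kernel_measurable(2)]
    by (simp add: split_beta')
  also have "\<dots> = (LINT \<xi>|lborel. window \<xi> * (cos_tr f \<xi> * cos_tr g \<xi>)) + (LINT \<xi>|lborel. window \<xi> * (sin_tr f \<xi> * sin_tr g \<xi>))"
    by (simp add: cos_tr_def[of g] sin_tr_def[of g] mult_ac)
  also have "\<dots> = (LINT \<xi>|lborel. window \<xi> * (cos_tr f \<xi> * cos_tr g \<xi> + sin_tr f \<xi> * sin_tr g \<xi>))"
    using window_tr_mult_integrable[OF f g] by (simp add: distrib_left)
  finally show ?thesis .
qed

lemma l2_inner_sinc_op_eq_tr:
  assumes f: "f \<in> sqint a b" and g: "g \<in> sqint a b"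
  shows "l2_inner (sinc_op a b f) g =
    (LINT \<xi>|lborel. window \<xi> * (cos_tr f \<xi> * cos_tr g \<xi> + sin_tr f \<xi> * sin_tr g \<xi>))"
  unfolding l2_inner_sinc_op[OF g] by (rule sinc_form_eq_tr[OF f g])

section \<open>The band-limiting operator is a contraction\<close>

lemma integral_split_unit_intervals:
  fixes F :: "real \<Rightarrow> real"
  assumes F: "integrable lborel F" and supp: "\<And>x. x \<notin> {- real N..<real N} \<Longrightarrow> F x = 0"
  shows "(LINT x|lborel. F x) = (\<Sum>n\<in>{- int N..<int N}. LINT t|lborel. indicator {0..<1} t * F (of_int n + t))"
proof -
  have int: "integrable lborel (\<lambda>x. indicator {of_int n..<of_int n + 1} x * F x)" for n
    by (rule integrable_bounded_mult[OF F, of _ 1]) (auto simp: indicator_def)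
  have "F x = (\<Sum>n\<in>{- int N..<int N}. indicator {of_int n..<of_int n + 1} x * F x)" for x
  proof (cases "x \<in> {- real N..<real N}")
    case True
    have "indicator {of_int n..<of_int n + 1} x = (if n = \<lfloor>x\<rfloor> then 1 else 0 :: real)" for n
      using floor_correct[of x] by (auto simp: indicator_def) linarith+
    moreover have "\<lfloor>x\<rfloor> \<in> {- int N..<int N}"
      using True by (auto simp: floor_less_iff le_floor_iff)
    ultimately show ?thesis by (simp add: if_distrib[of "\<lambda>c. c * _"] cong: if_cong)
  qed (simp add: supp)
  then have "(LINT x|lborel. F x) = (LINT x|lborel. (\<Sum>n\<in>{- int N..<int N}. indicator {of_int n..<of_int n + 1} x * F x))"
    by (intro Bochner_Integration.integral_cong) auto
  also have "\<dots> = (\<Sum>n\<in>{- int N..<int N}. LINT x|lborel. indicator {of_int n..<of_int n + 1} x * F x)"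
    by (intro Bochner_Integration.integral_sum int)
  also have "\<dots> = (\<Sum>n\<in>{- int N..<int N}. LINT t|lborel. indicator {0..<1} t * F (of_int n + t))"
  proof (intro sum.cong refl)
    fix n :: int
    have "(LINT x|lborel. indicator {of_int n..<of_int n + 1} x * F x) =
        (LINT t|lborel. indicator {of_int n..<of_int n + 1} (of_int n + t) * F (of_int n + t))"
      using lborel_integral_real_affine[of 1 "\<lambda>x. indicator {of_int n..<of_int n + 1} x * F x" "of_int n"] by simp
    also have "(\<lambda>t. indicator {real_of_int n..<of_int n + 1} (of_int n + t) :: real) = indicator {0..<1}"
      by (auto simp: indicator_def fun_eq_iff)
    finally show "(LINT x|lborel. indicator {of_int n..<of_int n + 1} x * F x) =
        (LINT t|lborel. indicator {0..<1} t * F (of_int n + t))"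
      .
  qed
  finally show ?thesis .
qed

lemma nsinc_of_int: "nsinc (of_int n) = (if n = 0 then 1 else 0)"
  by (auto simp: nsinc_def sin_zero_iff_int2 mult.commute[of pi])

lemma unit_interval_integral_sq_le:
  assumes X: "X \<in> sqint (- 1) 2" and supp: "\<And>t. t \<notin> {0..<1} \<Longrightarrow> X t = 0"
  shows "(LINT t|lborel. X t)\<^sup>2 \<le> l2_inner X X"
proof -
  have ind: "indicator {0..<1} \<in> sqint (- 1) 2"
    by (rule sqint_bounded[of _ 1]) (auto simp: indicator_def)
  have "(LINT t|lborel. X t) = l2_inner X (indicator {0..<1})"
    unfolding l2_inner_def using supp by (intro Bochner_Integration.integral_cong) (auto simp: indicator_def)
  moreover have "l2_inner (indicator {0..<1}) (indicator {0..<1}) = 1"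
    by (simp add: l2_inner_def flip: indicator_inter_arith)
  ultimately show ?thesis using sqint.Cauchy_Schwarz[OF X ind] by simp
qed

text \<open>
  Bessel's inequality, by periodisation. Split the line into unit intervals and write
  \<open>F n t = f (n + t)\<close> for \<open>0 \<le> t < 1\<close>. Then the Fourier transform of \<open>f\<close> at \<open>\<xi>\<close> is the integral over \<open>t\<close>
  of a unimodular factor times \<open>\<Sum>n. F n t exp (-2\<pi>i n\<xi>)\<close>. By Cauchy--Schwarz on the unit interval its
  square is at most the integral of \<open>\<bar>\<Sum>n. F n t exp (-2\<pi>i n\<xi>)\<bar>\<^sup>2\<close>. Integrating over a full period of
  \<open>\<xi>\<close> leaves only the diagonal terms, because \<open>nsinc\<close> vanishes at the nonzero integers; their sum is
  the squared norm of \<open>f\<close>.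
\<close>

proposition sinc_form_le:
  assumes f: "f \<in> sqint a b"
  shows "(LINT \<xi>|lborel. window \<xi> * ((cos_tr f \<xi>)\<^sup>2 + (sin_tr f \<xi>)\<^sup>2)) \<le> l2_inner f f"
proof -
  obtain N :: nat where N: "max \<bar>a\<bar> \<bar>b\<bar> \<le> real N" using real_arch_simple by blast
  have supp: "f x = 0" if "x \<notin> {- real N..<real N}" for x
    using that N by (intro sqintD(3)[OF f]) auto
  define I where "I = {- int N..<int N}"
  define F where "F n t = indicator {0..<1} t * f (of_int n + t)" for n t
  have meas: "f \<in> borel_measurable borel" by (rule sqintD(1)[OF f])
  have F_sqint: "F n \<in> sqint (- 1) 2" for n
  proof (rule sqintI)
    show "F n \<in> borel_measurable borel" unfolding F_def using meas by measurable
    have "integrable lborel (\<lambda>t. (f (of_int n + 1 * t))\<^sup>2)"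
      by (rule lborel_integrable_real_affine[OF sqintD(2)[OF f]]) simp
    then have "integrable lborel (\<lambda>t. indicator {0..<1} t * (f (of_int n + t))\<^sup>2)"
      by (intro integrable_bounded_mult[of _ _ 1]) (auto simp: indicator_def)
    moreover have "(\<lambda>t. (F n t)\<^sup>2) = (\<lambda>t. indicator {0..<1} t * (f (of_int n + t))\<^sup>2)"
      by (auto simp: F_def indicator_def)
    ultimately show "integrable lborel (\<lambda>t. (F n t)\<^sup>2)" by simp
  qed (auto simp: F_def)
  have split: "(LINT y|lborel. k y * f y) = (\<Sum>n\<in>I. LINT t|lborel. k (of_int n + t) * F n t)"
    if "k \<in> borel_measurable borel" "\<And>x. \<bar>k x\<bar> \<le> 1" for k
    unfolding I_def F_def
    using integral_split_unit_intervals[of "\<lambda>y. k y * f y" N]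
      integrable_bounded_mult[OF integrable_sqint[OF f] that] supp
    by (simp add: mult.left_commute)
  have norm_split: "l2_inner f f = (\<Sum>n\<in>I. l2_inner (F n) (F n))"
  proof -
    have "F n t * F n t = indicator {0..<1} t * (f (of_int n + t) * f (of_int n + t))" for n t
      by (auto simp: F_def indicator_def)
    then show ?thesis
      using integral_split_unit_intervals[of "\<lambda>y. f y * f y" N] integrable_mult_sqint[OF f f] supp
      by (simp add: l2_inner_def I_def)
  qed
  have pointwise: "(cos_tr f \<xi>)\<^sup>2 + (sin_tr f \<xi>)\<^sup>2
      \<le> (\<Sum>m\<in>I. \<Sum>n\<in>I. cos (2 * pi * \<xi> * of_int (m - n)) * l2_inner (F m) (F n))" for \<xi>
  proof -
    define A where "A t = (\<Sum>n\<in>I. cos (2 * pi * \<xi> * of_int n) * F n t)" for t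
    define B where "B t = (\<Sum>n\<in>I. sin (2 * pi * \<xi> * of_int n) * F n t)" for t
    \<comment> \<open>\<open>(X, Y)\<close> is the vector \<open>(A, B)\<close> rotated by the angle \<open>2\<pi>\<xi>t\<close>, so the integrals of \<open>X\<close> and \<open>Y\<close>
      are the transforms of \<open>f\<close> while \<open>X\<^sup>2 + Y\<^sup>2 = A\<^sup>2 + B\<^sup>2\<close>.\<close>
    define X where "X t = cos (2 * pi * \<xi> * t) * A t - sin (2 * pi * \<xi> * t) * B t" for t
    define Y where "Y t = sin (2 * pi * \<xi> * t) * A t + cos (2 * pi * \<xi> * t) * B t" for t
    have A: "A \<in> sqint (- 1) 2" and B: "B \<in> sqint (- 1) 2"
      unfolding A_def[abs_def] B_def[abs_def] using F_sqint
      by (intro sqint.sum_closed; force simp: I_def)+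
    have cA: "(\<lambda>t. cos (2 * pi * \<xi> * t) * A t) \<in> sqint (- 1) 2"
      and sA: "(\<lambda>t. sin (2 * pi * \<xi> * t) * A t) \<in> sqint (- 1) 2"
      and cB: "(\<lambda>t. cos (2 * pi * \<xi> * t) * B t) \<in> sqint (- 1) 2"
      and sB: "(\<lambda>t. sin (2 * pi * \<xi> * t) * B t) \<in> sqint (- 1) 2"
      using A B by (auto intro!: mult_bounded_sqint[where B = 1])
    have X: "X \<in> sqint (- 1) 2" unfolding X_def[abs_def] by (rule sqint.diff_closed[OF cA sB])
    have Y: "Y \<in> sqint (- 1) 2" unfolding Y_def[abs_def]
      using sqint.lincomb_closed[OF sA cB, of 1] by simp
    have zero: "A t = 0" "B t = 0" if "t \<notin> {0..<1}" for t
      using that by (auto simp: A_def B_def F_def)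
    have intF: "integrable lborel (\<lambda>t. k t * F n t)"
      if "k \<in> borel_measurable borel" "\<And>x. \<bar>k x\<bar> \<le> 1" for k n
      by (rule integrable_bounded_mult[OF integrable_sqint[OF F_sqint] that])
    have "cos_tr f \<xi> = (\<Sum>n\<in>I. LINT t|lborel. cos (2 * pi * \<xi> * (of_int n + t)) * F n t)"
      unfolding cos_tr_def by (rule split) auto
    also have "\<dots> = (LINT t|lborel. (\<Sum>n\<in>I. cos (2 * pi * \<xi> * (of_int n + t)) * F n t))"
      by (intro Bochner_Integration.integral_sum[symmetric] intF) auto
    also have "(\<lambda>t. \<Sum>n\<in>I. cos (2 * pi * \<xi> * (of_int n + t)) * F n t) = X"
    proof
      fix t
      show "(\<Sum>n\<in>I. cos (2 * pi * \<xi> * (of_int n + t)) * F n t) = X t"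
        unfolding X_def A_def B_def sum_distrib_left sum_subtractf[symmetric]
        by (intro sum.cong refl) (simp add: distrib_left cos_add algebra_simps)
    qed
    finally have C: "cos_tr f \<xi> = (LINT t|lborel. X t)" .
    have "sin_tr f \<xi> = (\<Sum>n\<in>I. LINT t|lborel. sin (2 * pi * \<xi> * (of_int n + t)) * F n t)"
      unfolding sin_tr_def by (rule split) auto
    also have "\<dots> = (LINT t|lborel. (\<Sum>n\<in>I. sin (2 * pi * \<xi> * (of_int n + t)) * F n t))"
      by (intro Bochner_Integration.integral_sum[symmetric] intF) auto
    also have "(\<lambda>t. \<Sum>n\<in>I. sin (2 * pi * \<xi> * (of_int n + t)) * F n t) = Y"
    proof
      fix t
      show "(\<Sum>n\<in>I. sin (2 * pi * \<xi> * (of_int n + t)) * F n t) = Y t"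
        unfolding Y_def A_def B_def sum_distrib_left sum.distrib[symmetric]
        by (intro sum.cong refl) (simp add: distrib_left sin_add algebra_simps)
    qed
    finally have S: "sin_tr f \<xi> = (LINT t|lborel. Y t)" .
    have "(cos_tr f \<xi>)\<^sup>2 + (sin_tr f \<xi>)\<^sup>2 \<le> l2_inner X X + l2_inner Y Y"
      unfolding C S using zero
      by (intro add_mono unit_interval_integral_sq_le X Y) (auto simp: X_def Y_def)
    also have "\<dots> = (LINT t|lborel. X t * X t + Y t * Y t)"
      unfolding l2_inner_def using integrable_mult_sqint[OF X X] integrable_mult_sqint[OF Y Y] by simp
    also have "\<dots> = (LINT t|lborel. A t * A t + B t * B t)"
    proof (intro Bochner_Integration.integral_cong refl)
      fix t
      have "X t * X t + Y t * Y t = ((cos (2 * pi * \<xi> * t))\<^sup>2 + (sin (2 * pi * \<xi> * t))\<^sup>2) * (A t * A t + B t * B t)"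
        unfolding X_def Y_def power2_eq_square by algebra
      then show "X t * X t + Y t * Y t = A t * A t + B t * B t" by simp
    qed
    also have "\<dots> = l2_inner A A + l2_inner B B"
      unfolding l2_inner_def using integrable_mult_sqint[OF A A] integrable_mult_sqint[OF B B] by simp
    also have "l2_inner A A = (\<Sum>m\<in>I. cos (2 * pi * \<xi> * of_int m) * (\<Sum>n\<in>I. cos (2 * pi * \<xi> * of_int n) * l2_inner (F m) (F n)))"
      using sqint.ip_sum_left[of I F "- 1" 2 A "\<lambda>n. cos (2 * pi * \<xi> * of_int n)"]
        sqint.ip_sum_right[of I F "- 1" 2 _ "\<lambda>n. cos (2 * pi * \<xi> * of_int n)"] F_sqint A
      by (simp add: A_def[abs_def] I_def)
    also have "l2_inner B B = (\<Sum>m\<in>I. sin (2 * pi * \<xi> * of_int m) * (\<Sum>n\<in>I. sin (2 * pi * \<xi> * of_int n) * l2_inner (F m) (F n)))"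
      using sqint.ip_sum_left[of I F "- 1" 2 B "\<lambda>n. sin (2 * pi * \<xi> * of_int n)"]
        sqint.ip_sum_right[of I F "- 1" 2 _ "\<lambda>n. sin (2 * pi * \<xi> * of_int n)"] F_sqint B
      by (simp add: B_def[abs_def] I_def)
    finally show ?thesis
      by (simp add: sum_distrib_left right_diff_distrib cos_diff distrib_right mult.assoc flip: sum.distrib)
  qed
  have "(LINT \<xi>|lborel. window \<xi> * ((cos_tr f \<xi>)\<^sup>2 + (sin_tr f \<xi>)\<^sup>2))
      \<le> (LINT \<xi>|lborel. window \<xi> * (\<Sum>m\<in>I. \<Sum>n\<in>I. cos (2 * pi * \<xi> * of_int (m - n)) * l2_inner (F m) (F n)))"
  proof (rule integral_mono)
    show "integrable lborel (\<lambda>\<xi>. window \<xi> * ((cos_tr f \<xi>)\<^sup>2 + (sin_tr f \<xi>)\<^sup>2))"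
      using window_tr_mult_integrable[OF f f] by (simp add: power2_eq_square distrib_left)
    have "integrable lborel (\<lambda>\<xi>. window \<xi> * cos (2 * pi * \<xi> * u))" for u
      by (rule cos_window_integrable) auto
    then show "integrable lborel (\<lambda>\<xi>. window \<xi> * (\<Sum>m\<in>I. \<Sum>n\<in>I. cos (2 * pi * \<xi> * of_int (m - n)) * l2_inner (F m) (F n)))"
      unfolding sum_distrib_left mult.assoc[symmetric]
      by (intro Bochner_Integration.integrable_sum integrable_mult_left) auto
    show "window \<xi> * ((cos_tr f \<xi>)\<^sup>2 + (sin_tr f \<xi>)\<^sup>2)
        \<le> window \<xi> * (\<Sum>m\<in>I. \<Sum>n\<in>I. cos (2 * pi * \<xi> * of_int (m - n)) * l2_inner (F m) (F n))" for \<xi>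
      using pointwise window_bounds by (intro mult_left_mono) auto
  qed
  also have "\<dots> = (\<Sum>m\<in>I. \<Sum>n\<in>I. nsinc (of_int (m - n)) * l2_inner (F m) (F n))"
  proof -
    have int: "integrable lborel (\<lambda>\<xi>. window \<xi> * cos (2 * pi * \<xi> * u))" for u
      by (rule cos_window_integrable) auto
    have "(LINT \<xi>|lborel. window \<xi> * (\<Sum>m\<in>I. \<Sum>n\<in>I. cos (2 * pi * \<xi> * of_int (m - n)) * l2_inner (F m) (F n)))
       = (LINT \<xi>|lborel. (\<Sum>m\<in>I. \<Sum>n\<in>I. window \<xi> * cos (2 * pi * \<xi> * of_int (m - n)) * l2_inner (F m) (F n)))"
      by (simp add: sum_distrib_left mult.assoc)
    also have "\<dots> = (\<Sum>m\<in>I. \<Sum>n\<in>I. LINT \<xi>|lborel. window \<xi> * cos (2 * pi * \<xi> * of_int (m - n)) * l2_inner (F m) (F n))"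
      using int by (subst Bochner_Integration.integral_sum;
        (intro Bochner_Integration.integrable_sum integrable_mult_left sum.cong refl Bochner_Integration.integral_sum)?) auto
    also have "\<dots> = (\<Sum>m\<in>I. \<Sum>n\<in>I. nsinc (of_int (m - n)) * l2_inner (F m) (F n))"
      using int by (simp add: nsinc_eq_integral)
    finally show ?thesis .
  qed
  also have "\<dots> = (\<Sum>m\<in>I. l2_inner (F m) (F m))"
  proof (intro sum.cong refl)
    fix m assume "m \<in> I"
    have "(\<Sum>n\<in>I. nsinc (of_int (m - n)) * l2_inner (F m) (F n)) = (\<Sum>n\<in>I. if n = m then l2_inner (F m) (F n) else 0)"
      unfolding nsinc_of_int by (intro sum.cong) auto
    also have "\<dots> = l2_inner (F m) (F m)" using \<open>m \<in> I\<close> by (simp add: I_def)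
    finally show "(\<Sum>n\<in>I. nsinc (of_int (m - n)) * l2_inner (F m) (F n)) = l2_inner (F m) (F m)" .
  qed
  finally show ?thesis unfolding norm_split .
qed

section \<open>The band-limiting operator is injective on an interval\<close>

lemma window_form_zero_imp_tr_zero:
  assumes f: "f \<in> sqint a b"
    and zero: "(LINT \<xi>|lborel. window \<xi> * ((cos_tr f \<xi>)\<^sup>2 + (sin_tr f \<xi>)\<^sup>2)) = 0"
    and \<xi>: "\<xi> \<in> {-1/2..1/2}"
  shows "cos_tr f \<xi> = 0" "sin_tr f \<xi> = 0"
proof -
  let ?h = "\<lambda>\<xi>. (cos_tr f \<xi>)\<^sup>2 + (sin_tr f \<xi>)\<^sup>2"
  have cont: "continuous_on (cbox (-1/2) (1/2)) ?h"
    using continuous_tr[OF f] by (intro continuous_intros) (auto elim: continuous_on_subset)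
  have int: "set_integrable lborel {-1/2..1/2} ?h"
    using window_tr_mult_integrable[OF f f]
    by (simp add: set_integrable_def window_def power2_eq_square distrib_left)
  have "integral {-1/2..1/2} ?h = 0"
    using zero set_borel_integral_eq_integral(2)[OF int]
    by (simp add: set_lebesgue_integral_def window_def)
  then have "(?h has_integral 0) (cbox (-1/2) (1/2))"
    using set_borel_integral_eq_integral(1)[OF int] by (simp add: has_integral_iff)
  then have "?h \<xi> = 0"
    using \<xi> by (intro has_integral_0_cbox_imp_0[OF cont, of \<xi>]) auto
  then show "cos_tr f \<xi> = 0" "sin_tr f \<xi> = 0" by (auto simp: sum_power2_eq_zero_iff)
qed

lemma power_mult_sqint:
  assumes f: "f \<in> sqint a b"
  shows "(\<lambda>y. y ^ n * f y) \<in> sqint a b"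
proof -
  define M where "M = max \<bar>a\<bar> \<bar>b\<bar>"
  have "(\<lambda>y. (y ^ n * indicator {a<..<b} y) * f y) \<in> sqint a b"
  proof (rule mult_bounded_sqint[OF f, where B = "M ^ n"])
    show "\<bar>y ^ n * indicator {a<..<b} y\<bar> \<le> M ^ n" for y
    proof (cases "y \<in> {a<..<b}")
      case True
      then have "\<bar>y\<bar> \<le> M" by (auto simp: M_def)
      then show ?thesis using True by (simp add: power_abs power_mono)
    qed (simp add: M_def)
  qed measurable
  moreover have "(y ^ n * indicator {a<..<b} y) * f y = y ^ n * f y" for y
    using sqintD(3)[OF f, of y] by (cases "y \<in> {a<..<b}") auto
  ultimately show ?thesis by simp
qed

text \<open>
  If the transform vanishes on an interval of frequencies, so do its derivatives there, which are the
  transforms of \<open>y\<^sup>n f(y)\<close>. A general phase \<open>\<theta>\<close> makes the induction close up, since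
  differentiation shifts the phase by \<open>\<pi>/2\<close>. At \<open>\<xi> = 0\<close> the conclusion says that all moments vanish.
\<close>

lemma tr_zero_imp_weighted_tr_zero:
  assumes f: "f \<in> sqint a b"
    and zero: "\<And>\<xi>. \<xi> \<in> {-1/2..1/2} \<Longrightarrow> cos_tr f \<xi> = 0" "\<And>\<xi>. \<xi> \<in> {-1/2..1/2} \<Longrightarrow> sin_tr f \<xi> = 0"
    and \<xi>: "\<xi> \<in> {-1/2<..<1/2}"
  shows "(LINT y|lborel. cos (2 * pi * \<xi> * y + \<theta>) * (y ^ n * f y)) = 0"
  using \<xi>
proof (induction n arbitrary: \<xi> \<theta>)
  case 0
  have "(LINT y|lborel. cos (2 * pi * \<xi> * y + \<theta>) * f y) =
      (LINT y|lborel. cos \<theta> * (cos (2 * pi * \<xi> * y) * f y) - sin \<theta> * (sin (2 * pi * \<xi> * y) * f y))"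
    by (intro Bochner_Integration.integral_cong refl) (simp add: cos_add algebra_simps)
  also have "\<dots> = cos \<theta> * cos_tr f \<xi> - sin \<theta> * sin_tr f \<xi>"
    unfolding cos_tr_def sin_tr_def using cos_sin_integrable[OF integrable_sqint[OF f]]
    by (subst Bochner_Integration.integral_diff) auto
  also have "\<dots> = 0" using zero[of \<xi>] 0 by simp
  finally show ?case by simp
next
  case (Suc n)
  define \<theta>' where "\<theta>' = \<theta> + pi / 2"
  \<comment> \<open>Increments tending to zero that keep \<open>\<xi> + d k\<close> inside the window.\<close>
  define d where "d k = (1/2 - \<xi>) / real (Suc (Suc k))" for k
  have d_pos: "0 < d k" for k using Suc.prems by (simp add: d_def)
  have d_less: "\<xi> + d k \<in> {-1/2<..<1/2}" for k
  proof -
    have "(1/2 - \<xi>) * 1 < (1/2 - \<xi>) * real (Suc (Suc k))"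
      using Suc.prems by (intro mult_strict_left_mono) auto
    then have "d k < 1/2 - \<xi>" unfolding d_def by (subst pos_divide_less_eq) simp_all
    then show ?thesis using Suc.prems d_pos[of k] by auto
  qed
  have d_lim: "d \<longlonglongrightarrow> 0"
    unfolding d_def by (rule LIMSEQ_Suc[OF LIMSEQ_Suc[OF lim_const_over_n]])
  have d_at: "filterlim d (at 0) sequentially"
    unfolding filterlim_at using d_lim d_pos by (auto simp: less_imp_neq[symmetric])
  define s where "s k y = (cos (2 * pi * (\<xi> + d k) * y + \<theta>') - cos (2 * pi * \<xi> * y + \<theta>')) / d k * (y ^ n * f y)" for k y
  note fn = integrable_sqint[OF power_mult_sqint[OF f]]
  have [measurable]: "f \<in> borel_measurable borel" by (rule sqintD(1)[OF f])
  have s_int: "(LINT y|lborel. s k y) = 0" for k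
  proof -
    have "(LINT y|lborel. s k y) = (LINT y|lborel. (cos (2 * pi * (\<xi> + d k) * y + \<theta>') * (y ^ n * f y)
        - cos (2 * pi * \<xi> * y + \<theta>') * (y ^ n * f y)) / d k)"
      unfolding s_def by (intro Bochner_Integration.integral_cong refl) (simp add: left_diff_distrib)
    also have "\<dots> = ((LINT y|lborel. cos (2 * pi * (\<xi> + d k) * y + \<theta>') * (y ^ n * f y))
        - (LINT y|lborel. cos (2 * pi * \<xi> * y + \<theta>') * (y ^ n * f y))) / d k"
      using Bochner_Integration.integral_diff[OF cos_sin_integrable(3)[OF fn] cos_sin_integrable(3)[OF fn]] by simp
    also have "\<dots> = 0" using Suc.IH[OF d_less] Suc.IH[OF Suc.prems] by simp
    finally show ?thesis .
  qed
  have "(\<lambda>k. LINT y|lborel. s k y) \<longlonglongrightarrow> (LINT y|lborel. (- 2 * pi) * (cos (2 * pi * \<xi> * y + \<theta>) * (y ^ Suc n * f y)))"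
  proof (rule integral_dominated_convergence)
    show "(\<lambda>y. (- 2 * pi) * (cos (2 * pi * \<xi> * y + \<theta>) * (y ^ Suc n * f y))) \<in> borel_measurable lborel"
      by simp
    show "s k \<in> borel_measurable lborel" for k unfolding s_def by simp
    show "integrable lborel (\<lambda>y. 2 * pi * \<bar>y ^ Suc n * f y\<bar>)"
      by (intro integrable_mult_right integrable_abs fn)
    show "AE y in lborel. (\<lambda>k. s k y) \<longlonglongrightarrow> (- 2 * pi) * (cos (2 * pi * \<xi> * y + \<theta>) * (y ^ Suc n * f y))"
    proof (rule AE_I2)
      fix y
      have "((\<lambda>\<eta>. cos (2 * pi * \<eta> * y + \<theta>')) has_real_derivative (- sin (2 * pi * \<xi> * y + \<theta>') * (2 * pi * y))) (at \<xi>)"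
        by (auto intro!: derivative_eq_intros)
      then have "((\<lambda>h. (cos (2 * pi * (\<xi> + h) * y + \<theta>') - cos (2 * pi * \<xi> * y + \<theta>')) / h) \<longlongrightarrow>
          - sin (2 * pi * \<xi> * y + \<theta>') * (2 * pi * y)) (at 0)"
        by (simp add: DERIV_def)
      then have "((\<lambda>k. (cos (2 * pi * (\<xi> + d k) * y + \<theta>') - cos (2 * pi * \<xi> * y + \<theta>')) / d k) \<longlongrightarrow>
          - sin (2 * pi * \<xi> * y + \<theta>') * (2 * pi * y)) sequentially"
        by (rule filterlim_compose[OF _ d_at])
      moreover have "sin (2 * pi * \<xi> * y + \<theta>') = cos (2 * pi * \<xi> * y + \<theta>)"
        by (simp add: \<theta>'_def sin_add cos_add)
      ultimately have "(\<lambda>k. s k y) \<longlonglongrightarrow> - cos (2 * pi * \<xi> * y + \<theta>) * (2 * pi * y) * (y ^ n * f y)"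
        unfolding s_def by (intro tendsto_mult tendsto_const) simp
      then show "(\<lambda>k. s k y) \<longlonglongrightarrow> (- 2 * pi) * (cos (2 * pi * \<xi> * y + \<theta>) * (y ^ Suc n * f y))"
        by (simp add: mult_ac)
    qed
    show "AE y in lborel. norm (s k y) \<le> 2 * pi * \<bar>y ^ Suc n * f y\<bar>" for k
    proof (rule AE_I2)
      fix y
      have "\<bar>cos (2 * pi * (\<xi> + d k) * y + \<theta>') - cos (2 * pi * \<xi> * y + \<theta>')\<bar> \<le> \<bar>2 * pi * (\<xi> + d k) * y - 2 * pi * \<xi> * y\<bar>"
        using abs_cos_diff_le[of "2 * pi * (\<xi> + d k) * y + \<theta>'" "2 * pi * \<xi> * y + \<theta>'"] by simp
      also have "\<dots> = 2 * pi * \<bar>y\<bar> * d k" using d_pos[of k] by (simp add: distrib_left distrib_right abs_mult)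
      finally have "\<bar>(cos (2 * pi * (\<xi> + d k) * y + \<theta>') - cos (2 * pi * \<xi> * y + \<theta>')) / d k\<bar> \<le> 2 * pi * \<bar>y\<bar>"
        using d_pos[of k] by (simp add: abs_divide divide_le_eq)
      then have "\<bar>(cos (2 * pi * (\<xi> + d k) * y + \<theta>') - cos (2 * pi * \<xi> * y + \<theta>')) / d k\<bar> * \<bar>y ^ n * f y\<bar>
          \<le> 2 * pi * \<bar>y\<bar> * \<bar>y ^ n * f y\<bar>"
        by (intro mult_right_mono) auto
      then show "norm (s k y) \<le> 2 * pi * \<bar>y ^ Suc n * f y\<bar>"
        unfolding s_def by (simp add: abs_mult mult_ac)
    qed
  qed
  then have "(LINT y|lborel. (- 2 * pi) * (cos (2 * pi * \<xi> * y + \<theta>) * (y ^ Suc n * f y))) = 0"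
    unfolding s_int by (rule LIMSEQ_unique[OF _ tendsto_const])
  then show ?case by simp
qed

text \<open>
  Weierstrass approximation on \<open>[a, b]\<close>.
\<close>

lemma moments_zero_imp_orthogonal_continuous:
  assumes f: "f \<in> sqint a b" and moments: "\<And>n. (LINT y|lborel. y ^ n * f y) = 0"
    and g: "continuous_on UNIV g" "\<And>x. \<bar>g x\<bar> \<le> 1"
  shows "(LINT y|lborel. g y * f y) = 0"
proof -
  note fi = integrable_sqint[OF f]
  have gi: "integrable lborel (\<lambda>y. g y * f y)"
    by (rule integrable_bounded_mult[OF fi _ g(2)]) (rule borel_measurable_continuous_onI[OF g(1)])
  have "\<bar>LINT y|lborel. g y * f y\<bar> \<le> e * (LINT y|lborel. \<bar>f y\<bar>)" if "0 < e" for e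
  proof -
    obtain p where "real_polynomial_function p" and p: "\<And>x. x \<in> {a..b} \<Longrightarrow> \<bar>g x - p x\<bar> < e"
      using Stone_Weierstrass_real_polynomial_function[of "{a..b}" g e] \<open>0 < e\<close> g(1)
      by (metis compact_Icc continuous_on_subset subset_UNIV)
    then obtain c n where pc: "p = (\<lambda>x. \<Sum>i\<le>n. c i * x ^ i)" by (auto simp: real_polynomial_function_iff_sum)
    have "(\<lambda>y. p y * f y) = (\<lambda>y. \<Sum>i\<le>n. c i * (y ^ i * f y))"
      by (simp add: pc sum_distrib_right mult.assoc)
    then have pi: "integrable lborel (\<lambda>y. p y * f y)" and p0: "(LINT y|lborel. p y * f y) = 0"
      using integrable_sqint[OF power_mult_sqint[OF f]] moments by simp_all
    have "\<bar>LINT y|lborel. g y * f y\<bar> = \<bar>LINT y|lborel. g y * f y - p y * f y\<bar>"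
      using p0 gi pi by simp
    also have "\<dots> \<le> (LINT y|lborel. \<bar>g y * f y - p y * f y\<bar>)" by (rule integral_abs_bound)
    also have "\<dots> \<le> (LINT y|lborel. e * \<bar>f y\<bar>)"
    proof (intro integral_mono integrable_abs integrable_mult_right fi Bochner_Integration.integrable_diff gi pi)
      fix y
      show "\<bar>g y * f y - p y * f y\<bar> \<le> e * \<bar>f y\<bar>"
      proof (cases "y \<in> {a<..<b}")
        case True
        then have "\<bar>g y - p y\<bar> \<le> e" using p[of y] by auto
        then show ?thesis by (simp add: abs_mult mult_right_mono flip: left_diff_distrib)
      qed (use sqintD(3)[OF f] in simp)
    qed
    finally show ?thesis by simp
  qed
  note small = this
  show ?thesis
  proof (rule ccontr)
    assume ne: "(LINT y|lborel. g y * f y) \<noteq> 0"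
    define A where "A = \<bar>LINT y|lborel. g y * f y\<bar>"
    define B where "B = (LINT y|lborel. \<bar>f y\<bar>)"
    have "0 < A" using ne by (simp add: A_def)
    have "0 \<le> B" by (simp add: B_def)
    have "A \<le> (A / (2 * (B + 1))) * B"
      using small[of "A / (2 * (B + 1))"] \<open>0 < A\<close> \<open>0 \<le> B\<close>
      unfolding A_def[symmetric] B_def[symmetric] by simp
    also have "\<dots> < A" using \<open>0 < A\<close> \<open>0 \<le> B\<close> by (simp add: field_simps add_nonneg_pos)
    finally show False by simp
  qed
qed

text \<open>
  A form value of zero makes the Fourier transform vanish on the window, hence all moments vanish and \<open>f\<close> is
  orthogonal to bounded continuous functions. Continuous functions \<open>g\<^sub>n\<close> converge to \<open>f\<close>
  almost everywhere; truncating them at \<open>\<plusminus>1\<close> gives in the limit a function \<open>clamp f\<close> with the sign of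
  \<open>f\<close>, and \<open>\<integral> clamp f f = 0\<close> forces \<open>f = 0\<close>.
\<close>

lemma sinc_op_definite:
  assumes f: "f \<in> sqint a b"
    and zero: "(LINT \<xi>|lborel. window \<xi> * ((cos_tr f \<xi>)\<^sup>2 + (sin_tr f \<xi>)\<^sup>2)) = 0"
  shows "AE x in lborel. f x = 0"
proof -
  have moments: "(LINT y|lborel. y ^ n * f y) = 0" for n
    using tr_zero_imp_weighted_tr_zero[OF f window_form_zero_imp_tr_zero[OF f zero], of 0 0 n] by simp
  have meas: "f \<in> borel_measurable borel" by (rule sqintD(1)[OF f])
  then have "f measurable_on UNIV"
    by (intro lebesgue_measurable_imp_measurable_on) (auto intro: measurable_completion)
  then obtain N g where N: "negligible N" and g: "\<And>n. continuous_on UNIV (g n)"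
    and lim: "\<And>x. x \<notin> N \<Longrightarrow> (\<lambda>n. g n x) \<longlonglongrightarrow> f x"
    unfolding measurable_on_def by auto
  define clamp where "clamp t = max (-1) (min 1 t)" for t :: real
  have clamp_cont: "continuous_on UNIV clamp" unfolding clamp_def by (intro continuous_intros)
  have clamp_le: "\<bar>clamp t\<bar> \<le> 1" for t by (auto simp: clamp_def)
  have orth: "(LINT y|lborel. clamp (g n y) * f y) = 0" for n
  proof (rule moments_zero_imp_orthogonal_continuous[OF f moments])
    show "continuous_on UNIV (\<lambda>y. clamp (g n y))"
      using continuous_on_compose2[OF clamp_cont g] by simp
  qed (rule clamp_le)
  have [measurable]: "clamp \<in> borel_measurable borel" "\<And>n. g n \<in> borel_measurable borel"
    using clamp_cont g by (auto intro: borel_measurable_continuous_onI)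
  have "(\<lambda>n. LINT y|lborel. clamp (g n y) * f y) \<longlonglongrightarrow> (LINT y|lborel. clamp (f y) * f y)"
  proof (rule integral_dominated_convergence)
    show "(\<lambda>y. clamp (f y) * f y) \<in> borel_measurable lborel" using meas by simp
    show "(\<lambda>y. clamp (g n y) * f y) \<in> borel_measurable lborel" for n using meas by simp
    show "integrable lborel (\<lambda>y. \<bar>f y\<bar>)" by (intro integrable_abs integrable_sqint[OF f])
    have "AE y in lebesgue. y \<notin> N" using N by (auto simp: negligible_iff_null_sets intro: AE_not_in)
    then have "AE y in lborel. y \<notin> N" by (simp add: AE_completion_iff)
    then show "AE y in lborel. (\<lambda>n. clamp (g n y) * f y) \<longlonglongrightarrow> clamp (f y) * f y"
    proof eventually_elim
      case (elim y)
      have "isCont clamp (f y)" using clamp_cont by (simp add: continuous_on_eq_continuous_at)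
      then show ?case by (intro tendsto_mult tendsto_const isCont_tendsto_compose[OF _ lim[OF elim]])
    qed
    show "AE y in lborel. norm (clamp (g n y) * f y) \<le> \<bar>f y\<bar>" for n
      using clamp_le by (intro AE_I2) (simp add: abs_mult mult_left_le_one_le)
  qed
  then have "(LINT y|lborel. clamp (f y) * f y) = 0"
    unfolding orth by (rule LIMSEQ_unique[OF _ tendsto_const])
  moreover have "integrable lborel (\<lambda>y. clamp (f y) * f y)"
    using meas clamp_le by (intro integrable_bounded_mult[OF integrable_sqint[OF f], of _ 1]) auto
  moreover have "0 \<le> clamp t * t" for t by (auto simp: clamp_def max_def min_def zero_le_mult_iff)
  ultimately have "AE y in lborel. clamp (f y) * f y = 0"
    by (subst integral_nonneg_eq_0_iff_AE[symmetric]) auto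
  then show ?thesis by eventually_elim (auto simp: clamp_def max_def min_def split: if_splits)
qed

section \<open>Compactness and the energy outside the interval\<close>

text \<open>
  Arzela--Ascoli: a bounded set of \<open>L\<^sup>2(a, b)\<close> is bounded in \<open>L\<^sup>1\<close>, so its images are bounded and
  equi-Lipschitz. Uniform convergence on a bounded interval implies convergence in norm.
\<close>

lemma sinc_op_compact:
  assumes s: "\<And>n. s n \<in> sqint a b" "\<And>n. l2_inner (s n) (s n) \<le> 1" and "a < b"
  shows "\<exists>(r :: nat \<Rightarrow> nat) g. strict_mono r \<and> g \<in> sqint a b \<and>
    (\<lambda>n. l2_inner (\<lambda>x. sinc_op a b (s (r n)) x - g x) (\<lambda>x. sinc_op a b (s (r n)) x - g x)) \<longlonglongrightarrow> 0"
proof -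
  define M where "M = sqrt (b - a)"
  have M: "0 < M" using \<open>a < b\<close> by (simp add: M_def)
  have L1: "(LINT x|lborel. \<bar>s n x\<bar>) \<le> M" for n
  proof -
    have "(LINT x|lborel. \<bar>s n x\<bar>) \<le> M * sqrt (l2_inner (s n) (s n))"
      unfolding M_def using \<open>a < b\<close> by (intro L1_le_L2 s(1)) simp
    also have "\<dots> \<le> M * 1" using s(2) M by (intro mult_left_mono) auto
    finally show ?thesis by simp
  qed
  note int = integrable_sqint[OF s(1)]
  obtain g k where g: "continuous_on {a..b} g" and k: "strict_mono (k :: nat \<Rightarrow> nat)"
    and unif: "\<And>e. 0 < e \<Longrightarrow> \<exists>N. \<forall>n x. n \<ge> N \<and> x \<in> {a..b} \<longrightarrow> norm (sinc_conv (s (k n)) x - g x) < e"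
  proof (rule Arzela_Ascoli[of "{a..b}" "\<lambda>n. sinc_conv (s n)" M])
    show "norm (sinc_conv (s n) x) \<le> M" for n x
      using abs_sinc_conv_le[OF int, of n x] L1[of n] by simp
    fix x e :: real assume "0 < e"
    show "\<exists>d>0. \<forall>n y. y \<in> {a..b} \<and> norm (x - y) < d \<longrightarrow> norm (sinc_conv (s n) x - sinc_conv (s n) y) < e"
    proof (intro exI[of _ "e / (pi * M)"] conjI allI impI)
      show "0 < e / (pi * M)" using \<open>0 < e\<close> M by simp
      fix n y assume "y \<in> {a..b} \<and> norm (x - y) < e / (pi * M)"
      then have "\<bar>x - y\<bar> * (pi * M) < e" using M by (simp add: pos_less_divide_eq)
      have "\<bar>sinc_conv (s n) x - sinc_conv (s n) y\<bar> \<le> pi * \<bar>x - y\<bar> * (LINT y|lborel. \<bar>s n y\<bar>)"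
        by (rule sinc_conv_lipschitz[OF int])
      also have "\<dots> \<le> pi * \<bar>x - y\<bar> * M" by (intro mult_left_mono L1) auto
      also have "\<dots> < e" using \<open>\<bar>x - y\<bar> * (pi * M) < e\<close> by (simp add: mult_ac)
      finally show "norm (sinc_conv (s n) x - sinc_conv (s n) y) < e" by simp
    qed
  qed (auto intro: that)
  define G where "G x = indicator {a<..<b} x * g x" for x
  have "compact (g ` {a..b})" by (intro compact_continuous_image g) simp
  then have "bounded (g ` {a..b})" by (rule compact_imp_bounded)
  then obtain B where "\<forall>y\<in>g ` {a..b}. norm y \<le> B" unfolding bounded_iff by blast
  then have B: "\<bar>g x\<bar> \<le> B" if "x \<in> {a..b}" for x using that by auto
  have G: "G \<in> sqint a b"
  proof (rule sqint_bounded[of _ "max B 0"])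
    have "continuous_on {a<..<b} g" using g by (rule continuous_on_subset) auto
    then show "G \<in> borel_measurable borel"
      unfolding G_def[abs_def]
      using borel_measurable_continuous_on_indicator[of "{a<..<b}" g] by simp
    show "\<bar>G x\<bar> \<le> max B 0" for x using B[of x] by (auto simp: G_def indicator_def)
  qed (auto simp: G_def)
  have "(\<lambda>n. l2_inner (\<lambda>x. sinc_op a b (s (k n)) x - G x) (\<lambda>x. sinc_op a b (s (k n)) x - G x)) \<longlonglongrightarrow> 0"
  proof (rule LIMSEQ_I)
    fix e :: real assume "0 < e"
    define \<epsilon> where "\<epsilon> = sqrt (e / (2 * (b - a)))"
    have "\<epsilon> * \<epsilon> = e / (2 * (b - a))" using \<open>0 < e\<close> \<open>a < b\<close> by (simp add: \<epsilon>_def)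
    then have "\<epsilon> * \<epsilon> * (b - a) = e / 2" using \<open>a < b\<close> by (simp add: field_simps)
    moreover have "0 < \<epsilon>" using \<open>0 < e\<close> \<open>a < b\<close> by (simp add: \<epsilon>_def)
    ultimately have \<epsilon>: "0 < \<epsilon>" "\<epsilon> * \<epsilon> * (b - a) < e" using \<open>0 < e\<close> by simp_all
    obtain N where N: "\<And>n x. n \<ge> N \<Longrightarrow> x \<in> {a..b} \<Longrightarrow> \<bar>sinc_conv (s (k n)) x - g x\<bar> < \<epsilon>"
      using unif[OF \<epsilon>(1)] by auto
    show "\<exists>N. \<forall>n\<ge>N. norm (l2_inner (\<lambda>x. sinc_op a b (s (k n)) x - G x) (\<lambda>x. sinc_op a b (s (k n)) x - G x) - 0) < e"
    proof (intro exI[of _ N] allI impI)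
      fix n assume "N \<le> n"
      let ?D = "\<lambda>x. sinc_op a b (s (k n)) x - G x"
      have D: "?D \<in> sqint a b" by (intro sqint.diff_closed sinc_op_sqint int G)
      have "l2_inner ?D ?D \<le> (LINT x|lborel. (\<epsilon> * \<epsilon>) * indicator {a<..<b} x)"
        unfolding l2_inner_def
      proof (intro integral_mono integrable_mult_sqint[OF D D] integrable_mult_right)
        show "integrable lborel (indicator {a<..<b} :: real \<Rightarrow> real)" by (rule integrable_sqint[OF indicator_sqint])
        fix x
        show "?D x * ?D x \<le> (\<epsilon> * \<epsilon>) * indicator {a<..<b} x"
        proof (cases "x \<in> {a<..<b}")
          case True
          then have "\<bar>?D x\<bar> \<le> \<epsilon>" using N[OF \<open>N \<le> n\<close>, of x] by (auto simp: sinc_op_def G_def)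
          then have "\<bar>?D x\<bar> * \<bar>?D x\<bar> \<le> \<epsilon> * \<epsilon>" by (intro mult_mono) auto
          then show ?thesis using True by (simp add: abs_mult_self_eq)
        qed (simp add: sinc_op_def G_def)
      qed
      also have "\<dots> = \<epsilon> * \<epsilon> * (b - a)" using \<open>a < b\<close> by simp
      also have "\<dots> < e" by (rule \<epsilon>(2))
      finally show "norm (l2_inner ?D ?D - 0) < e" using sqint.ip_nonneg[OF D] by simp
    qed
  qed
  then show ?thesis using k G by blast
qed

text \<open>
  Among the combinations of \<open>n + 1\<close> indicators of disjoint intervals, some nonzero one is orthogonal to \<open>n\<close> given
  functions.
\<close>

lemma sqint_infinite_dim:
  assumes e: "\<And>i. i < n \<Longrightarrow> e i \<in> sqint a b" and "a < b"
  shows "\<exists>f\<in>sqint a b. (\<forall>i<(n::nat). l2_inner (e i) f = 0) \<and> 0 < l2_inner f f"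
proof -
  define h where "h = (b - a) / real (Suc n)"
  have h: "0 < h" "h * real (Suc n) = b - a" using \<open>a < b\<close> by (auto simp: h_def)
  define I where "I k = {a + real k * h<..<a + real (Suc k) * h}" for k :: nat
  define u :: "nat \<Rightarrow> real \<Rightarrow> real" where "u k = indicator (I k)" for k
  have I_sub: "I k \<subseteq> {a<..<b}" if "k \<le> n" for k
  proof -
    have "real (Suc k) * h \<le> real (Suc n) * h" using that h by (intro mult_right_mono) auto
    moreover have "0 \<le> real k * h" using h by simp
    ultimately show ?thesis using h(2) by (auto simp: I_def mult.commute)
  qed
  have disj: "I j \<inter> I k = {}" if "j < k" for j k
  proof -
    have "real (Suc j) * h \<le> real k * h" using that h by (intro mult_right_mono) auto
    then show ?thesis by (auto simp: I_def)
  qed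
  have u: "u k \<in> sqint a b" if "k \<le> n" for k
    using I_sub[OF that] by (intro sqint_bounded[of _ 1]) (auto simp: u_def indicator_def I_def)
  have ip_u: "l2_inner (u j) (u k) = (if j = k then h else 0)" for j k
  proof (cases "j = k")
    case True
    have "a + real k * h \<le> a + real (Suc k) * h" using h by (intro add_left_mono mult_right_mono) auto
    then show ?thesis using True
      by (simp add: l2_inner_def u_def I_def algebra_simps flip: indicator_inter_arith)
  next
    case False
    then have "I j \<inter> I k = {}" using disj[of j k] disj[of k j] by (cases "j < k") auto
    then show ?thesis using False by (simp add: l2_inner_def u_def flip: indicator_inter_arith)
  qed
  obtain c where c: "\<exists>k\<in>{..n}. c k \<noteq> 0" "\<And>i. i < n \<Longrightarrow> (\<Sum>k\<le>n. c k * l2_inner (e i) (u k)) = 0"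
    using homogeneous_system_nontrivial[of "{..<n}" "{..n}" "\<lambda>k i. l2_inner (e i) (u k)"] by auto
  define f where "f = (\<lambda>x. \<Sum>k\<le>n. c k * u k x)"
  have f: "f \<in> sqint a b" unfolding f_def using u by (intro sqint.sum_closed) auto
  have "l2_inner (e i) f = 0" if "i < n" for i
    unfolding f_def using u c(2)[OF that] by (subst sqint.ip_sum_right[OF _ _ e[OF that]]) auto
  moreover have "l2_inner f f = (\<Sum>k\<le>n. c k * l2_inner (u k) f)"
    using sqint.ip_sum_left[of "{..n}" u a b f c] u f by (simp add: f_def)
  moreover have "l2_inner (u k) f = c k * h" if "k \<le> n" for k
  proof -
    have "l2_inner (u k) f = (\<Sum>j\<le>n. c j * l2_inner (u k) (u j))"
      unfolding f_def using u that by (subst sqint.ip_sum_right[of _ _ a b]) auto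
    also have "\<dots> = c k * h" using that by (simp add: ip_u if_distrib cong: if_cong)
    finally show ?thesis .
  qed
  moreover have "0 < (\<Sum>k\<le>n. c k * (c k * h))"
  proof -
    obtain k where k: "k \<le> n" "c k \<noteq> 0" using c(1) by auto
    show ?thesis
      by (rule sum_pos2[of _ k]) (use k h in \<open>auto simp: mult.assoc[symmetric] zero_less_mult_iff linorder_neq_iff\<close>)
  qed
  ultimately show ?thesis using f by (intro bexI[of _ f]) auto
qed

lemma l2_inner_zero_iff_AE:
  assumes "f \<in> sqint a b"
  shows "l2_inner f f = 0 \<longleftrightarrow> (AE x in lborel. f x = 0)"
  unfolding l2_inner_def using integrable_mult_sqint[OF assms assms]
  by (subst integral_nonneg_eq_0_iff_AE) auto

lemma sinc_conv_lincomb: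
  assumes "integrable lborel f" "integrable lborel g"
  shows "sinc_conv (\<lambda>x. f x + c * g x) x = sinc_conv f x + c * sinc_conv g x"
  unfolding sinc_conv_def using sinc_integrable[OF assms(1)] sinc_integrable[OF assms(2)]
  by (simp add: distrib_left mult.left_commute[of _ c])

lemma sinc_positive_contraction: "positive_contraction (sqint a b) l2_inner (sinc_op a b)"
proof unfold_locales
  fix f g :: "real \<Rightarrow> real" and c :: real
  show "f \<in> sqint a b \<Longrightarrow> sinc_op a b f \<in> sqint a b" by (intro sinc_op_sqint integrable_sqint)
  show "sinc_op a b (\<lambda>x. f x + c * g x) = (\<lambda>x. sinc_op a b f x + c * sinc_op a b g x)"
    if "f \<in> sqint a b" "g \<in> sqint a b"
    using sinc_conv_lincomb[OF that[THEN integrable_sqint]] by (auto simp: sinc_op_def fun_eq_iff algebra_simps)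
  show "l2_inner (sinc_op a b f) g = l2_inner f (sinc_op a b g)" if f: "f \<in> sqint a b" and g: "g \<in> sqint a b"
  proof -
    have "l2_inner f (sinc_op a b g) = l2_inner (sinc_op a b g) f" by (simp add: l2_inner_def mult.commute)
    then show ?thesis unfolding l2_inner_sinc_op_eq_tr[OF f g] l2_inner_sinc_op_eq_tr[OF g f] by (simp add: mult.commute)
  qed
  show "0 \<le> l2_inner (sinc_op a b f) f" if f: "f \<in> sqint a b"
    unfolding l2_inner_sinc_op_eq_tr[OF f f] using window_bounds
    by (intro integral_nonneg_AE AE_I2) (simp add: add_nonneg_nonneg)
  show "l2_inner (sinc_op a b f) f \<le> l2_inner f f" if f: "f \<in> sqint a b"
    unfolding l2_inner_sinc_op_eq_tr[OF f f] using sinc_form_le[OF f] by (simp add: power2_eq_square)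
qed

lemma sinc_compact_positive_contraction:
  assumes "a < b" shows "compact_positive_contraction (sqint a b) l2_inner (sinc_op a b)"
proof -
  interpret positive_contraction "sqint a b" l2_inner "sinc_op a b" by (rule sinc_positive_contraction)
  show ?thesis
  proof unfold_locales
    show "l2_inner f f = 0" if f: "f \<in> sqint a b" and "l2_inner (sinc_op a b f) f = 0" for f
      using that sinc_op_definite[OF f] by (simp add: l2_inner_zero_iff_AE l2_inner_sinc_op_eq_tr power2_eq_square)
  qed (use sinc_op_compact[OF _ _ assms] sqint_infinite_dim[OF _ assms] in blast)+
qed

text \<open>
  Let \<open>Q'\<close> be the compression of \<open>Q\<close> to \<open>(-l, l)\<close>. From \<open>0 \<le> Q' \<le> 1\<close> follows \<open>\<parallel>Q'f\<parallel>\<^sup>2 \<le> \<langle>Q'f, f\<rangle> = \<langle>Sf, f\<rangle>\<close>.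
  On the left, the part of \<open>Q'f\<close> in \<open>(0, l)\<close> contributes \<open>\<parallel>Sf\<parallel>\<^sup>2\<close>. So the part \<open>q\<close> in \<open>(-l, 0]\<close> has
  energy at most \<open>\<langle>Sf, f\<rangle> - \<parallel>Sf\<parallel>\<^sup>2\<close>; pairing it with \<open>h\<close> gives a lower bound for that
  energy which can be computed for explicit \<open>f\<close> and \<open>h\<close>.
\<close>

lemma exterior_energy_le:
  assumes l: "0 < l" and f: "f \<in> sqint 0 l" and h: "h \<in> sqint (- l) 0"
  shows "(LINT x|lborel. sinc_conv f x * h x)\<^sup>2
    \<le> l2_inner h h * (l2_inner (sinc_op 0 l f) f - l2_inner (sinc_op 0 l f) (sinc_op 0 l f))"
proof -
  interpret big: positive_contraction "sqint (- l) l" l2_inner "sinc_op (- l) l" by (rule sinc_positive_contraction)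
  have f': "f \<in> sqint (- l) l" using f l by (auto intro: sqint_mono)
  have h': "h \<in> sqint (- l) l" using h l by (auto intro: sqint_mono)
  note fi = integrable_sqint[OF f]
  define p where "p = sinc_op 0 l f"
  define q where "q = (\<lambda>x. sinc_op (- l) l f x - p x)"
  have p: "p \<in> sqint 0 l" unfolding p_def by (rule sinc_op_sqint[OF fi])
  have p': "p \<in> sqint (- l) l" using p l by (auto intro: sqint_mono)
  have q: "q \<in> sqint (- l) l" unfolding q_def by (intro sqint.diff_closed sinc_op_sqint fi p')
  have pq: "p x * q x = 0" for x using l by (auto simp: p_def q_def sinc_op_def indicator_def)
  have sum: "sinc_op (- l) l f = (\<lambda>x. p x + 1 * q x)" by (simp add: q_def)
  have orth: "l2_inner p q = 0" by (simp add: l2_inner_def pq)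
  have "l2_inner (sinc_op (- l) l f) (sinc_op (- l) l f) = l2_inner p p + l2_inner q q"
    unfolding sum sqint.ip_lincomb_self[OF p' q] orth by simp
  moreover have "l2_inner (sinc_op (- l) l f) f = l2_inner p f"
    unfolding p_def by (simp add: l2_inner_sinc_op[OF f'] l2_inner_sinc_op[OF f])
  ultimately have q_le: "l2_inner q q \<le> l2_inner p f - l2_inner p p"
    using big.norm_image_le_form[OF f'] by simp
  have "(LINT x|lborel. sinc_conv f x * h x) = l2_inner q h"
    unfolding l2_inner_def
  proof (intro Bochner_Integration.integral_cong refl)
    fix x
    show "sinc_conv f x * h x = q x * h x"
      using sqintD(3)[OF h, of x] l by (cases "x \<in> {- l<..<0}") (auto simp: q_def p_def sinc_op_def)
  qed
  then have "(LINT x|lborel. sinc_conv f x * h x)\<^sup>2 \<le> l2_inner q q * l2_inner h h"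
    using sqint.Cauchy_Schwarz[OF q h'] by simp
  also have "\<dots> \<le> (l2_inner p f - l2_inner p p) * l2_inner h h"
    using q_le sqint.ip_nonneg[OF h] by (intro mult_right_mono)
  finally show ?thesis by (simp add: p_def mult.commute)
qed

section \<open>The list of eigenvalues\<close>

text \<open>
  At a first index \<open>n\<close> with \<open>g n < f n\<close>, the value \<open>f n\<close> is taken by \<open>g\<close> only before \<open>n\<close>, hence
  less often than by \<open>f\<close>.
\<close>

lemma decseq_eqI_fibres:
  fixes f g :: "nat \<Rightarrow> real"
  assumes f: "decseq f" and g: "decseq g"
    and fin: "\<And>v. finite {n. f n = v}" "\<And>v. finite {n. g n = v}"
    and card: "\<And>v. card {n. f n = v} = card {n. g n = v}"
  shows "f = g"
proof -
  have not_less: "\<not> g n < f n" if same: "\<forall>k<n. f k = g k" and g: "decseq g"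
    and fin: "\<And>v. finite {n. f n = v}" and card: "\<And>v. card {n. f n = v} = card {n. g n = v}"
    for f g :: "nat \<Rightarrow> real" and n
  proof
    assume less: "g n < f n"
    have "n \<in> {k. f k = f n}" "n \<notin> {k. g k = f n}" using less by auto
    then have ne: "{k. g k = f n} \<noteq> {k. f k = f n}" by blast
    have "{k. g k = f n} \<subset> {k. f k = f n}"
    proof (intro psubsetI subsetI ne)
      fix k assume "k \<in> {k. g k = f n}"
      moreover from this have "k < n"
        using less decseqD[OF g, of n k] by (cases "k < n") auto
      ultimately show "k \<in> {k. f k = f n}" using same by simp
    qed
    from psubset_card_mono[OF fin this] card show False by simp
  qed
  have "f n = g n" for n
  proof (induction n rule: less_induct)
    case (less n)
    then have "\<forall>k<n. f k = g k" "\<forall>k<n. g k = f k" by auto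
    with not_less[of n f g] not_less[of n g f] f g fin card show ?case by (metis linorder_neqE)
  qed
  then show ?thesis by auto
qed

text \<open>
  If \<open>d < d'\<close>, the second basis satisfies a nontrivial linear relation almost everywhere.
\<close>

lemma has_dim_AE_le:
  assumes V: "has_dim_AE M V d" and V': "has_dim_AE M V d'"
  shows "d' \<le> d"
proof (rule ccontr)
  assume "\<not> d' \<le> d"
  obtain b where b: "\<forall>f\<in>V. \<exists>c :: nat \<Rightarrow> complex. AE x in M. f x = (\<Sum>i<d. c i * b i x)"
    using V unfolding has_dim_AE_def by blast
  obtain b' where b'V: "\<forall>i<d'. b' i \<in> V"
    and indep: "\<And>c :: nat \<Rightarrow> complex. AE x in M. (\<Sum>i<d'. c i * b' i x) = 0 \<Longrightarrow> \<forall>i<d'. c i = 0"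
    using V' unfolding has_dim_AE_def by blast
  have "\<forall>j\<in>{..<d'}. \<exists>c :: nat \<Rightarrow> complex. AE x in M. b' j x = (\<Sum>i<d. c i * b i x)"
    using b b'V by blast
  then obtain C :: "nat \<Rightarrow> nat \<Rightarrow> complex"
    where C: "\<forall>j\<in>{..<d'}. AE x in M. b' j x = (\<Sum>i<d. C j i * b i x)"
    by (rule bchoice[THEN exE])
  obtain c where c: "\<exists>j\<in>{..<d'}. c j \<noteq> 0" "\<forall>i\<in>{..<d}. (\<Sum>j<d'. c j * C j i) = 0"
    using homogeneous_system_nontrivial[of "{..<d}" "{..<d'}" C] \<open>\<not> d' \<le> d\<close> by auto
  have "AE x in M. \<forall>j\<in>{..<d'}. b' j x = (\<Sum>i<d. C j i * b i x)"
    using C by (intro eventually_ball_finite) auto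
  then have "AE x in M. (\<Sum>j<d'. c j * b' j x) = 0"
  proof eventually_elim
    case (elim x)
    have "(\<Sum>j<d'. c j * b' j x) = (\<Sum>j<d'. \<Sum>i<d. c j * C j i * b i x)"
      using elim by (simp add: sum_distrib_left mult.assoc)
    also have "\<dots> = (\<Sum>i<d. (\<Sum>j<d'. c j * C j i) * b i x)"
      by (subst sum.swap) (simp add: sum_distrib_right)
    also have "\<dots> = 0" using c(2) by simp
    finally show ?case .
  qed
  from indep[OF this] c(1) show False by blast
qed

lemma has_dim_AE_unique: "has_dim_AE M V d \<Longrightarrow> has_dim_AE M V d' \<Longrightarrow> d = d'"
  using has_dim_AE_le by (metis le_antisym)

lemma lists_eigenvalues_unique:
  assumes f: "lists_eigenvalues l f" and g: "lists_eigenvalues l g"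
  shows "f = g"
proof (rule decseq_eqI_fibres)
  have real_fibre: "{n. of_real (h n) = (of_real v :: complex)} = {n. h n = v}" for h :: "nat \<Rightarrow> real" and v
    by simp
  show "decseq f" "decseq g" using f g by (auto simp: lists_eigenvalues_def)
  show "finite {n. f n = v}" "finite {n. g n = v}" for v
    using f g unfolding lists_eigenvalues_def real_fibre[symmetric] by blast+
  show "card {n. f n = v} = card {n. g n = v}" for v
    using f g has_dim_AE_unique unfolding lists_eigenvalues_def real_fibre[symmetric] by blast
qed

lemma AE_interval_iff:
  "(AE x in interval_measure_on l. P x) \<longleftrightarrow> (AE x in lborel. x \<in> {0<..<l} \<longrightarrow> P x)"
  by (subst AE_restrict_space_iff) auto

text \<open>
  The sinc kernel is real, so \<open>S_op\<close> acts separately on real and imaginary parts.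
\<close>

lemma S_op_eq:
  assumes u: "u \<in> sqint 0 l" and v: "v \<in> sqint 0 l" and F: "\<And>x. P_op l F x = Complex (u x) (v x)"
  shows "S_op l F x = Complex (sinc_op 0 l u x) (sinc_op 0 l v x)"
proof -
  have "(LINT y|lborel. of_real (nsinc (x - y)) * P_op l F y) =
      (LINT y|lborel. of_real (nsinc (x - y) * u y) + \<i> * of_real (nsinc (x - y) * v y))"
    unfolding F Complex_eq by (simp add: algebra_simps)
  also have "\<dots> = of_real (sinc_conv u x) + \<i> * of_real (sinc_conv v x)"
    unfolding sinc_conv_def
    using sinc_integrable[OF integrable_sqint[OF u], of x] sinc_integrable[OF integrable_sqint[OF v], of x]
    by (subst Bochner_Integration.integral_add) (auto intro!: integrable_of_real simp del: of_real_mult)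
  finally show ?thesis
    by (simp add: S_op_def Q_op_def P_op_def[of _ "Q_op _"] sinc_op_def Complex_eq indicator_def)
qed

lemma P_op_Re_Im_sqint:
  assumes f: "f \<in> L2 (interval_measure_on l)"
  shows "(\<lambda>x. Re (P_op l f x)) \<in> sqint 0 l" "(\<lambda>x. Im (P_op l f x)) \<in> sqint 0 l"
proof -
  have P_scaleR: "P_op l f x = indicator {0<..<l} x *\<^sub>R f x" for x
    by (simp add: P_op_def indicator_def)
  have "(\<lambda>x. indicator {0<..<l} x *\<^sub>R f x) \<in> borel_measurable lborel"
    using f by (subst borel_measurable_restrict_space_iff[symmetric]) (auto simp: L2_def)
  then have meas: "P_op l f \<in> borel_measurable borel" by (simp add: P_scaleR[abs_def])
  have "integrable lborel (\<lambda>x. indicator {0<..<l} x *\<^sub>R (norm (f x))\<^sup>2)"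
    using f by (subst integrable_restrict_space[symmetric]) (auto simp: L2_def)
  moreover have "indicator {0<..<l} x *\<^sub>R (norm (f x))\<^sup>2 = (norm (P_op l f x))\<^sup>2" for x
    by (simp add: P_scaleR indicator_def)
  ultimately have int: "integrable lborel (\<lambda>x. (norm (P_op l f x))\<^sup>2)" by simp
  have zero: "P_op l f x = 0" if "x \<notin> {0<..<l}" for x using that by (simp add: P_op_def)
  have part: "(\<lambda>x. k (P_op l f x)) \<in> sqint 0 l"
    if k: "k \<in> borel_measurable borel" "k 0 = 0" "\<And>z. \<bar>k z\<bar> \<le> norm z" for k :: "complex \<Rightarrow> real"
  proof (rule sqintI)
    show m: "(\<lambda>x. k (P_op l f x)) \<in> borel_measurable borel" using meas k(1) by simp
    show "integrable lborel (\<lambda>x. (k (P_op l f x))\<^sup>2)"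
      by (rule Bochner_Integration.integrable_bound[OF int])
        (use m in \<open>auto intro!: AE_I2 power_mono[of "\<bar>k _\<bar>" "norm _" 2, simplified] k(3)\<close>)
  qed (simp add: zero k(2))
  show "(\<lambda>x. Re (P_op l f x)) \<in> sqint 0 l" "(\<lambda>x. Im (P_op l f x)) \<in> sqint 0 l"
    by (rule part; simp add: abs_Re_le_cmod abs_Im_le_cmod)+
qed

lemma of_real_sqint_L2:
  assumes e: "e \<in> sqint 0 l"
  shows "(\<lambda>x. of_real (e x)) \<in> L2 (interval_measure_on l)"
proof -
  have meas: "e \<in> borel_measurable borel" by (rule sqintD(1)[OF e])
  have eq: "indicator {0<..<l} x *\<^sub>R (norm (of_real (e x) :: complex))\<^sup>2 = (e x)\<^sup>2" for x
    using sqintD(3)[OF e, of x] by (cases "x \<in> {0<..<l}") auto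
  have "integrable (interval_measure_on l) (\<lambda>x. (norm (of_real (e x) :: complex))\<^sup>2) \<longleftrightarrow>
      integrable lborel (\<lambda>x. indicator {0<..<l} x *\<^sub>R (norm (of_real (e x) :: complex))\<^sup>2)"
    by (rule integrable_restrict_space) simp
  then have "integrable (interval_measure_on l) (\<lambda>x. (norm (of_real (e x) :: complex))\<^sup>2)"
    using sqintD(2)[OF e] by (simp only: eq)
  moreover have "(\<lambda>x. of_real (e x) :: complex) \<in> borel_measurable (interval_measure_on l)"
    using meas by (intro measurable_restrict_space1) simp
  ultimately show ?thesis by (simp add: L2_def)
qed

lemma P_op_sqint: "e \<in> sqint 0 l \<Longrightarrow> P_op l (\<lambda>x. of_real (e x)) x = Complex (e x) 0"
  using sqintD(3)[of e 0 l x] by (auto simp: P_op_def Complex_eq indicator_def)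

lemma sinc_op_zero: "sinc_op a b (\<lambda>_. 0) x = 0"
  by (simp add: sinc_op_def sinc_conv_def)

abbreviation sinc_eigensystem :: "real \<Rightarrow> (nat \<Rightarrow> real \<Rightarrow> real) \<Rightarrow> (nat \<Rightarrow> real) \<Rightarrow> bool" where
  "sinc_eigensystem l \<equiv> compact_positive_contraction.eigensystem (sqint 0 l) l2_inner (sinc_op 0 l)"

text \<open>
  The real eigenvectors for the value \<open>\<mu>\<close> form a basis of the complex eigenspace. To see that they span,
  let \<open>u\<close> and \<open>v\<close> be the real and imaginary part of a complex eigenfunction. Pairing the eigenvalue equation
  with \<open>e n\<close> gives \<open>(lam n - \<mu>) \<langle>u + iv, e n\<rangle> = 0\<close>. So only coefficients with \<open>lam n = \<mu>\<close> survive, and the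
  remainder vanishes because an \<open>L\<^sup>2\<close> function orthogonal to all \<open>e n\<close> does. The argument is uniform in \<open>\<mu>\<close>: for
  \<open>\<mu> = 0\<close> and for \<open>\<mu>\<close> not real there are no such \<open>n\<close>, and the eigenspace is trivial.
\<close>

lemma eigensystem_lists_eigenvalues:
  assumes l: "0 < l" and sys: "sinc_eigensystem l e lam"
  shows "lists_eigenvalues l lam"
proof -
  interpret sinc: compact_positive_contraction "sqint 0 l" l2_inner "sinc_op 0 l"
    by (rule sinc_compact_positive_contraction[OF l])
  note eV = sinc.eigensystemD(1)[OF sys] and orth = sinc.eigensystemD(2)[OF sys]
    and eig = sinc.eigensystemD(3)[OF sys] and pos = sinc.eigensystemD(4)[OF sys]
  have eig_AE: "AE x in lborel. sinc_op 0 l (e n) x = lam n * e n x" for n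
  proof -
    let ?D = "\<lambda>x. sinc_op 0 l (e n) x + (- lam n) * e n x"
    have D: "?D \<in> sqint 0 l" by (intro lincomb_sqint sinc.T_closed eV)
    have "l2_inner ?D ?D = 0"
      using sqint.ip_lincomb_left[OF sinc.T_closed[OF eV[of n]] eV[of n] D, of "- lam n"] eig[OF D, of n] by simp
    then show ?thesis unfolding l2_inner_zero_iff_AE[OF D] by eventually_elim simp
  qed
  have expand: "AE x in lborel. w x = (\<Sum>n\<in>N. l2_inner (e n) w * e n x)"
    if w: "w \<in> sqint 0 l" and N: "finite N" "\<And>n. n \<notin> N \<Longrightarrow> l2_inner (e n) w = 0" for w N
  proof -
    let ?s = "\<lambda>x. \<Sum>n\<in>N. l2_inner (e n) w * e n x"
    have s: "?s \<in> sqint 0 l" using eV w N(1) by (intro sqint.sum_closed) auto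
    let ?r = "\<lambda>x. w x + (- 1) * ?s x"
    have r: "?r \<in> sqint 0 l" by (intro lincomb_sqint w s)
    have "l2_inner (e m) ?r = 0" for m
    proof -
      have "l2_inner (e m) ?s = (\<Sum>n\<in>N. l2_inner (e n) w * (if m = n then 1 else 0))"
        using eV orth N(1) by (subst sqint.ip_sum_right[of _ _ 0 l]) auto
      also have "\<dots> = l2_inner (e m) w" using N by (auto simp: if_distrib cong: if_cong)
      finally show ?thesis using sqint.ip_lincomb_right[OF w s eV[of m], of "- 1"] by simp
    qed
    then have "l2_inner ?r ?r = 0" by (rule sinc.eigensystem_complete[OF sys r])
    then show ?thesis unfolding l2_inner_zero_iff_AE[OF r] by eventually_elim simp
  qed
  have fin: "finite {n. of_real (lam n) = \<mu>}" for \<mu> :: complex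
  proof (cases "\<exists>m. of_real (lam m) = \<mu>")
    case True
    then obtain m where m: "\<mu> = of_real (lam m)" by auto
    have "{n. of_real (lam n) = \<mu>} \<subseteq> {n. lam m \<le> lam n}" by (auto simp: m)
    then show ?thesis by (rule finite_subset[OF _ sinc.finite_large_eigenvalues[OF sys pos]])
  qed simp
  have dim: "has_dim_AE (interval_measure_on l) (S_eigenspace l \<mu>) (card {n. of_real (lam n) = \<mu>})" for \<mu> :: complex
  proof -
    define N where "N = {n. of_real (lam n) = \<mu>}"
    have finN: "finite N" unfolding N_def by (rule fin)
    obtain h where h: "bij_betw h {..<card N} N"
      using ex_bij_betw_nat_finite[OF finN] by (auto simp: atLeast0LessThan)
    define b where "b i x = complex_of_real (e (h i) x)" for i x
    have hN: "h i \<in> N" if "i < card N" for i using h that by (auto simp: bij_betw_def)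
    have h_inj: "h i = h j \<longleftrightarrow> i = j" if "i < card N" "j < card N" for i j
      using h that by (auto simp: bij_betw_def inj_on_def)
    have b_eigen: "b i \<in> S_eigenspace l \<mu>" if "i < card N" for i
    proof -
      have S: "S_op l (b i) x = of_real (sinc_op 0 l (e (h i)) x)" for x
      proof -
        have "(\<lambda>_. 0) \<in> sqint 0 l" by (rule sqint_bounded[of _ 0]) auto
        then have "S_op l (b i) x = Complex (sinc_op 0 l (e (h i)) x) (sinc_op 0 l (\<lambda>_. 0) x)"
          unfolding b_def by (intro S_op_eq eV P_op_sqint)
        then show ?thesis by (simp add: sinc_op_zero Complex_eq)
      qed
      have "of_real (lam (h i)) = \<mu>" using hN[OF that] by (simp add: N_def)
      then have mult: "of_real (lam (h i) * t) = \<mu> * of_real t" for t by simp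
      have "AE x in lborel. S_op l (b i) x = \<mu> * b i x"
        using eig_AE[of "h i"] by eventually_elim (simp only: S b_def mult)
      moreover have "b i \<in> L2 (interval_measure_on l)"
        using of_real_sqint_L2[OF eV[of "h i"]] by (simp add: b_def[abs_def])
      ultimately show ?thesis unfolding S_eigenspace_def AE_interval_iff by auto
    qed
    have indep: "c j = 0" if c: "AE x in interval_measure_on l. (\<Sum>i<card N. c i * b i x) = 0" and j: "j < card N"
      for c :: "nat \<Rightarrow> complex" and j
    proof -
      have zero: "b i x = 0" if "x \<notin> {0<..<l}" for i x
        using sqintD(3)[OF eV that] by (simp add: b_def)
      have ae: "AE x in lborel. (\<Sum>i<card N. c i * b i x) = 0"
        using c unfolding AE_interval_iff
      proof eventually_elim
        case (elim x)
        then show ?case by (cases "x \<in> {0<..<l}") (simp_all add: zero)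
      qed
      have part: "r j = 0" if r: "AE x in lborel. (\<Sum>i<card N. r i * e (h i) x) = 0" for r :: "nat \<Rightarrow> real"
      proof -
        have "AE x in lborel. (\<Sum>i<card N. r i * e (h i) x) * e (h j) x = 0"
          using r by eventually_elim simp
        then have "0 = l2_inner (\<lambda>x. \<Sum>i<card N. r i * e (h i) x) (e (h j))"
          unfolding l2_inner_def by (intro integral_eq_zero_AE[symmetric])
        also have "\<dots> = (\<Sum>i<card N. r i * l2_inner (e (h i)) (e (h j)))"
          using eV by (intro sqint.ip_sum_left[of _ _ 0 l]) auto
        also have "\<dots> = (\<Sum>i<card N. if i = j then r i else 0)"
          using orth h_inj j by (intro sum.cong) auto
        also have "\<dots> = r j" using j by simp
        finally show ?thesis by simp
      qed
      have "AE x in lborel. (\<Sum>i<card N. Re (c i) * e (h i) x) = 0"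
        using ae by eventually_elim (drule arg_cong[where f = Re], simp add: b_def)
      moreover have "AE x in lborel. (\<Sum>i<card N. Im (c i) * e (h i) x) = 0"
        using ae by eventually_elim (drule arg_cong[where f = Im], simp add: b_def)
      ultimately show ?thesis using part[of "\<lambda>i. Re (c i)"] part[of "\<lambda>i. Im (c i)"] by (simp add: complex_eq_iff)
    qed
    have span: "\<exists>c :: nat \<Rightarrow> complex. AE x in interval_measure_on l. f x = (\<Sum>i<card N. c i * b i x)"
      if f: "f \<in> S_eigenspace l \<mu>" for f
    proof -
      have fL2: "f \<in> L2 (interval_measure_on l)" using f by (simp add: S_eigenspace_def)
      define u where "u x = Re (P_op l f x)" for x
      define v where "v x = Im (P_op l f x)" for x
      have u: "u \<in> sqint 0 l" and v: "v \<in> sqint 0 l"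
        unfolding u_def[abs_def] v_def[abs_def] by (rule P_op_Re_Im_sqint[OF fL2])+
      have f_uv: "f x = Complex (u x) (v x)" if "x \<in> {0<..<l}" for x
        using that by (simp add: u_def v_def P_op_def)
      have S: "S_op l f x = Complex (sinc_op 0 l u x) (sinc_op 0 l v x)" for x
        by (rule S_op_eq[OF u v]) (simp add: u_def v_def)
      have ae: "AE x in lborel. x \<in> {0<..<l} \<longrightarrow> S_op l f x = \<mu> * f x"
        using f unfolding S_eigenspace_def AE_interval_iff by simp
      have zero: "u x = 0 \<and> v x = 0 \<and> sinc_op 0 l u x = 0 \<and> sinc_op 0 l v x = 0" if "x \<notin> {0<..<l}" for x
        using sqintD(3)[OF u that] sqintD(3)[OF v that] that by (auto simp: sinc_op_def)
      have Tu: "AE x in lborel. sinc_op 0 l u x = Re \<mu> * u x + (- Im \<mu>) * v x"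
        using ae
      proof eventually_elim
        case (elim x)
        then show ?case using zero[of x] S[of x] f_uv[of x]
          by (cases "x \<in> {0<..<l}") (auto dest: arg_cong[where f = Re])
      qed
      have Tv: "AE x in lborel. sinc_op 0 l v x = Im \<mu> * u x + Re \<mu> * v x"
        using ae
      proof eventually_elim
        case (elim x)
        then show ?case using zero[of x] S[of x] f_uv[of x]
          by (cases "x \<in> {0<..<l}") (auto dest: arg_cong[where f = Im])
      qed
      \<comment> \<open>The coefficients of \<open>S w\<close> are computed once by symmetry of the operator and once from the
        eigenvalue equation.\<close>
      have pair: "lam n * l2_inner (e n) w = p * l2_inner (e n) u + q * l2_inner (e n) v"
        if w: "w \<in> sqint 0 l" and Tw: "AE x in lborel. sinc_op 0 l w x = p * u x + q * v x" for n w p q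
      proof -
        have pu: "(\<lambda>x. p * u x) \<in> sqint 0 l" by (rule sqint.scale_closed[OF u])
        have s: "(\<lambda>x. p * u x + q * v x) \<in> sqint 0 l" by (rule lincomb_sqint[OF pu v])
        have "lam n * l2_inner (e n) w = l2_inner (e n) (sinc_op 0 l w)"
          using eig[OF w, of n] sinc.T_sym[OF eV w, of n] by simp
        also have "\<dots> = l2_inner (e n) (\<lambda>x. p * u x + q * v x)"
          unfolding l2_inner_def
        proof (rule integral_cong_AE)
          show "AE x in lborel. e n x * sinc_op 0 l w x = e n x * (p * u x + q * v x)"
            using Tw by eventually_elim simp
        qed (use sqintD(1)[OF eV[of n]] sqintD(1)[OF sinc.T_closed[OF w]] sqintD(1)[OF s] in simp_all)
        also have "\<dots> = p * l2_inner (e n) u + q * l2_inner (e n) v"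
          by (simp add: sqint.ip_lincomb_right[OF pu v eV] sqint.ip_scale_right[OF u eV])
        finally show ?thesis .
      qed
      have off: "l2_inner (e n) u = 0 \<and> l2_inner (e n) v = 0" if "n \<notin> N" for n
      proof -
        define U W where "U = l2_inner (e n) u" and "W = l2_inner (e n) v"
        have "(lam n - Re \<mu>) * U = - Im \<mu> * W" "(lam n - Re \<mu>) * W = Im \<mu> * U"
          using pair[OF u Tu, of n] pair[OF v Tv, of n] by (simp_all add: U_def W_def algebra_simps)
        then have "((lam n - Re \<mu>)\<^sup>2 + (Im \<mu>)\<^sup>2) * U = 0" "((lam n - Re \<mu>)\<^sup>2 + (Im \<mu>)\<^sup>2) * W = 0"
          unfolding power2_eq_square by algebra+
        moreover have "(lam n - Re \<mu>)\<^sup>2 + (Im \<mu>)\<^sup>2 \<noteq> 0"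
          using that by (auto simp: N_def sum_power2_eq_zero_iff complex_eq_iff)
        ultimately have "U = 0" "W = 0" by (metis mult_eq_0_iff)+
        then show ?thesis by (simp add: U_def W_def)
      qed
      define c where "c i = Complex (l2_inner (e (h i)) u) (l2_inner (e (h i)) v)" for i
      have "AE x in lborel. u x = (\<Sum>n\<in>N. l2_inner (e n) u * e n x)"
        by (rule expand[OF u finN]) (use off in blast)
      moreover have "AE x in lborel. v x = (\<Sum>n\<in>N. l2_inner (e n) v * e n x)"
        by (rule expand[OF v finN]) (use off in blast)
      ultimately have "AE x in lborel. x \<in> {0<..<l} \<longrightarrow> f x = (\<Sum>i<card N. c i * b i x)"
      proof eventually_elim
        case (elim x)
        have "(\<Sum>i<card N. c i * b i x) = (\<Sum>n\<in>N. Complex (l2_inner (e n) u) (l2_inner (e n) v) * of_real (e n x))"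
          unfolding c_def b_def by (rule sum.reindex_bij_betw[OF h])
        also have "\<dots> = Complex (u x) (v x)" using elim by (simp add: complex_eq_iff)
        finally show ?case using f_uv by simp
      qed
      then show ?thesis unfolding AE_interval_iff by blast
    qed
    show ?thesis
      unfolding has_dim_AE_def N_def[symmetric] using b_eigen indep span by blast
  qed
  show ?thesis
    unfolding lists_eigenvalues_def using fin dim sinc.eigensystemD(5)[OF sys] by blast
qed

lemma eigenvalue_eq:
  assumes "0 < l" "sinc_eigensystem l e lam"
  shows "eigenvalue l = lam"
proof -
  have "lists_eigenvalues l lam" by (rule eigensystem_lists_eigenvalues[OF assms])
  then show ?thesis
    unfolding eigenvalue_def by (intro the_equality) (auto intro: lists_eigenvalues_unique)
qed

section \<open>Carleman's kernel and oscillating integrals\<close>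

lemma integral_cos_le:
  fixes u v \<theta> :: real
  assumes "u \<le> v"
  shows "\<bar>integral {u..v} (\<lambda>y. cos (2 * pi * y + \<theta>))\<bar> \<le> 1 / pi"
proof -
  have "((\<lambda>y. cos (2 * pi * y + \<theta>)) has_integral
      sin (2 * pi * v + \<theta>) / (2 * pi) - sin (2 * pi * u + \<theta>) / (2 * pi)) {u..v}"
    by (rule fundamental_theorem_of_calculus[OF assms])
       (auto intro!: derivative_eq_intros simp: has_real_derivative_iff_has_vector_derivative[symmetric])
  then have "\<bar>integral {u..v} (\<lambda>y. cos (2 * pi * y + \<theta>))\<bar>
      = \<bar>sin (2 * pi * v + \<theta>) - sin (2 * pi * u + \<theta>)\<bar> / (2 * pi)"
    by (simp add: integral_unique diff_divide_distrib abs_divide flip: diff_divide_distrib)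
  also have "\<dots> \<le> 2 / (2 * pi)"
  proof (intro divide_right_mono)
    show "\<bar>sin (2 * pi * v + \<theta>) - sin (2 * pi * u + \<theta>)\<bar> \<le> 2"
      using abs_sin_le_one[of "2 * pi * v + \<theta>"] abs_sin_le_one[of "2 * pi * u + \<theta>"] by linarith
  qed simp
  finally show ?thesis by simp
qed

text \<open>
  The second mean value theorem, with \<open>\<bar>\<integral> cos (2\<pi>y + \<theta>)\<bar> \<le> 1/\<pi>\<close> and \<open>2/\<pi> \<le> 1\<close>. The amplitude need only
  be decreasing.
\<close>

lemma oscillatory_integral_le:
  fixes \<phi> :: "real \<Rightarrow> real"
  assumes "p \<le> q" and anti: "\<And>x y. p \<le> x \<Longrightarrow> x \<le> y \<Longrightarrow> y \<le> q \<Longrightarrow> \<phi> y \<le> \<phi> x" and nonneg: "0 \<le> \<phi> q"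
  shows "\<bar>integral {p..q} (\<lambda>y. cos (2 * pi * y + \<theta>) * \<phi> y)\<bar> \<le> \<phi> p"
proof -
  have "(\<lambda>y. cos (2 * pi * y + \<theta>)) integrable_on {p..q}"
    by (intro integrable_continuous_interval continuous_intros)
  then obtain c where c: "c \<in> {p..q}" and eq: "integral {p..q} (\<lambda>y. - \<phi> y * cos (2 * pi * y + \<theta>)) =
      - \<phi> p * integral {p..c} (\<lambda>y. cos (2 * pi * y + \<theta>)) + - \<phi> q * integral {c..q} (\<lambda>y. cos (2 * pi * y + \<theta>))"
    using second_mean_value_theorem[of "\<lambda>y. cos (2 * pi * y + \<theta>)" p q "\<lambda>y. - \<phi> y"] assms by auto
  have pq: "\<phi> q \<le> \<phi> p" using anti[of p q] assms(1) by simp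
  have "integral {p..q} (\<lambda>y. - \<phi> y * cos (2 * pi * y + \<theta>)) = - integral {p..q} (\<lambda>y. cos (2 * pi * y + \<theta>) * \<phi> y)"
    by (simp add: mult.commute)
  with eq have "\<bar>integral {p..q} (\<lambda>y. cos (2 * pi * y + \<theta>) * \<phi> y)\<bar> =
      \<bar>\<phi> p * integral {p..c} (\<lambda>y. cos (2 * pi * y + \<theta>)) + \<phi> q * integral {c..q} (\<lambda>y. cos (2 * pi * y + \<theta>))\<bar>"
    by simp
  also have "\<dots> \<le> \<phi> p * (1 / pi) + \<phi> q * (1 / pi)"
  proof (intro order_trans[OF abs_triangle_ineq] add_mono)
    show "\<bar>\<phi> p * integral {p..c} (\<lambda>y. cos (2 * pi * y + \<theta>))\<bar> \<le> \<phi> p * (1 / pi)"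
      unfolding abs_mult using c nonneg pq by (intro mult_mono integral_cos_le) auto
    show "\<bar>\<phi> q * integral {c..q} (\<lambda>y. cos (2 * pi * y + \<theta>))\<bar> \<le> \<phi> q * (1 / pi)"
      unfolding abs_mult using c nonneg by (intro mult_mono integral_cos_le) auto
  qed
  also have "\<dots> \<le> \<phi> p * (1 / pi) + \<phi> p * (1 / pi)"
    using pq by (intro add_left_mono mult_right_mono) auto
  also have "\<dots> = \<phi> p * (2 / pi)" by simp
  also have "\<dots> \<le> \<phi> p * 1" using pi_gt3 nonneg pq by (intro mult_left_mono) auto
  finally show ?thesis by simp
qed

text \<open>
  Carleman's kernel \<open>1 / (x + y)\<close> together with the amplitudes \<open>1 / \<surd>x\<close> and \<open>1 / \<surd>y\<close> of the test functions.
  In the variables \<open>ln x\<close> and \<open>ln y\<close> it is a convolution kernel of total mass \<open>\<pi>\<close>.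
\<close>

definition carleman_kernel :: "real \<Rightarrow> real \<Rightarrow> real" where
  "carleman_kernel x y = 1 / (sqrt x * sqrt y * (x + y))"

lemma carleman_kernel_commute: "carleman_kernel x y = carleman_kernel y x" by (simp add: carleman_kernel_def add.commute mult.commute)

lemma carleman_kernel_nonneg: "0 < x \<Longrightarrow> 0 < y \<Longrightarrow> 0 \<le> carleman_kernel x y" by (simp add: carleman_kernel_def)

lemma carleman_kernel_antimono: "0 < x \<Longrightarrow> 0 < y \<Longrightarrow> y \<le> y' \<Longrightarrow> carleman_kernel x y' \<le> carleman_kernel x y"
  unfolding carleman_kernel_def by (intro divide_left_mono mult_mono mult_pos_pos) auto

lemma continuous_on_carleman_kernel [continuous_intros]:
  assumes "continuous_on S f" "continuous_on S g" "\<And>x. x \<in> S \<Longrightarrow> 0 < f x" "\<And>x. x \<in> S \<Longrightarrow> 0 < g x"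
  shows "continuous_on S (\<lambda>x. carleman_kernel (f x) (g x))"
  unfolding carleman_kernel_def using assms
  by (intro continuous_intros) (auto simp: less_imp_neq[symmetric] add_pos_pos)

lemma has_integral_carleman_kernel:
  assumes x: "0 < x" and "0 < c" "c \<le> d"
  shows "((carleman_kernel x) has_integral (2 / x) * (arctan (sqrt (d / x)) - arctan (sqrt (c / x)))) {c..d}"
proof -
  have "((\<lambda>y. carleman_kernel x y) has_integral (2 / x) * arctan (sqrt (d / x)) - (2 / x) * arctan (sqrt (c / x))) {c..d}"
  proof (rule fundamental_theorem_of_calculus[OF \<open>c \<le> d\<close>])
    fix y assume "y \<in> {c..d}"
    then have y: "0 < y" using assms by auto
    have ds: "((\<lambda>y. sqrt (y / x)) has_real_derivative (1 / x) * (inverse (sqrt (y / x)) / 2)) (at y within {c..d})"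
      using DERIV_chain2[OF DERIV_real_sqrt[OF divide_pos_pos[OF y x]] DERIV_cdivide[OF DERIV_ident]]
      by (simp add: mult.commute)
    have "((\<lambda>y. (2 / x) * arctan (sqrt (y / x))) has_real_derivative
        (2 / x) * (inverse (1 + (sqrt (y / x))\<^sup>2) * ((1 / x) * (inverse (sqrt (y / x)) / 2)))) (at y within {c..d})"
      by (intro DERIV_cmult DERIV_chain2[OF DERIV_arctan ds])
    also have "(2 / x) * (inverse (1 + (sqrt (y / x))\<^sup>2) * ((1 / x) * (inverse (sqrt (y / x)) / 2))) = carleman_kernel x y"
    proof -
      have 1: "1 + (sqrt (y / x))\<^sup>2 = (x + y) / x" using x y by (simp add: field_simps)
      have 2: "inverse (sqrt (y / x)) = x / (sqrt x * sqrt y)"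
        using x y by (simp add: real_sqrt_divide field_simps)
      define D E where "D = sqrt x * sqrt y" and "E = x + y"
      have "0 < D" "0 < E" using x y by (auto simp: D_def E_def)
      then show ?thesis unfolding 1 2 carleman_kernel_def D_def[symmetric] E_def[symmetric]
        using x by (simp add: field_simps)
    qed
    finally show "((\<lambda>y. (2 / x) * arctan (sqrt (y / x))) has_vector_derivative carleman_kernel x y) (at y within {c..d})"
      by (simp add: has_real_derivative_iff_has_vector_derivative)
  qed
  then show ?thesis by (simp add: right_diff_distrib)
qed

lemma integral_inverse_ln:
  fixes p q :: real
  assumes "0 < p" "p \<le> q" shows "((\<lambda>x. 1 / x) has_integral ln q - ln p) {p..q}"
  using assms(1) by (intro fundamental_theorem_of_calculus[OF assms(2)])
    (auto intro!: derivative_eq_intros simp: has_real_derivative_iff_has_vector_derivative[symmetric])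

lemma arctan_le_quintic:
  assumes "0 \<le> t" shows "arctan t \<le> t - t ^ 3 / 3 + t ^ 5 / 5"
proof -
  have "t - t ^ 3 / 3 + t ^ 5 / 5 - arctan t \<ge> 0 - 0 ^ 3 / 3 + 0 ^ 5 / 5 - arctan 0"
  proof (rule DERIV_nonneg_imp_nondecreasing[OF assms])
    fix x :: real
    have "1 / (1 + x\<^sup>2) \<le> 1 - x\<^sup>2 + x ^ 4"
    proof -
      have "(1 - x\<^sup>2 + x ^ 4) * (1 + x\<^sup>2) = 1 + x ^ 6" by (simp add: algebra_simps power_numeral_reduce)
      then show ?thesis by (simp add: pos_divide_le_eq add_pos_nonneg)
    qed
    moreover have "((\<lambda>t. t - t ^ 3 / 3 + t ^ 5 / 5 - arctan t) has_real_derivative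
        1 - x\<^sup>2 + x ^ 4 - 1 / (1 + x\<^sup>2)) (at x)"
      by (auto intro!: derivative_eq_intros simp: field_simps)
    ultimately show "\<exists>y. ((\<lambda>t. t - t ^ 3 / 3 + t ^ 5 / 5 - arctan t) has_real_derivative y) (at x) \<and> 0 \<le> y"
      by (intro exI conjI) auto
  qed
  then show ?thesis by simp
qed

text \<open>
  The leading term \<open>\<pi> ln (q / p)\<close> is the mass \<open>\<pi>\<close> of the kernel times the logarithmic length of the block; the constant is
  twice the loss \<open>836/225 = 4 - 4/9 + 4/25\<close> at one end. That loss is the integral of
  \<open>(2/x) arctan (\<surd>(p/x))\<close> over \<open>(p, \<infinity>)\<close> after \<open>arctan s\<close> has been replaced by
  \<open>s - s\<^sup>3/3 + s\<^sup>5/5\<close>. The bound \<open>arctan s \<le> s\<close>, with loss 4, would be too weak for the final inequality.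
\<close>

lemma diagonal_block_ge:
  assumes p: "0 < p" and "p \<le> q"
    and I: "((\<lambda>x. (2 / x) * (arctan (sqrt (q / x)) - arctan (sqrt (p / x)))) has_integral I) {p..q}"
  shows "pi * (ln q - ln p) - 1672 / 225 \<le> I"
proof -
  \<comment> \<open>\<open>P\<close> is a primitive of \<open>4 A(s) / s\<close>; for \<open>s = \<surd>(x/q)\<close> one has \<open>ds/dx = s / (2x)\<close>, and this turns
    \<open>(2/x) A(s)\<close> into a derivative.\<close>
  define P where "P s = 4 * s - 4 / 9 * s ^ 3 + 4 / 25 * s ^ 5" for s :: real
  define A where "A s = s - s ^ 3 / 3 + s ^ 5 / 5" for s :: real
  define G where "G x = pi * ln x - P (sqrt (x / q)) + P (sqrt (p / x))" for x
  have q: "0 < q" using assms by simp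
  have P_deriv: "(P has_real_derivative 4 * (1 - s\<^sup>2 / 3 + s ^ 4 / 5)) (at s)" for s
    unfolding P_def[abs_def] by (auto intro!: derivative_eq_intros simp: field_simps)
  have int: "((\<lambda>x. (2 / x) * (pi / 2 - A (sqrt (x / q)) - A (sqrt (p / x)))) has_integral G q - G p) {p..q}"
  proof (rule fundamental_theorem_of_calculus[OF \<open>p \<le> q\<close>])
    fix x assume "x \<in> {p..q}"
    then have x: "0 < x" using p by auto
    define s t where "s = sqrt (x / q)" and "t = sqrt (p / x)"
    have st: "0 < s" "0 < t" using x p q by (auto simp: s_def t_def)
    have "((\<lambda>x. sqrt (x / q)) has_real_derivative (1 / q) * (inverse s / 2)) (at x)"
      unfolding s_def
      using DERIV_chain2[OF DERIV_real_sqrt[OF divide_pos_pos[OF x q]] DERIV_cdivide[OF DERIV_ident]]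
      by (simp add: mult.commute)
    also have "(1 / q) * (inverse s / 2) = s / (2 * x)"
    proof -
      have "s * s = x / q" using x q by (simp add: s_def)
      then show ?thesis using st x q by (simp add: field_simps)
    qed
    finally have ds: "((\<lambda>x. sqrt (x / q)) has_real_derivative s / (2 * x)) (at x)" .
    have "((\<lambda>x. sqrt (p / x)) has_real_derivative (- p / x\<^sup>2) * (inverse t / 2)) (at x)"
    proof -
      have "((\<lambda>x. p / x) has_real_derivative - p / x\<^sup>2) (at x)"
        using x by (auto intro!: derivative_eq_intros simp: power2_eq_square)
      from DERIV_chain2[OF DERIV_real_sqrt[OF divide_pos_pos[OF p x]] this]
      show ?thesis unfolding t_def by (simp add: mult.commute)
    qed
    also have "(- p / x\<^sup>2) * (inverse t / 2) = - t / (2 * x)"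
    proof -
      have "t * t = p / x" using x p by (simp add: t_def)
      then show ?thesis using st x p by (simp add: field_simps power2_eq_square)
    qed
    finally have dt: "((\<lambda>x. sqrt (p / x)) has_real_derivative - t / (2 * x)) (at x)" .
    have "(G has_real_derivative pi * (1 / x) - 4 * (1 - s\<^sup>2 / 3 + s ^ 4 / 5) * (s / (2 * x))
        + 4 * (1 - t\<^sup>2 / 3 + t ^ 4 / 5) * (- t / (2 * x))) (at x)"
      unfolding G_def[abs_def]
      by (intro DERIV_add DERIV_diff DERIV_cmult DERIV_chain2[OF P_deriv[of s, unfolded s_def] ds[unfolded s_def], folded s_def]
          DERIV_chain2[OF P_deriv[of t, unfolded t_def] dt[unfolded t_def], folded t_def])
         (use x in \<open>auto intro!: derivative_eq_intros\<close>)
    also have "pi * (1 / x) - 4 * (1 - s\<^sup>2 / 3 + s ^ 4 / 5) * (s / (2 * x)) + 4 * (1 - t\<^sup>2 / 3 + t ^ 4 / 5) * (- t / (2 * x))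
        = (2 / x) * (pi / 2 - A s - A t)"
      using x by (simp add: A_def field_simps power_numeral_reduce)
    finally show "(G has_vector_derivative (2 / x) * (pi / 2 - A (sqrt (x / q)) - A (sqrt (p / x)))) (at x within {p..q})"
      unfolding s_def t_def has_real_derivative_iff_has_vector_derivative[symmetric]
      by (rule has_field_derivative_at_within)
  qed
  have "G q - G p \<le> I"
  proof (rule has_integral_le[OF int I])
    fix x assume "x \<in> {p..q}"
    then have x: "0 < x" using p by auto
    have pos: "0 < sqrt (x / q)" using x q by simp
    have "inverse (sqrt (x / q)) = sqrt (q / x)" by (simp add: real_sqrt_divide)
    then have "arctan (sqrt (q / x)) = pi / 2 - arctan (sqrt (x / q))"
      using arctan_inverse[of "sqrt (x / q)"] sgn_pos[OF pos] pos by (simp del: real_sqrt_gt_0_iff)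
    moreover have "arctan (sqrt (x / q)) \<le> A (sqrt (x / q))" "arctan (sqrt (p / x)) \<le> A (sqrt (p / x))"
      unfolding A_def using x p q by (auto intro!: arctan_le_quintic)
    ultimately show "(2 / x) * (pi / 2 - A (sqrt (x / q)) - A (sqrt (p / x)))
        \<le> (2 / x) * (arctan (sqrt (q / x)) - arctan (sqrt (p / x)))"
      using x by (intro mult_left_mono) auto
  qed
  moreover have "0 \<le> P (sqrt (p / q))"
  proof -
    define s where "s = sqrt (p / q)"
    have s: "0 \<le> s" "s \<le> 1" using p q \<open>p \<le> q\<close> by (auto simp: s_def)
    have "s ^ 3 \<le> s ^ 1" using s by (intro power_decreasing) auto
    moreover have "0 \<le> s ^ 5" using s by simp
    ultimately show ?thesis unfolding s_def[symmetric] P_def using s by simp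
  qed
  ultimately show ?thesis using p q by (simp add: G_def P_def[of 1] right_diff_distrib)
qed

text \<open>
  Oscillation in one variable gains the value at the lower limit \<open>c\<close>. Estimating \<open>x + c \<ge> x\<close> there, and not by
  the geometric mean, gives the product \<open>1 / (\<surd>p \<surd>c)\<close>, whose factors are both summable over exponentially
  growing blocks.
\<close>

lemma oscillatory_double_integral_le:
  assumes p: "0 < p" "p \<le> q" and c: "0 < c" "c \<le> d" and \<alpha>: "continuous_on {p..q} \<alpha>"
  shows "\<bar>integral {p..q} (\<lambda>x. integral {c..d} (\<lambda>y. cos (2 * pi * y + \<alpha> x) * carleman_kernel x y))\<bar>
    \<le> 2 / (sqrt p * sqrt c)"
proof -
  have cont: "continuous_on ({p..q} \<times> {c..d}) (\<lambda>(x, y). cos (2 * pi * y + \<alpha> x) * carleman_kernel x y)"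
    unfolding split_beta'
    using p c by (intro continuous_intros continuous_on_compose2[OF \<alpha>]) auto
  then have "continuous_on {p..q} (\<lambda>x. integral {c..d} (\<lambda>y. cos (2 * pi * y + \<alpha> x) * carleman_kernel x y))"
    using integral_continuous_on_param[of "{p..q}" c d "\<lambda>x y. cos (2 * pi * y + \<alpha> x) * carleman_kernel x y"] by simp
  then have int: "(\<lambda>x. integral {c..d} (\<lambda>y. cos (2 * pi * y + \<alpha> x) * carleman_kernel x y)) integrable_on {p..q}"
    by (rule integrable_continuous_interval)
  have "((\<lambda>x. 1 / (x * sqrt x * sqrt c)) has_integral (- 2 / (sqrt q * sqrt c)) - (- 2 / (sqrt p * sqrt c))) {p..q}"
  proof (rule fundamental_theorem_of_calculus[OF p(2)])
    fix x assume "x \<in> {p..q}"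
    then have x: "0 < x" using p by auto
    then have "sqrt x * sqrt x = x" by simp
    then have "((\<lambda>x. - 2 / (sqrt x * sqrt c)) has_real_derivative 1 / (x * sqrt x * sqrt c)) (at x within {p..q})"
      using x c by (auto intro!: derivative_eq_intros simp: divide_simps) (simp add: mult_ac)?
    then show "((\<lambda>x. - 2 / (sqrt x * sqrt c)) has_vector_derivative 1 / (x * sqrt x * sqrt c)) (at x within {p..q})"
      by (simp add: has_real_derivative_iff_has_vector_derivative)
  qed
  then have maj: "((\<lambda>x. 1 / (x * sqrt x * sqrt c)) has_integral (2 / (sqrt p * sqrt c) - 2 / (sqrt q * sqrt c))) {p..q}"
    by simp
  have "norm (integral {p..q} (\<lambda>x. integral {c..d} (\<lambda>y. cos (2 * pi * y + \<alpha> x) * carleman_kernel x y)))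
      \<le> integral {p..q} (\<lambda>x. 1 / (x * sqrt x * sqrt c))"
  proof (rule integral_norm_bound_integral[OF int has_integral_integrable[OF maj]])
    fix x assume "x \<in> {p..q}"
    then have x: "0 < x" using p by auto
    have "\<bar>integral {c..d} (\<lambda>y. cos (2 * pi * y + \<alpha> x) * carleman_kernel x y)\<bar> \<le> carleman_kernel x c"
      using x c by (intro oscillatory_integral_le carleman_kernel_antimono carleman_kernel_nonneg) auto
    also have "carleman_kernel x c \<le> 1 / (x * sqrt x * sqrt c)"
      unfolding carleman_kernel_def using x c by (intro divide_left_mono) (auto simp: mult_ac)
    finally show "norm (integral {c..d} (\<lambda>y. cos (2 * pi * y + \<alpha> x) * carleman_kernel x y)) \<le> 1 / (x * sqrt x * sqrt c)" by simp
  qed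
  also have "\<dots> \<le> 2 / (sqrt p * sqrt c)" unfolding integral_unique[OF maj] using p c by simp
  finally show ?thesis by simp
qed

section \<open>Truncated waves\<close>

lemma LINT_indicator_Ioo:
  fixes g :: "real \<Rightarrow> real"
  assumes "continuous_on {a..b} g"
  shows "(LINT x|lborel. indicator {a<..<b} x * g x) = integral {a..b} g"
proof -
  have "set_integrable lborel {a..b} g"
    by (rule borel_integrable_atLeastAtMost'[OF assms])
  then have "set_integrable lborel {a<..<b} g" by (rule set_integrable_subset) auto
  from set_borel_integral_eq_integral(2)[OF this] show ?thesis
    by (simp add: set_lebesgue_integral_def integral_open_interval_real)
qed

text \<open>
  The open interval makes waves on adjacent blocks have disjoint supports.
\<close>

definition wave :: "real \<Rightarrow> real \<Rightarrow> real \<Rightarrow> real \<Rightarrow> real" where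
  "wave p q \<theta> y = indicator {p<..<q} y * (cos (pi * y + \<theta>) / sqrt y)"

lemma wave_sqint:
  assumes "0 < p" shows "wave p q \<theta> \<in> sqint p q"
proof (rule sqint_bounded)
  show "wave p q \<theta> \<in> borel_measurable borel" unfolding wave_def by measurable
  show "\<bar>wave p q \<theta> y\<bar> \<le> 1 / sqrt p" for y
  proof (cases "y \<in> {p<..<q}")
    case True
    then have "\<bar>cos (pi * y + \<theta>)\<bar> / sqrt y \<le> 1 / sqrt p"
      using assms by (intro frac_le) auto
    then show ?thesis using True assms by (simp add: wave_def abs_divide)
  qed (use assms in \<open>simp add: wave_def\<close>)
qed (simp add: wave_def)

lemma l2_inner_reflect: "l2_inner (\<lambda>x. f (- x)) (\<lambda>x. g (- x)) = l2_inner f g"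
  using lborel_integral_real_affine[of "- 1" "\<lambda>x. f x * g x" 0] by (simp add: l2_inner_def)

lemma reflect_sqint:
  assumes f: "f \<in> sqint a b" shows "(\<lambda>x. f (- x)) \<in> sqint (- b) (- a)"
proof (rule sqintI)
  show "(\<lambda>x. f (- x)) \<in> borel_measurable borel" using sqintD(1)[OF f] by measurable
  show "integrable lborel (\<lambda>x. (f (- x))\<^sup>2)"
    using lborel_integrable_real_affine[OF sqintD(2)[OF f], of "- 1" 0] by simp
  show "f (- x) = 0" if "x \<notin> {- b<..<- a}" for x using that by (intro sqintD(3)[OF f]) auto
qed

lemma wave_Gram:
  assumes p: "0 < p" "p \<le> q"
  shows "\<bar>l2_inner (wave p q \<theta>) (wave p q \<theta>') - cos (\<theta> - \<theta>') / 2 * (ln q - ln p)\<bar> \<le> 1 / 2 * (1 / sqrt p * (1 / sqrt p))"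
proof -
  let ?o = "\<lambda>y. cos (2 * pi * y + (\<theta> + \<theta>')) * (1 / y)"
  have "l2_inner (wave p q \<theta>) (wave p q \<theta>') =
      (LINT y|lborel. indicator {p<..<q} y * (cos (\<theta> - \<theta>') / 2 * (1 / y) + ?o y / 2))"
    unfolding l2_inner_def
  proof (intro Bochner_Integration.integral_cong refl)
    fix y
    show "wave p q \<theta> y * wave p q \<theta>' y =
        indicator {p<..<q} y * (cos (\<theta> - \<theta>') / 2 * (1 / y) + ?o y / 2)"
    proof (cases "y \<in> {p<..<q}")
      case True
      then have y: "0 < y" using p by auto
      have prod: "cos (pi * y + \<theta>) * cos (pi * y + \<theta>') = (cos (\<theta> - \<theta>') + cos (2 * pi * y + (\<theta> + \<theta>'))) / 2"
        by (simp add: cos_times_cos algebra_simps)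
      have "wave p q \<theta> y * wave p q \<theta>' y = (cos (pi * y + \<theta>) * cos (pi * y + \<theta>')) / (sqrt y * sqrt y)"
        using True by (simp add: wave_def)
      also have "\<dots> = cos (\<theta> - \<theta>') / 2 * (1 / y) + ?o y / 2"
        unfolding prod using y by (simp add: field_simps)
      finally show ?thesis using True by simp
    qed (simp add: wave_def)
  qed
  also have "\<dots> = integral {p..q} (\<lambda>y. cos (\<theta> - \<theta>') / 2 * (1 / y) + ?o y / 2)"
    using p by (intro LINT_indicator_Ioo continuous_intros) auto
  also have "\<dots> = integral {p..q} (\<lambda>y. cos (\<theta> - \<theta>') / 2 * (1 / y)) + integral {p..q} (\<lambda>y. ?o y / 2)"
    using p by (intro integral_add integrable_continuous_interval continuous_intros) auto
  also have "\<dots> = cos (\<theta> - \<theta>') / 2 * (ln q - ln p) + integral {p..q} ?o / 2"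
    using integral_unique[OF integral_inverse_ln[OF p]] by (simp only: integral_mult_right integral_divide)
  finally have "l2_inner (wave p q \<theta>) (wave p q \<theta>') - cos (\<theta> - \<theta>') / 2 * (ln q - ln p) = integral {p..q} ?o / 2" by simp
  moreover have "\<bar>integral {p..q} ?o\<bar> \<le> 1 / p"
    using p by (intro oscillatory_integral_le) (auto intro: divide_left_mono)
  moreover have "1 / sqrt p * (1 / sqrt p) = 1 / p" using p by simp
  ultimately show ?thesis by (simp only:)
qed

lemma nsinc_minus: "nsinc (- t) = nsinc t"
  by (simp add: nsinc_def)

text \<open>
  The dual wave has the phase \<open>- \<theta> - \<pi>/2\<close>, so that it equals \<open>sin (\<pi>x - \<theta>) / \<surd>x\<close>. This is the phase that resonates
  with \<open>cos (\<pi>y + \<theta>)\<close> under the kernel \<open>sin (\<pi>(x + y))\<close>; the argument \<open>- x\<close> places it to the left of the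
  interval.
\<close>

lemma wave_pairing_eq:
  assumes p: "0 < p" and c: "0 < c"
  shows "(LINT x|lborel. sinc_conv (wave c d \<theta>') x * wave p q (- \<theta> - pi / 2) (- x)) =
    integral {p..q} (\<lambda>x. integral {c..d} (\<lambda>y.
      sin (pi * x - \<theta>) * sin (pi * x + pi * y) * cos (pi * y + \<theta>') / pi * carleman_kernel x y))"
proof -
  define k where "k x y = sin (pi * x - \<theta>) * sin (pi * x + pi * y) * cos (pi * y + \<theta>') / pi * carleman_kernel x y" for x y
  have k_cont: "continuous_on ({p..q} \<times> cbox c d) (\<lambda>(x, y). k x y)"
    unfolding k_def split_beta' using p c by (intro continuous_intros) auto
  have inner: "sinc_conv (wave c d \<theta>') (- x) * wave p q (- \<theta> - pi / 2) x =
      indicator {p<..<q} x * integral {c..d} (k x)" for x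
  proof (cases "x \<in> {p<..<q}")
    case True
    then have x: "0 < x" using p by auto
    have ph: "cos (pi * x + (- \<theta> - pi / 2)) = sin (pi * x - \<theta>)"
    proof -
      have "pi * x + (- \<theta> - pi / 2) = (pi * x - \<theta>) - pi / 2" by simp
      then show ?thesis by (simp only: cos_diff) simp
    qed
    have "sinc_conv (wave c d \<theta>') (- x) * wave p q (- \<theta> - pi / 2) x =
        (LINT y|lborel. (nsinc (- x - y) * wave c d \<theta>' y) * wave p q (- \<theta> - pi / 2) x)"
      unfolding sinc_conv_def by simp
    also have "\<dots> = (LINT y|lborel. indicator {c<..<d} y * k x y)"
    proof (intro Bochner_Integration.integral_cong refl)
      fix y
      show "nsinc (- x - y) * wave c d \<theta>' y * wave p q (- \<theta> - pi / 2) x = indicator {c<..<d} y * k x y"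
      proof (cases "y \<in> {c<..<d}")
        case yT: True
        then have y: "0 < y" using c by auto
        have "nsinc (- x - y) = nsinc (x + y)"
          using nsinc_minus[of "x + y"] by (simp only: minus_add_distrib diff_conv_add_uminus)
        then have sinc: "nsinc (- x - y) = sin (pi * x + pi * y) / (pi * (x + y))"
          using x y by (simp add: nsinc_def distrib_left)
        show ?thesis
          using True yT by (simp add: wave_def ph sinc k_def carleman_kernel_def mult_ac)
      qed (simp add: wave_def)
    qed
    also have "\<dots> = integral {c..d} (k x)"
    proof (rule LINT_indicator_Ioo)
      show "continuous_on {c..d} (k x)"
        unfolding k_def[abs_def] using x c by (intro continuous_intros) auto
    qed
    finally show ?thesis using True by simp
  qed (simp add: wave_def)
  have "(LINT x|lborel. sinc_conv (wave c d \<theta>') x * wave p q (- \<theta> - pi / 2) (- x)) =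
      (LINT x|lborel. sinc_conv (wave c d \<theta>') (- x) * wave p q (- \<theta> - pi / 2) x)"
    using lborel_integral_real_affine[of "- 1" "\<lambda>x. sinc_conv (wave c d \<theta>') x * wave p q (- \<theta> - pi / 2) (- x)" 0] by simp
  also have "\<dots> = (LINT x|lborel. indicator {p<..<q} x * integral {c..d} (k x))" by (simp only: inner)
  also have "\<dots> = integral {p..q} (\<lambda>x. integral {c..d} (k x))"
    using integral_continuous_on_param[OF k_cont] by (intro LINT_indicator_Ioo) simp
  finally show ?thesis by (simp add: k_def[abs_def])
qed

text \<open>
  The only term without oscillation is \<open>cos (\<theta> - \<theta>') / 4\<close>. Each of the others oscillates in \<open>y\<close> or in \<open>x\<close>
  with frequency 1.
\<close>

lemma triple_product_expansion:
  fixes x y :: real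
  shows "sin (pi * x - \<theta>) * sin (pi * x + pi * y) * cos (pi * y + \<theta>') =
    (cos (\<theta> - \<theta>') + cos (2 * pi * y + (\<theta> + \<theta>')) - cos (2 * pi * y + (2 * pi * x + \<theta>' - \<theta>))
      - cos (2 * pi * x + (- \<theta> - \<theta>'))) / 4"
proof -
  have 1: "sin (pi * x - \<theta>) * sin (pi * x + pi * y) = (cos (pi * y + \<theta>) - cos (2 * pi * x + pi * y - \<theta>)) / 2"
  proof -
    have "cos (pi * x - \<theta> - (pi * x + pi * y)) = cos (pi * y + \<theta>)"
      using cos_minus[of "pi * y + \<theta>"] by (simp add: algebra_simps)
    then show ?thesis by (simp add: sin_times_sin algebra_simps)
  qed
  have 2: "cos (pi * y + \<theta>) * cos (pi * y + \<theta>') = (cos (\<theta> - \<theta>') + cos (2 * pi * y + (\<theta> + \<theta>'))) / 2"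
    by (simp add: cos_times_cos algebra_simps)
  have 3: "cos (2 * pi * x + pi * y - \<theta>) * cos (pi * y + \<theta>') =
      (cos (2 * pi * x + (- \<theta> - \<theta>')) + cos (2 * pi * y + (2 * pi * x + \<theta>' - \<theta>))) / 2"
  proof -
    have "2 * pi * x + pi * y - \<theta> - (pi * y + \<theta>') = 2 * pi * x + (- \<theta> - \<theta>')"
      "2 * pi * x + pi * y - \<theta> + (pi * y + \<theta>') = 2 * pi * y + (2 * pi * x + \<theta>' - \<theta>)"
      by simp_all
    then show ?thesis by (simp only: cos_times_cos)
  qed
  have "sin (pi * x - \<theta>) * sin (pi * x + pi * y) * cos (pi * y + \<theta>') =
      (cos (pi * y + \<theta>) * cos (pi * y + \<theta>') - cos (2 * pi * x + pi * y - \<theta>) * cos (pi * y + \<theta>')) / 2"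
    unfolding 1 by (simp add: left_diff_distrib)
  then show ?thesis unfolding 2 3 by (simp add: field_simps)
qed

definition carleman_block :: "real \<Rightarrow> real \<Rightarrow> real \<Rightarrow> real \<Rightarrow> real" where
  "carleman_block p q c d = integral {p..q} (\<lambda>x. integral {c..d} (carleman_kernel x))"

lemma wave_pairing:
  assumes p: "0 < p" "p \<le> q" and c: "0 < c" "c \<le> d"
  shows "\<bar>(LINT x|lborel. sinc_conv (wave c d \<theta>') x * wave p q (- \<theta> - pi / 2) (- x))
      - cos (\<theta> - \<theta>') / (4 * pi) * carleman_block p q c d\<bar> \<le> 1 / 2 * (1 / sqrt p * (1 / sqrt c))"
proof -
  define dint :: "(real \<times> real \<Rightarrow> real) \<Rightarrow> real" where "dint F = integral (cbox (p, c) (q, d)) F" for F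
  have box: "x \<in> cbox (p, c) (q, d) \<Longrightarrow> 0 < fst x \<and> 0 < snd x" for x
    using p c by (cases x) auto
  have iter: "dint F = integral {p..q} (\<lambda>x. integral {c..d} (\<lambda>y. F (x, y)))"
    if "continuous_on (cbox (p, c) (q, d)) F" for F
    using integral_prod_continuous[of p c q d F] that by (simp add: dint_def)
  define w where "w z = carleman_kernel (fst z) (snd z)" for z
  define F1 F2 F3 where "F1 z = cos (2 * pi * snd z + (\<theta> + \<theta>')) * w z"
    and "F2 z = cos (2 * pi * snd z + (2 * pi * fst z + \<theta>' - \<theta>)) * w z"
    and "F3 z = cos (2 * pi * fst z + (- \<theta> - \<theta>')) * w z" for z
  have w_cont: "continuous_on (cbox (p, c) (q, d)) w"
    unfolding w_def[abs_def] using box by (intro continuous_intros) auto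
  have F_cont: "continuous_on (cbox (p, c) (q, d)) F1" "continuous_on (cbox (p, c) (q, d)) F2"
      "continuous_on (cbox (p, c) (q, d)) F3"
    unfolding F1_def[abs_def] F2_def[abs_def] F3_def[abs_def] by (intro continuous_intros w_cont)+
  note ints = integrable_continuous[OF w_cont] F_cont[THEN integrable_continuous]
  let ?k = "\<lambda>z. sin (pi * fst z - \<theta>) * sin (pi * fst z + pi * snd z) * cos (pi * snd z + \<theta>') / pi * w z"
  have k_cont: "continuous_on (cbox (p, c) (q, d)) ?k" by (intro continuous_intros w_cont) auto
  have "(LINT x|lborel. sinc_conv (wave c d \<theta>') x * wave p q (- \<theta> - pi / 2) (- x)) = dint ?k"
    unfolding iter[OF k_cont]
    by (simp only: wave_pairing_eq[OF p(1) c(1)] w_def fst_conv snd_conv)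
  also have "?k = (\<lambda>z. 1 / (4 * pi) * (cos (\<theta> - \<theta>') * w z + F1 z - F2 z - F3 z))"
    unfolding triple_product_expansion F1_def F2_def F3_def by (simp add: fun_eq_iff field_simps)
  also have "dint \<dots> = 1 / (4 * pi) * (cos (\<theta> - \<theta>') * dint w + dint F1 - dint F2 - dint F3)"
    unfolding dint_def using ints
    by (simp only: integral_mult_right integral_add integral_diff integrable_add integrable_diff integrable_on_mult_right)
  finally have eq: "(LINT x|lborel. sinc_conv (wave c d \<theta>') x * wave p q (- \<theta> - pi / 2) (- x))
      - cos (\<theta> - \<theta>') / (4 * pi) * dint w = 1 / (4 * pi) * (dint F1 - dint F2 - dint F3)"
    by (simp add: field_simps)
  have w_eq: "dint w = carleman_block p q c d" unfolding iter[OF w_cont] carleman_block_def w_def by simp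
  let ?b = "2 / (sqrt p * sqrt c)"
  have b1: "\<bar>dint F1\<bar> \<le> ?b"
    unfolding iter[OF F_cont(1)] F1_def w_def fst_conv snd_conv
    by (rule oscillatory_double_integral_le[OF p c continuous_on_const])
  have b2: "\<bar>dint F2\<bar> \<le> ?b"
    unfolding iter[OF F_cont(2)] F2_def w_def fst_conv snd_conv
    by (rule oscillatory_double_integral_le[OF p c]) (intro continuous_intros)
  have b3: "\<bar>dint F3\<bar> \<le> ?b"
  proof -
    have "dint F3 = integral {c..d} (\<lambda>y. integral {p..q} (\<lambda>x. F3 (x, y)))"
      using integral_swap_continuous[of p c q d "\<lambda>x y. F3 (x, y)"] F_cont(3) iter[OF F_cont(3)] by simp
    also have "\<dots> = integral {c..d} (\<lambda>y. integral {p..q} (\<lambda>x. cos (2 * pi * x + (- \<theta> - \<theta>')) * carleman_kernel y x))"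
      unfolding F3_def w_def fst_conv snd_conv by (simp only: carleman_kernel_commute)
    also have "\<bar>\<dots>\<bar> \<le> 2 / (sqrt c * sqrt p)"
      by (rule oscillatory_double_integral_le[OF c p continuous_on_const])
    finally show ?thesis by (simp add: mult.commute)
  qed
  have "\<bar>1 / (4 * pi) * (dint F1 - dint F2 - dint F3)\<bar> \<le> 1 / (4 * pi) * (3 * ?b)"
    unfolding abs_mult using b1 b2 b3 by (intro mult_mono) auto
  also have "\<dots> = (3 / pi) * (1 / 2 * (1 / sqrt p * (1 / sqrt c)))" by (simp add: field_simps)
  also have "\<dots> \<le> 1 * (1 / 2 * (1 / sqrt p * (1 / sqrt c)))"
    using pi_gt3 p c by (intro mult_right_mono) auto
  finally show ?thesis using eq unfolding w_eq by simp
qed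

lemma carleman_block_commute:
  assumes "0 < p" "0 < c"
  shows "carleman_block p q c d = carleman_block c d p q"
proof -
  have "continuous_on (cbox (p, c) (q, d)) (\<lambda>(x, y). carleman_kernel x y)"
    unfolding split_beta' using assms by (intro continuous_intros) auto
  from integral_swap_continuous[OF this] show ?thesis
    unfolding carleman_block_def using carleman_kernel_commute by (simp add: fun_eq_iff)
qed

lemma has_integral_carleman_block:
  assumes p: "0 < p" "p \<le> q" and c: "0 < c" "c \<le> d"
  shows "((\<lambda>x. (2 / x) * (arctan (sqrt (d / x)) - arctan (sqrt (c / x)))) has_integral carleman_block p q c d) {p..q}"
proof -
  have "(\<lambda>x. (2 / x) * (arctan (sqrt (d / x)) - arctan (sqrt (c / x)))) integrable_on {p..q}"
    using p by (intro integrable_continuous_interval continuous_intros) auto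
  moreover have "carleman_block p q c d = integral {p..q} (\<lambda>x. (2 / x) * (arctan (sqrt (d / x)) - arctan (sqrt (c / x))))"
    unfolding carleman_block_def using p by (intro integral_cong integral_unique has_integral_carleman_kernel c) auto
  ultimately show ?thesis by (simp add: has_integral_integral)
qed

lemma carleman_block_nonneg:
  assumes p: "0 < p" "p \<le> q" and c: "0 < c" "c \<le> d"
  shows "0 \<le> carleman_block p q c d"
  using p c
  by (intro has_integral_nonneg[OF has_integral_carleman_block[OF assms]])
     (auto intro!: mult_nonneg_nonneg simp: arctan_le_iff divide_right_mono)

text \<open>
  The arctangents telescope, and their difference is at most \<open>\<pi>/2\<close>.
\<close>

lemma carleman_block_row_sum_le:
  assumes p: "0 < p" "p \<le> q" and s: "\<And>k. 0 < s k" "\<And>k. s k \<le> s (Suc k)"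
  shows "(\<Sum>k<K. carleman_block p q (s k) (s (Suc k))) \<le> pi * (ln q - ln p)"
proof (rule has_integral_le)
  show "((\<lambda>x. \<Sum>k<K. (2 / x) * (arctan (sqrt (s (Suc k) / x)) - arctan (sqrt (s k / x)))) has_integral
      (\<Sum>k<K. carleman_block p q (s k) (s (Suc k)))) {p..q}"
    by (intro has_integral_sum has_integral_carleman_block p s) simp
  show "((\<lambda>x. pi * (1 / x)) has_integral pi * (ln q - ln p)) {p..q}"
    by (intro has_integral_mult_right integral_inverse_ln p)
  fix x assume "x \<in> {p..q}"
  then have x: "0 < x" using p by auto
  have "(\<Sum>k<K. (2 / x) * (arctan (sqrt (s (Suc k) / x)) - arctan (sqrt (s k / x)))) =
      (2 / x) * (arctan (sqrt (s K / x)) - arctan (sqrt (s 0 / x)))"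
    unfolding sum_distrib_left[symmetric] using sum_lessThan_telescope[of "\<lambda>k. arctan (sqrt (s k / x))" K] by simp
  also have "\<dots> \<le> (2 / x) * (pi / 2)"
    using x s(1)[of 0] arctan_ubound[of "sqrt (s K / x)"]
    by (intro mult_left_mono) (auto intro: less_imp_le add_increasing2 simp: diff_le_eq)
  finally show "(\<Sum>k<K. (2 / x) * (arctan (sqrt (s (Suc k) / x)) - arctan (sqrt (s k / x)))) \<le> pi * (1 / x)"
    by simp
qed

section \<open>The test space and the count\<close>

text \<open>
  From \<open>a\<^sub>j a\<^sub>k \<ge> - (a\<^sub>j\<^sup>2 + a\<^sub>k\<^sup>2) / 2\<close> off the diagonal. In this form no single off-diagonal entry has
  to be estimated: a bound for full row sums and one for the diagonal suffice.
\<close>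

lemma quadratic_form_ge_diagonal_dominance:
  fixes a :: "nat \<Rightarrow> real"
  assumes sym: "\<And>j k. B j k = B k j" and nonneg: "\<And>j k. 0 \<le> B j k"
  shows "(\<Sum>j<K. (a j)\<^sup>2 * (2 * B j j - (\<Sum>k<K. B j k))) \<le> (\<Sum>j<K. \<Sum>k<K. a j * a k * B j k)"
proof -
  have pointwise: "(if j = k then 2 * (a j)\<^sup>2 * B j j else 0) - ((a j)\<^sup>2 * B j k / 2 + (a k)\<^sup>2 * B j k / 2) \<le> a j * a k * B j k"
    for j k
  proof (cases "j = k")
    case False
    have "0 \<le> (a j + a k)\<^sup>2 * B j k" using nonneg by simp
    then show ?thesis using False by (simp add: power2_sum algebra_simps)
  qed (simp add: power2_eq_square algebra_simps)
  have diag: "(\<Sum>j<K. \<Sum>k<K. if j = k then 2 * (a j)\<^sup>2 * B j j else 0) = (\<Sum>j<K. 2 * (a j)\<^sup>2 * B j j)"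
    by (intro sum.cong refl) simp
  have left: "(\<Sum>j<K. \<Sum>k<K. (a j)\<^sup>2 * B j k / 2) = (\<Sum>j<K. (a j)\<^sup>2 * (\<Sum>k<K. B j k)) / 2"
    by (simp add: sum_distrib_left sum_divide_distrib)
  have right: "(\<Sum>j<K. \<Sum>k<K. (a k)\<^sup>2 * B j k / 2) = (\<Sum>j<K. (a j)\<^sup>2 * (\<Sum>k<K. B j k)) / 2"
    by (subst sum.swap) (simp add: sum_distrib_left sum_divide_distrib sym)
  have "(\<Sum>j<K. (a j)\<^sup>2 * (2 * B j j - (\<Sum>k<K. B j k))) =
      (\<Sum>j<K. 2 * (a j)\<^sup>2 * B j j) - (\<Sum>j<K. (a j)\<^sup>2 * (\<Sum>k<K. B j k))"
    by (simp add: right_diff_distrib sum_subtractf mult_ac)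
  also have "\<dots> = (\<Sum>j<K. \<Sum>k<K. (if j = k then 2 * (a j)\<^sup>2 * B j j else 0) - ((a j)\<^sup>2 * B j k / 2 + (a k)\<^sup>2 * B j k / 2))"
    unfolding sum_subtractf sum.distrib diag left right by simp
  also have "\<dots> \<le> (\<Sum>j<K. \<Sum>k<K. a j * a k * B j k)" by (intro sum_mono pointwise)
  finally show ?thesis .
qed

text \<open>
  Errors of product form \<open>r m * r n\<close> are absorbed by Cauchy--Schwarz, uniformly in the number of indices.
\<close>

lemma bilinear_perturbation:
  fixes c r :: "'i \<Rightarrow> real"
  assumes close: "\<And>m n. m \<in> A \<Longrightarrow> n \<in> A \<Longrightarrow> \<bar>G m n - H m n\<bar> \<le> \<epsilon> * (r m * r n)" and "0 \<le> \<epsilon>"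
  shows "\<bar>(\<Sum>m\<in>A. \<Sum>n\<in>A. c m * c n * G m n) - (\<Sum>m\<in>A. \<Sum>n\<in>A. c m * c n * H m n)\<bar>
    \<le> \<epsilon> * ((\<Sum>m\<in>A. (c m)\<^sup>2) * (\<Sum>m\<in>A. (r m)\<^sup>2))"
proof -
  have "\<bar>(\<Sum>m\<in>A. \<Sum>n\<in>A. c m * c n * G m n) - (\<Sum>m\<in>A. \<Sum>n\<in>A. c m * c n * H m n)\<bar>
      = \<bar>\<Sum>m\<in>A. \<Sum>n\<in>A. c m * c n * (G m n - H m n)\<bar>"
    by (simp add: sum_subtractf right_diff_distrib)
  also have "\<dots> \<le> (\<Sum>m\<in>A. \<bar>\<Sum>n\<in>A. c m * c n * (G m n - H m n)\<bar>)" by (rule sum_abs)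
  also have "\<dots> \<le> (\<Sum>m\<in>A. \<Sum>n\<in>A. \<bar>c m * c n * (G m n - H m n)\<bar>)" by (intro sum_mono sum_abs)
  also have "\<dots> \<le> (\<Sum>m\<in>A. \<Sum>n\<in>A. \<bar>c m\<bar> * \<bar>c n\<bar> * (\<epsilon> * (r m * r n)))"
    unfolding abs_mult using close by (intro sum_mono mult_left_mono) auto
  also have "\<dots> = \<epsilon> * ((\<Sum>m\<in>A. \<bar>c m\<bar> * r m) * (\<Sum>n\<in>A. \<bar>c n\<bar> * r n))"
    unfolding sum_product by (simp add: sum_distrib_left mult_ac)
  also have "\<dots> \<le> \<epsilon> * ((\<Sum>m\<in>A. \<bar>c m\<bar>\<^sup>2) * (\<Sum>m\<in>A. (r m)\<^sup>2))"
    using Cauchy_Schwarz_ineq_sum[of "\<lambda>m. \<bar>c m\<bar>" r A] \<open>0 \<le> \<epsilon>\<close>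
    by (intro mult_left_mono) (simp_all add: power2_eq_square)
  finally show ?thesis by simp
qed

text \<open>
  The logarithmic length of a block; two test functions per block then give the density
  \<open>2 / scale_step = 8 / (15 \<pi>\<^sup>2)\<close>.
\<close>

definition scale_step :: real where "scale_step = 15 * pi\<^sup>2 / 4"

text \<open>
  The blocks start at \<open>exp scale_step\<close> and not at 1, which makes all oscillating errors tiny and costs only a
  constant in the count.
\<close>

definition endpt :: "nat \<Rightarrow> real" where "endpt k = exp (scale_step * (real k + 1))"

text \<open>
  The phases 0 and \<open>- \<pi>/2\<close> turn the cosine into a cosine and a sine.
\<close>

definition phase :: "nat \<Rightarrow> real" where "phase i = - real i * pi / 2"

definition test_fun :: "nat \<times> nat \<Rightarrow> real \<Rightarrow> real" where
  "test_fun m = wave (endpt (fst m)) (endpt (Suc (fst m))) (phase (snd m))"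

definition dual_fun :: "nat \<times> nat \<Rightarrow> real \<Rightarrow> real" where
  "dual_fun m = (\<lambda>x. wave (endpt (fst m)) (endpt (Suc (fst m))) (- phase (snd m) - pi / 2) (- x))"

text \<open>
  Pairs of a block and a phase.
\<close>

definition test_index :: "nat \<Rightarrow> (nat \<times> nat) set" where "test_index K = {..<K} \<times> {..<2}"

lemma scale_step_gt: "37 < scale_step"
proof -
  have "3.1415\<^sup>2 < pi\<^sup>2" using pi_approx by (intro power_strict_mono) auto
  then show ?thesis by (simp add: scale_step_def power2_eq_square)
qed

lemma endpt_pos: "0 < endpt k" by (simp add: endpt_def)

lemma endpt_mono: "j \<le> k \<Longrightarrow> endpt j \<le> endpt k"
  using scale_step_gt by (simp add: endpt_def)

lemma ln_endpt_diff: "ln (endpt (Suc k)) - ln (endpt k) = scale_step"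
  by (simp add: endpt_def algebra_simps)

lemma cos_phase_diff: "i < 2 \<Longrightarrow> i' < 2 \<Longrightarrow> cos (phase i - phase i') = (if i = i' then 1 else 0)"
  by (auto simp: phase_def less_2_cases_iff)

lemma sum_test_index:
  fixes F :: "nat \<times> nat \<Rightarrow> real"
  shows "(\<Sum>m\<in>test_index K. F m) = (\<Sum>j<K. F (j, 0)) + (\<Sum>j<K. F (j, 1))"
  unfolding test_index_def by (simp add: sum.cartesian_product' numeral_2_eq_2 sum.distrib)

lemma sum_inverse_endpt_le: "(\<Sum>m\<in>test_index K. (1 / sqrt (endpt (fst m)))\<^sup>2) \<le> 1 / 100"
proof -
  have "1000 \<le> exp scale_step"
  proof -
    have "(2::real) ^ 10 \<le> exp 1 ^ 10" using exp_ge_add_one_self[of 1] by (intro power_mono) auto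
    also have "\<dots> = exp 10" by (simp flip: exp_of_nat_mult)
    also have "\<dots> \<le> exp scale_step" using scale_step_gt by simp
    finally show ?thesis by simp
  qed
  then have small: "exp (- scale_step) \<le> 1 / 1000" by (simp add: exp_minus field_simps)
  have "(1 / sqrt (endpt k))\<^sup>2 \<le> (1 / 1000) * (1 / 1000) ^ k" for k
  proof -
    have "(1 / sqrt (endpt k))\<^sup>2 = exp (- scale_step) ^ Suc k"
      using endpt_pos[of k] by (simp add: power_divide endpt_def exp_minus field_simps exp_add flip: exp_of_nat_mult)
    also have "\<dots> \<le> (1 / 1000) ^ Suc k" using small by (intro power_mono) auto
    finally show ?thesis by simp
  qed
  then have "(\<Sum>k<K. (1 / sqrt (endpt k))\<^sup>2) \<le> (\<Sum>k<K. (1 / 1000) * (1 / 1000) ^ k)" by (rule sum_mono)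
  also have "\<dots> = (1 / 1000) * ((1 - (1 / 1000) ^ K) / (1 - 1 / 1000))"
    unfolding sum_distrib_left[symmetric] by (simp add: sum_gp_strict)
  also have "\<dots> \<le> 1 / 999" by simp
  finally have "(\<Sum>k<K. (1 / sqrt (endpt k))\<^sup>2) \<le> 1 / 999" .
  moreover have "(\<Sum>m\<in>test_index K. (1 / sqrt (endpt (fst m)))\<^sup>2) = 2 * (\<Sum>k<K. (1 / sqrt (endpt k))\<^sup>2)"
    by (simp add: sum_test_index)
  ultimately show ?thesis by simp
qed

lemma wave_disjoint:
  assumes "j \<noteq> k"
  shows "wave (endpt j) (endpt (Suc j)) \<theta> x * wave (endpt k) (endpt (Suc k)) \<theta>' x = 0"
proof -
  have "endpt (Suc j) \<le> endpt k \<or> endpt (Suc k) \<le> endpt j"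
    using assms endpt_mono[of "Suc j" k] endpt_mono[of "Suc k" j] by linarith
  then show ?thesis by (auto simp: wave_def indicator_def)
qed

definition block_form :: "nat \<times> nat \<Rightarrow> nat \<times> nat \<Rightarrow> real" where
  "block_form m n = (if snd m = snd n then carleman_block (endpt (fst m)) (endpt (Suc (fst m))) (endpt (fst n)) (endpt (Suc (fst n))) else 0)"

lemma sqint_nonempty: "sqint a b \<noteq> {}"
  using indicator_sqint[of a b] by auto

lemma wave_family_Gram:
  assumes \<theta>: "\<And>i i'. i < 2 \<Longrightarrow> i' < 2 \<Longrightarrow> cos (\<theta> i - \<theta> i') = (if i = i' then 1 else 0)"
    and m: "m \<in> test_index K" and n: "n \<in> test_index K"
  shows "\<bar>l2_inner (wave (endpt (fst m)) (endpt (Suc (fst m))) (\<theta> (snd m))) (wave (endpt (fst n)) (endpt (Suc (fst n))) (\<theta> (snd n)))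
      - (if m = n then scale_step / 2 else 0)\<bar> \<le> 1 / 2 * (1 / sqrt (endpt (fst m)) * (1 / sqrt (endpt (fst n))))"
proof (cases "fst m = fst n")
  case True
  have "cos (\<theta> (snd m) - \<theta> (snd n)) / 2 * scale_step = (if m = n then scale_step / 2 else 0)"
    using m n True by (subst \<theta>) (auto simp: test_index_def prod_eq_iff)
  then show ?thesis
    using wave_Gram[OF endpt_pos endpt_mono[of "fst m" "Suc (fst m)"], of "\<theta> (snd m)" "\<theta> (snd n)"] True
    unfolding ln_endpt_diff by simp
next
  case False
  then show ?thesis using endpt_pos by (auto simp: l2_inner_def wave_disjoint less_imp_le)
qed

lemma combination_norm_le:
  assumes \<theta>: "\<And>i i'. i < 2 \<Longrightarrow> i' < 2 \<Longrightarrow> cos (\<theta> i - \<theta> i') = (if i = i' then 1 else 0)"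
  defines "g \<equiv> \<lambda>m. wave (endpt (fst m)) (endpt (Suc (fst m))) (\<theta> (snd m))"
  shows "l2_inner (\<lambda>x. \<Sum>m\<in>test_index K. c m * g m x) (\<lambda>x. \<Sum>m\<in>test_index K. c m * g m x)
    \<le> (scale_step / 2 + 1 / 200) * (\<Sum>m\<in>test_index K. (c m)\<^sup>2)"
proof -
  let ?A = "test_index K" and ?f = "\<lambda>x. \<Sum>m\<in>test_index K. c m * g m x"
  let ?r = "\<lambda>m :: nat \<times> nat. 1 / sqrt (endpt (fst m))"
  have fin: "finite ?A" by (simp add: test_index_def)
  have g: "g m \<in> sqint 0 (endpt K)" if "m \<in> ?A" for m
  proof -
    have "endpt (Suc (fst m)) \<le> endpt K" using that by (intro endpt_mono) (auto simp: test_index_def)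
    then show ?thesis unfolding g_def
      by (rule sqint_mono[OF wave_sqint[OF endpt_pos] less_imp_le[OF endpt_pos]])
  qed
  have f: "?f \<in> sqint 0 (endpt K)"
    by (intro sqint.sum_closed fin sqint_nonempty g)
  have "l2_inner ?f ?f = (\<Sum>m\<in>?A. \<Sum>n\<in>?A. c m * c n * l2_inner (g m) (g n))"
    using sqint.ip_sum_left[OF fin g f] sqint.ip_sum_right[OF fin g g]
    by (simp add: sum_distrib_left mult.assoc)
  moreover have "(\<Sum>m\<in>?A. \<Sum>n\<in>?A. c m * c n * (if m = n then scale_step / 2 else 0)) = scale_step / 2 * (\<Sum>m\<in>?A. (c m)\<^sup>2)"
    using fin by (simp add: if_distrib sum.delta power2_eq_square sum_distrib_left mult_ac cong: if_cong)
  moreover have "\<bar>(\<Sum>m\<in>?A. \<Sum>n\<in>?A. c m * c n * l2_inner (g m) (g n)) - (\<Sum>m\<in>?A. \<Sum>n\<in>?A. c m * c n * (if m = n then scale_step / 2 else 0))\<bar>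
      \<le> 1 / 2 * ((\<Sum>m\<in>?A. (c m)\<^sup>2) * (\<Sum>m\<in>?A. (?r m)\<^sup>2))"
    unfolding g_def by (rule bilinear_perturbation) (use wave_family_Gram[OF \<theta>] in auto)
  moreover have "1 / 2 * ((\<Sum>m\<in>?A. (c m)\<^sup>2) * (\<Sum>m\<in>?A. (?r m)\<^sup>2)) \<le> 1 / 2 * ((\<Sum>m\<in>?A. (c m)\<^sup>2) * (1 / 100))"
    by (intro mult_left_mono sum_inverse_endpt_le sum_nonneg) auto
  ultimately show ?thesis unfolding distrib_right by linarith
qed

text \<open>
  Each row of block integrals sums to at most \<open>\<pi> T\<close>, while the diagonal entry is at least \<open>\<pi> T - 1672/225\<close>. Hence twice
  the diagonal minus the row is at least \<open>\<pi> T - 3344/225\<close>. The two phases decouple.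
\<close>

lemma carleman_block_form_ge:
  "(pi * scale_step - 3344 / 225) * (\<Sum>m\<in>test_index K. (c m)\<^sup>2)
    \<le> (\<Sum>m\<in>test_index K. \<Sum>n\<in>test_index K. c m * c n * block_form m n)"
proof -
  define B where "B j k = carleman_block (endpt j) (endpt (Suc j)) (endpt k) (endpt (Suc k))" for j k
  have step: "endpt k \<le> endpt (Suc k)" for k by (rule endpt_mono) simp
  have sym: "B j k = B k j" for j k unfolding B_def by (intro carleman_block_commute endpt_pos)
  have nonneg: "0 \<le> B j k" for j k unfolding B_def by (intro carleman_block_nonneg endpt_pos step)
  have row: "(\<Sum>k<K. B j k) \<le> pi * scale_step" for j
    using carleman_block_row_sum_le[where s = endpt, OF endpt_pos[of j] step[of j] endpt_pos step, of K] unfolding B_def ln_endpt_diff .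
  have diag: "pi * scale_step - 1672 / 225 \<le> B j j" for j
    using diagonal_block_ge[OF endpt_pos[of j] step[of j] has_integral_carleman_block[OF endpt_pos[of j] step[of j] endpt_pos[of j] step[of j]]]
    unfolding B_def ln_endpt_diff .
  have single: "(pi * scale_step - 3344 / 225) * (\<Sum>j<K. (a j)\<^sup>2) \<le> (\<Sum>j<K. \<Sum>k<K. a j * a k * B j k)" for a
  proof -
    have "(pi * scale_step - 3344 / 225) * (\<Sum>j<K. (a j)\<^sup>2) \<le> (\<Sum>j<K. (a j)\<^sup>2 * (2 * B j j - (\<Sum>k<K. B j k)))"
      unfolding sum_distrib_left
    proof (intro sum_mono)
      fix j
      have "pi * scale_step - 3344 / 225 \<le> 2 * B j j - (\<Sum>k<K. B j k)" using row[of j] diag[of j] by simp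
      from mult_left_mono[OF this, of "(a j)\<^sup>2"]
      show "(pi * scale_step - 3344 / 225) * (a j)\<^sup>2 \<le> (a j)\<^sup>2 * (2 * B j j - (\<Sum>k<K. B j k))"
        by (simp add: mult.commute)
    qed
    also have "\<dots> \<le> (\<Sum>j<K. \<Sum>k<K. a j * a k * B j k)"
      by (rule quadratic_form_ge_diagonal_dominance[OF sym nonneg])
    finally show ?thesis .
  qed
  have "(\<Sum>m\<in>test_index K. \<Sum>n\<in>test_index K. c m * c n * block_form m n) =
      (\<Sum>j<K. \<Sum>k<K. c (j, 0) * c (k, 0) * B j k) + (\<Sum>j<K. \<Sum>k<K. c (j, 1) * c (k, 1) * B j k)"
    unfolding sum_test_index by (simp add: block_form_def B_def sum.distrib)
  then show ?thesis
    using single[of "\<lambda>j. c (j, 0)"] single[of "\<lambda>j. c (j, 1)"] by (simp add: sum_test_index distrib_left)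
qed

lemma test_fun_sqint:
  assumes "m \<in> test_index K" "endpt K \<le> l"
  shows "test_fun m \<in> sqint 0 l" "dual_fun m \<in> sqint (- l) 0"
proof -
  have "endpt (Suc (fst m)) \<le> endpt K" using assms(1) by (intro endpt_mono) (auto simp: test_index_def)
  then have "endpt (Suc (fst m)) \<le> l" using assms(2) by linarith
  then have "wave (endpt (fst m)) (endpt (Suc (fst m))) \<theta> \<in> sqint 0 l" for \<theta>
    by (rule sqint_mono[OF wave_sqint[OF endpt_pos] less_imp_le[OF endpt_pos]])
  then show "test_fun m \<in> sqint 0 l" "dual_fun m \<in> sqint (- l) 0"
    unfolding test_fun_def dual_fun_def using reflect_sqint[of _ 0 l] by simp_all
qed

lemma sinc_conv_sum:
  assumes "finite A" "\<And>m. m \<in> A \<Longrightarrow> integrable lborel (g m)"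
  shows "sinc_conv (\<lambda>x. \<Sum>m\<in>A. c m * g m x) x = (\<Sum>m\<in>A. c m * sinc_conv (g m) x)"
proof -
  have "nsinc (x - y) * (\<Sum>m\<in>A. c m * g m y) = (\<Sum>m\<in>A. c m * (nsinc (x - y) * g m y))" for y
    by (simp add: sum_distrib_left mult.left_commute)
  then show ?thesis unfolding sinc_conv_def using sinc_integrable[OF assms(2)]
    by (simp add: Bochner_Integration.integral_sum)
qed

lemma pairing_ge:
  assumes l: "endpt K \<le> l"
  shows "(scale_step / 4 - 836 / 225 / pi - 1 / 200) * (\<Sum>m\<in>test_index K. (c m)\<^sup>2)
    \<le> (LINT x|lborel. sinc_conv (\<lambda>x. \<Sum>m\<in>test_index K. c m * test_fun m x) x * (\<Sum>m\<in>test_index K. c m * dual_fun m x))"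
proof -
  let ?A = "test_index K"
  let ?r = "\<lambda>m :: nat \<times> nat. 1 / sqrt (endpt (fst m))"
  define M where "M m n = (LINT x|lborel. sinc_conv (test_fun n) x * dual_fun m x)" for m n
  have fin: "finite ?A" by (simp add: test_index_def)
  have int: "integrable lborel (test_fun m)" if "m \<in> ?A" for m
    by (rule integrable_sqint[OF test_fun_sqint(1)[OF that l]])
  have int2: "integrable lborel (\<lambda>x. sinc_conv (test_fun n) x * dual_fun m x)" if "m \<in> ?A" "n \<in> ?A" for m n
    by (rule integrable_bounded_mult[OF integrable_sqint[OF test_fun_sqint(2)[OF that(1) l]]
        sinc_conv_measurable[OF int[OF that(2)]] abs_sinc_conv_le[OF int[OF that(2)]]])
  have "(LINT x|lborel. sinc_conv (\<lambda>x. \<Sum>m\<in>?A. c m * test_fun m x) x * (\<Sum>m\<in>?A. c m * dual_fun m x))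
      = (LINT x|lborel. (\<Sum>m\<in>?A. \<Sum>n\<in>?A. c m * c n * (sinc_conv (test_fun n) x * dual_fun m x)))"
  proof (intro Bochner_Integration.integral_cong refl)
    fix x
    have "sinc_conv (\<lambda>x. \<Sum>m\<in>?A. c m * test_fun m x) x = (\<Sum>n\<in>?A. c n * sinc_conv (test_fun n) x)"
      by (rule sinc_conv_sum[OF fin int])
    then have "sinc_conv (\<lambda>x. \<Sum>m\<in>?A. c m * test_fun m x) x * (\<Sum>m\<in>?A. c m * dual_fun m x)
        = (\<Sum>m\<in>?A. c m * dual_fun m x) * (\<Sum>n\<in>?A. c n * sinc_conv (test_fun n) x)"
      by (simp only: mult.commute)
    also have "\<dots> = (\<Sum>m\<in>?A. \<Sum>n\<in>?A. c m * c n * (sinc_conv (test_fun n) x * dual_fun m x))"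
      unfolding sum_product by (intro sum.cong refl) (simp only: mult_ac)
    finally show "sinc_conv (\<lambda>x. \<Sum>m\<in>?A. c m * test_fun m x) x * (\<Sum>m\<in>?A. c m * dual_fun m x)
        = (\<Sum>m\<in>?A. \<Sum>n\<in>?A. c m * c n * (sinc_conv (test_fun n) x * dual_fun m x))" .
  qed
  also have "\<dots> = (\<Sum>m\<in>?A. LINT x|lborel. (\<Sum>n\<in>?A. c m * c n * (sinc_conv (test_fun n) x * dual_fun m x)))"
    by (intro Bochner_Integration.integral_sum Bochner_Integration.integrable_sum integrable_mult_right int2)
  also have "\<dots> = (\<Sum>m\<in>?A. \<Sum>n\<in>?A. c m * c n * M m n)"
  proof (intro sum.cong refl)
    fix m assume "m \<in> ?A"
    then have "(LINT x|lborel. (\<Sum>n\<in>?A. c m * c n * (sinc_conv (test_fun n) x * dual_fun m x))) =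
        (\<Sum>n\<in>?A. LINT x|lborel. c m * c n * (sinc_conv (test_fun n) x * dual_fun m x))"
      by (intro Bochner_Integration.integral_sum integrable_mult_right int2)
    then show "(LINT x|lborel. (\<Sum>n\<in>?A. c m * c n * (sinc_conv (test_fun n) x * dual_fun m x))) =
        (\<Sum>n\<in>?A. c m * c n * M m n)" by (simp add: M_def)
  qed
  finally have eq: "(LINT x|lborel. sinc_conv (\<lambda>x. \<Sum>m\<in>?A. c m * test_fun m x) x * (\<Sum>m\<in>?A. c m * dual_fun m x))
      = (\<Sum>m\<in>?A. \<Sum>n\<in>?A. c m * c n * M m n)" .
  have close: "\<bar>M m n - block_form m n / (4 * pi)\<bar> \<le> 1 / 2 * (?r m * ?r n)" if "m \<in> ?A" "n \<in> ?A" for m n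
  proof -
    have "cos (phase (snd m) - phase (snd n)) = (if snd m = snd n then 1 else 0)"
      using that by (intro cos_phase_diff) (auto simp: test_index_def)
    then show ?thesis
      using wave_pairing[OF endpt_pos endpt_mono endpt_pos endpt_mono,
          of "fst m" "Suc (fst m)" "fst n" "Suc (fst n)" "phase (snd n)" "phase (snd m)"]
      by (simp add: M_def test_fun_def dual_fun_def block_form_def split: if_splits)
  qed
  have "\<bar>(\<Sum>m\<in>?A. \<Sum>n\<in>?A. c m * c n * M m n) - (\<Sum>m\<in>?A. \<Sum>n\<in>?A. c m * c n * (block_form m n / (4 * pi)))\<bar>
      \<le> 1 / 2 * ((\<Sum>m\<in>?A. (c m)\<^sup>2) * (\<Sum>m\<in>?A. (?r m)\<^sup>2))"
    by (rule bilinear_perturbation[OF close]) auto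
  also have "\<dots> \<le> 1 / 2 * ((\<Sum>m\<in>?A. (c m)\<^sup>2) * (1 / 100))"
    by (intro mult_left_mono sum_inverse_endpt_le sum_nonneg) auto
  finally have "(\<Sum>m\<in>?A. \<Sum>n\<in>?A. c m * c n * (block_form m n / (4 * pi))) - 1 / 200 * (\<Sum>m\<in>?A. (c m)\<^sup>2)
      \<le> (\<Sum>m\<in>?A. \<Sum>n\<in>?A. c m * c n * M m n)" by linarith
  moreover have "(\<Sum>m\<in>?A. \<Sum>n\<in>?A. c m * c n * (block_form m n / (4 * pi))) =
      (\<Sum>m\<in>?A. \<Sum>n\<in>?A. c m * c n * block_form m n) / (4 * pi)"
    by (simp add: sum_divide_distrib)
  moreover have "(pi * scale_step - 3344 / 225) * (\<Sum>m\<in>?A. (c m)\<^sup>2) / (4 * pi)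
      \<le> (\<Sum>m\<in>?A. \<Sum>n\<in>?A. c m * c n * block_form m n) / (4 * pi)"
    by (intro divide_right_mono carleman_block_form_ge) simp
  moreover have "(pi * scale_step - 3344 / 225) * (\<Sum>m\<in>?A. (c m)\<^sup>2) / (4 * pi) =
      (scale_step / 4 - 836 / 225 / pi) * (\<Sum>m\<in>?A. (c m)\<^sup>2)"
    by (simp add: field_simps)
  ultimately show ?thesis unfolding eq by (simp add: left_diff_distrib)
qed

text \<open>
  Numerically \<open>\<surd>3 / 4 < 0.4331\<close>, and with \<open>scale_step > 37\<close> the margin is about \<open>0.05\<close>.
\<close>

lemma pairing_constant:
  "0 < scale_step / 4 - 836 / 225 / pi - 1 / 200"
  "3 / 16 * (scale_step / 2 + 1 / 200)\<^sup>2 < (scale_step / 4 - 836 / 225 / pi - 1 / 200)\<^sup>2"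
proof -
  have "836 / 225 / pi \<le> 836 / 225 / 3.1415" using pi_approx by (intro divide_left_mono) auto
  then have *: "0.4331 * (scale_step / 2 + 1 / 200) < scale_step / 4 - 836 / 225 / pi - 1 / 200"
    using scale_step_gt by simp
  have "0 < 0.4331 * (scale_step / 2 + 1 / 200)" using scale_step_gt by simp
  with * show "0 < scale_step / 4 - 836 / 225 / pi - 1 / 200" by linarith
  have "3 / 16 * (scale_step / 2 + 1 / 200)\<^sup>2 \<le> 0.4331\<^sup>2 * (scale_step / 2 + 1 / 200)\<^sup>2"
    by (intro mult_right_mono) (auto simp: power2_eq_square)
  also have "\<dots> = (0.4331 * (scale_step / 2 + 1 / 200))\<^sup>2" by (simp only: power_mult_distrib)
  also have "\<dots> < (scale_step / 4 - 836 / 225 / pi - 1 / 200)\<^sup>2"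
    using * scale_step_gt by (intro power_strict_mono) auto
  finally show "3 / 16 * (scale_step / 2 + 1 / 200)\<^sup>2 < (scale_step / 4 - 836 / 225 / pi - 1 / 200)\<^sup>2" .
qed

text \<open>
  The dual function \<open>h\<close> has the same coefficients as \<open>f\<close>. The squared pairing of \<open>Q f\<close> with \<open>h\<close> is at most \<open>\<parallel>h\<parallel>\<^sup>2\<close>
  times the defect of \<open>f\<close>, and \<open>pairing_constant\<close> says that it exceeds \<open>3/16\<close> of the product of the
  squared norms.
\<close>

lemma test_space_defect:
  assumes l: "endpt K \<le> l" and c: "\<exists>m\<in>test_index K. c m \<noteq> 0"
    and f: "f = (\<lambda>x. \<Sum>m\<in>test_index K. c m * test_fun m x)"
  shows "3 / 16 * l2_inner f f < l2_inner (sinc_op 0 l f) f - l2_inner (sinc_op 0 l f) (sinc_op 0 l f)"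
proof -
  let ?A = "test_index K"
  have fin: "finite ?A" by (simp add: test_index_def)
  have l_pos: "0 < l" using l endpt_pos[of K] by linarith
  define h where "h = (\<lambda>x. \<Sum>m\<in>?A. c m * dual_fun m x)"
  define \<sigma> where "\<sigma> = (\<Sum>m\<in>?A. (c m)\<^sup>2)"
  define D where "D = l2_inner (sinc_op 0 l f) f - l2_inner (sinc_op 0 l f) (sinc_op 0 l f)"
  define u where "u = scale_step / 2 + 1 / 200"
  define v where "v = scale_step / 4 - 836 / 225 / pi - 1 / 200"
  have uv: "0 < v" "3 / 16 * u\<^sup>2 < v\<^sup>2" unfolding u_def v_def by (rule pairing_constant)+
  have \<sigma>: "0 < \<sigma>" unfolding \<sigma>_def
  proof -
    obtain m where m: "m \<in> ?A" "c m \<noteq> 0" using c by blast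
    show "0 < (\<Sum>m\<in>?A. (c m)\<^sup>2)" by (rule sum_pos2[OF fin m(1)]) (use m in auto)
  qed
  have fV: "f \<in> sqint 0 l" unfolding f
    by (intro sqint.sum_closed fin sqint_nonempty test_fun_sqint(1)[OF _ l])
  have hV: "h \<in> sqint (- l) 0" unfolding h_def
    by (intro sqint.sum_closed fin sqint_nonempty test_fun_sqint(2)[OF _ l])
  have f_le: "l2_inner f f \<le> u * \<sigma>"
    unfolding f u_def \<sigma>_def test_fun_def by (rule combination_norm_le) (rule cos_phase_diff)
  have h_le: "l2_inner h h \<le> u * \<sigma>"
  proof -
    define w where "w = (\<lambda>x. \<Sum>m\<in>?A. c m * wave (endpt (fst m)) (endpt (Suc (fst m))) (- phase (snd m) - pi / 2) x)"
    have "h = (\<lambda>x. w (- x))" by (simp add: h_def w_def dual_fun_def)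
    then have "l2_inner h h = l2_inner w w" by (simp only: l2_inner_reflect)
    also have "\<dots> \<le> u * \<sigma>"
      unfolding u_def \<sigma>_def w_def
    proof (rule combination_norm_le)
      show "cos (- phase i - pi / 2 - (- phase i' - pi / 2)) = (if i = i' then 1 else 0)" if "i < 2" "i' < 2" for i i'
        using cos_phase_diff[OF that(2,1)] by auto
    qed
    finally show ?thesis .
  qed
  have "v * \<sigma> \<le> (LINT x|lborel. sinc_conv f x * h x)"
    unfolding v_def \<sigma>_def f h_def by (rule pairing_ge[OF l])
  then have "(v * \<sigma>)\<^sup>2 \<le> (LINT x|lborel. sinc_conv f x * h x)\<^sup>2"
    using uv \<sigma> by (intro power_mono) auto
  also have "\<dots> \<le> l2_inner h h * D" unfolding D_def by (rule exterior_energy_le[OF l_pos fV hV])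
  finally have key: "(v * \<sigma>)\<^sup>2 \<le> l2_inner h h * D" .
  have D_nonneg: "0 \<le> D"
  proof -
    have "0 < (v * \<sigma>)\<^sup>2" using uv \<sigma> by simp
    then have "0 < l2_inner h h * D" using key by linarith
    then show ?thesis using sqint.ip_nonneg[OF hV] by (simp add: zero_less_mult_iff)
  qed
  have u: "0 < u" using scale_step_gt by (simp add: u_def)
  have "3 / 16 * u * \<sigma> * (u * \<sigma>) = (3 / 16 * u\<^sup>2) * \<sigma>\<^sup>2" by (simp add: power2_eq_square)
  also have "\<dots> < v\<^sup>2 * \<sigma>\<^sup>2" using uv \<sigma> by (intro mult_strict_right_mono) auto
  also have "\<dots> = (v * \<sigma>)\<^sup>2" by (simp add: power_mult_distrib)
  also have "\<dots> \<le> D * (u * \<sigma>)" using key mult_right_mono[OF h_le D_nonneg] by (simp add: mult.commute)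
  finally have "3 / 16 * u * \<sigma> < D" using u \<sigma> by simp
  then show ?thesis using f_le by (simp add: D_def)
qed

lemma plunge_count_ge:
  assumes l: "0 < l" and K: "K = 0 \<or> endpt K \<le> l"
  shows "2 * K \<le> card {n. eigenvalue l n \<in> {1/4<..<3/4}}"
proof (cases "K = 0")
  case False
  then have Kl: "endpt K \<le> l" using K by simp
  interpret sinc: compact_positive_contraction "sqint 0 l" l2_inner "sinc_op 0 l"
    by (rule sinc_compact_positive_contraction[OF l])
  obtain e lam where sys: "sinc.eigensystem e lam" using sinc.eigensystem_exists by blast
  have "card (test_index K) \<le> card {n. 3 / 16 < lam n - (lam n)\<^sup>2}"
    using test_fun_sqint(1)[OF _ Kl] test_space_defect[OF Kl]
    by (intro sinc.card_test_functions_le[OF sys, of _ _ test_fun]) (auto simp: test_index_def)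
  moreover have iff: "3 / 16 < t - t\<^sup>2 \<longleftrightarrow> t \<in> {1/4<..<3/4}" for t :: real
  proof -
    have "t - t\<^sup>2 - 3 / 16 = (t - 1/4) * (3/4 - t)" by (simp add: power2_eq_square field_simps)
    moreover have "0 < (t - 1/4) * (3/4 - t) \<longleftrightarrow> t \<in> {1/4<..<3/4}" by (auto simp: zero_less_mult_iff)
    ultimately show ?thesis by linarith
  qed
  ultimately show ?thesis
    unfolding eigenvalue_eq[OF l sys] iff by (simp add: test_index_def mult.commute)
qed simp

text \<open>
  The blocks up to scale \<open>l\<close> number \<open>ln l / T\<close> up to rounding, one of them being given up at the bottom; with two functions per
  block the loss is at most 4.
\<close>

theorem theorem6p4:
  "\<exists>C0 :: real. \<forall>l :: real. l > 0 \<longrightarrow>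
     real (card {n. eigenvalue l n \<in> {1/4<..<3/4}}) \<ge> 8 / (15 * pi\<^sup>2) * ln l - C0"
proof (intro exI[of _ 4] allI impI)
  fix l :: real
  assume l: "0 < l"
  define K where "K = nat (\<lfloor>ln l / scale_step\<rfloor> - 1)"
  have T: "0 < scale_step" using scale_step_gt by simp
  have "K = 0 \<or> endpt K \<le> l"
  proof (cases "K = 0")
    case False
    then have "real K + 1 = of_int \<lfloor>ln l / scale_step\<rfloor>" by (simp add: K_def)
    then have "real K + 1 \<le> ln l / scale_step" by simp
    then have "scale_step * (real K + 1) \<le> ln l" using T by (simp add: pos_le_divide_eq mult.commute)
    then show ?thesis unfolding endpt_def using l by (simp add: ln_ge_iff)
  qed simp
  then have "real (2 * K) \<le> real (card {n. eigenvalue l n \<in> {1/4<..<3/4}})"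
    using plunge_count_ge[OF l] by (simp only: of_nat_le_iff)
  moreover have "ln l / scale_step - 2 \<le> real K" unfolding K_def by linarith
  moreover have "8 / (15 * pi\<^sup>2) * ln l = 2 * (ln l / scale_step)" by (simp add: scale_step_def)
  ultimately show "real (card {n. eigenvalue l n \<in> {1/4<..<3/4}}) \<ge> 8 / (15 * pi\<^sup>2) * ln l - 4" by simp
qed

end
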